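(* Let $s\in\mathbb N$, let $\lambda_0,\dots,\lambda_{\lceil s/2\rceil-1}>0$ and let $n\in\mathbb N_0$. The polynomials $\{Q^{-s,n}_{j,\ell}:0\le j\le n/2,\ 1\le\ell\le a^d_{n-2j}\}$ form a mutually orthogonal basis of $\mathcal V^d_n(\varpi_{-s})$. More precisely, for all $n,n'\in\mathbb N_0$ and admissible indices, $$\langle Q^{-s,n}_{j,\ell},Q^{-s,n'}_{j',\ell'}\rangle_{-s}=h^{-s}_{j,n}\,\delta_{n,n'}\delta_{j,j'}\delta_{\ell,\ell'},$$ where $h^{-s}_{j,n}=2^{2s-1}d\,(n+\tfrac d2-s)_s\,(n+\tfrac d2-s+1)_{s-1}$ if $j\ge\lceil s/2\rceil$; $h^{-s}_{j,n}=d(n-2j)+\lambda_j$ if $j=\frac{s-1}{2}$; and $h^{-s}_{j,n}=\lambda_j$ if $0\le j<\frac{s-1}2$.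
   Context: $\mathbb B^d$ unit ball, $\mathbb S^{d-1}$ unit sphere, $\omega_d$ its area; $\langle f,g\rangle_{\mathbb B^d}=\frac1{\mathrm{vol}(\mathbb B^d)}\int_{\mathbb B^d}fg\,dx$, $\langle f,g\rangle_{\mathbb S^{d-1}}=\frac1{\omega_d}\int fg\,d\sigma$. $(a)_0=1$, $(a)_m=a(a+1)\cdots(a+m-1)$. $\nabla^{2m}=\Delta^m$, $\nabla^{2m+1}=\nabla\Delta^m$ with $\langle\nabla^{2m+1}f,\nabla^{2m+1}g\rangle_{\mathbb B^d}=\sum_i\langle\partial_i\Delta^mf,\partial_i\Delta^mg\rangle_{\mathbb B^d}$; $\langle f,g\rangle_{-s}=\langle\nabla^sf,\nabla^sg\rangle_{\mathbb B^d}+\sum_{k=0}^{\lceil s/2\rceil-1}\lambda_k\langle\Delta^kf,\Delta^kg\rangle_{\mathbb S^{d-1}}$. $\Pi^d_n$: polynomials of degree $\le n$; $\mathcal V^d_n(\varpi_{-s})=\{P\in\Pi^d_n:\langle P,Q\rangle_{-s}=0\ \forall Q\in\Pi^d_{n-1}\}$. $\mathcal H^d_m$: homogeneous harmonic polynomials of degree $m$, $a^d_m=\dim\mathcal H^d_m$, $\{Y^m_\ell\}_{\ell=1}^{a^d_m}$ a basis orthonormal for $\langle\cdot,\cdot\rangle_{\mathbb S^{d-1}}$. Generalized Jacobi polynomials: for $\alpha,\beta\in\mathbb R$, $j\in\mathbb N_0$, let $j_0=-j-\alpha-\beta$ if this number lies in $\{1,\dots,j\}$ and $j_0=0$ otherwise;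 $\widehat P^{(\alpha,\beta)}_j(t)=\sum_{k=j_0}^j\frac{(k+\alpha+1)_{j-k}}{(j-k)!\,k!\,(j+\alpha+\beta+k+1)_{j-k}}\big(\frac{t-1}2\big)^k$. For $\mu\in\mathbb R$, $0\le j\le n/2$, $1\le\ell\le a^d_{n-2j}$: $P^{\mu,n}_{j,\ell}(x)=(n-j+\tfrac d2)_j\,\widehat P^{(\mu,n-2j+\frac d2-1)}_j(2\|x\|^2-1)\,Y^{n-2j}_\ell(x)$. For $m,j\in\mathbb N_0$ let $(c_i^{m,j})_{0\le i\le j}$ be the unique solution of $4^k\sum_{i=k}^j(-i)_k(-k)_{i-k}\frac{(m+d/2)_k}{(m+d/2)_{i-k}}c_i=\delta_{k,j}$, $0\le k\le j$, and $Y^{m,j}_\ell(x)=\sum_{i=0}^jc^{m,j}_i(1-\|x\|^2)^iY^m_\ell(x)$. Define $Q^{-s,n}_{j,\ell}$: if $j\ge s$, $Q^{-s,n}_{j,\ell}=P^{-s,n}_{j,\ell}$; if $\lceil s/2\rceil\le j\le s-1$, $Q^{-s,n}_{j,\ell}=P^{-s,n}_{j,\ell}-\sum_{k=0}^{\lceil s/2\rceil-1}\gamma_kY^{n-2j,k}_\ell$, where $\gamma_k$ is the constant with $\Delta^kP^{-s,n}_{j,\ell}(\xi)=\gamma_kY^{n-2j}_\ell(\xi)$ for all $\xi\in\mathbb S^{d-1}$ (note $\Delta^kP^{-s,n}_{j,\ell}(x)=q(\|x\|^2)Y^{n-2j}_\ell(x)$ for a univariate polynomial $q$, and $\gamma_k=q(1)$);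 if $0\le j\le\lceil s/2\rceil-1$, $Q^{-s,n}_{j,\ell}=Y^{n-2j,j}_\ell$. *)

theory Defs
  imports "HOL-Analysis.Analysis"
begin

definition monom :: "('n::finite \<Rightarrow> nat) \<Rightarrow> real ^ 'n \<Rightarrow> real" where
  "monom \<alpha> x = (\<Prod>i\<in>UNIV. (x $ i) ^ (\<alpha> i))"

definition mdeg :: "('n::finite \<Rightarrow> nat) \<Rightarrow> nat" where
  "mdeg \<alpha> = (\<Sum>i\<in>UNIV. \<alpha> i)"

definition polys_below :: "nat \<Rightarrow> (real ^ 'n::finite \<Rightarrow> real) set" where
  "polys_below n = {f. \<exists>c. f = (\<lambda>x. \<Sum>\<alpha>\<in>{\<alpha>. mdeg \<alpha> < n}. c \<alpha> * monom \<alpha> x)}"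

definition Pi_d :: "nat \<Rightarrow> (real ^ 'n::finite \<Rightarrow> real) set" where
  "Pi_d n = polys_below (Suc n)"

definition homog_polys :: "nat \<Rightarrow> (real ^ 'n::finite \<Rightarrow> real) set" where
  "homog_polys m = {f. \<exists>c. f = (\<lambda>x. \<Sum>\<alpha>\<in>{\<alpha>. mdeg \<alpha> = m}. c \<alpha> * monom \<alpha> x)}"

definition partial :: "'n::finite \<Rightarrow> (real ^ 'n \<Rightarrow> real) \<Rightarrow> real ^ 'n \<Rightarrow> real" where
  "partial i f x = frechet_derivative f (at x) (axis i 1)"

definition laplacian :: "(real ^ 'n::finite \<Rightarrow> real) \<Rightarrow> real ^ 'n \<Rightarrow> real" where
  "laplacian f x = (\<Sum>i\<in>UNIV. partial i (partial i f) x)"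

definition harm_polys :: "nat \<Rightarrow> (real ^ 'n::finite \<Rightarrow> real) set" where
  "harm_polys m = {f \<in> homog_polys m. laplacian f = (\<lambda>x. 0)}"

definition ball_ip :: "(real ^ 'n::finite \<Rightarrow> real) \<Rightarrow> (real ^ 'n \<Rightarrow> real) \<Rightarrow> real" where
  "ball_ip f g = (LINT x:ball 0 1|lborel. f x * g x) / measure lborel (ball (0::real^'n) 1)"

(* <f,g>_S = (1/omega_d) int_S f g dsigma, written via polar coordinates
   (normalized surface measure = push-forward of normalized volume on B under x |-> x/|x|) *)
definition sph_ip :: "(real ^ 'n::finite \<Rightarrow> real) \<Rightarrow> (real ^ 'n \<Rightarrow> real) \<Rightarrow> real" where
  "sph_ip f g = (LINT x:ball 0 1|lborel. f (sgn x) * g (sgn x)) / measure lborel (ball (0::real^'n) 1)"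

definition nabla_ip :: "nat \<Rightarrow> (real ^ 'n::finite \<Rightarrow> real) \<Rightarrow> (real ^ 'n \<Rightarrow> real) \<Rightarrow> real" where
  "nabla_ip s f g =
     (if even s then ball_ip ((laplacian ^^ (s div 2)) f) ((laplacian ^^ (s div 2)) g)
      else (\<Sum>i\<in>UNIV. ball_ip (partial i ((laplacian ^^ (s div 2)) f))
                                (partial i ((laplacian ^^ (s div 2)) g))))"

definition ceil_half :: "nat \<Rightarrow> nat" where
  "ceil_half s = (s + 1) div 2"

definition sob_ip :: "nat \<Rightarrow> (nat \<Rightarrow> real) \<Rightarrow> (real ^ 'n::finite \<Rightarrow> real) \<Rightarrow> (real ^ 'n \<Rightarrow> real) \<Rightarrow> real" where
  "sob_ip s lam f g = nabla_ip s f g +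
     (\<Sum>k<ceil_half s. lam k * sph_ip ((laplacian ^^ k) f) ((laplacian ^^ k) g))"

definition V_space :: "nat \<Rightarrow> (nat \<Rightarrow> real) \<Rightarrow> nat \<Rightarrow> (real ^ 'n::finite \<Rightarrow> real) set" where
  "V_space s lam n = {P \<in> Pi_d n. \<forall>Q \<in> polys_below n. sob_ip s lam P Q = 0}"

definition j0_gen :: "real \<Rightarrow> real \<Rightarrow> nat \<Rightarrow> nat" where
  "j0_gen \<alpha> \<beta> j = (let r = - real j - \<alpha> - \<beta> in
      if r \<in> \<int> \<and> 1 \<le> r \<and> r \<le> real j then nat \<lfloor>r\<rfloor> else 0)"

definition gen_jacobi :: "real \<Rightarrow> real \<Rightarrow> nat \<Rightarrow> real \<Rightarrow> real" where
  "gen_jacobi \<alpha> \<beta> j t = (\<Sum>k = j0_gen \<alpha> \<beta> j..j.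
      pochhammer (real k + \<alpha> + 1) (j - k)
      / (fact (j - k) * fact k * pochhammer (real j + \<alpha> + \<beta> + real k + 1) (j - k))
      * ((t - 1) / 2) ^ k)"

definition P_poly :: "(nat \<Rightarrow> nat \<Rightarrow> real ^ 'n::finite \<Rightarrow> real) \<Rightarrow> real \<Rightarrow> nat \<Rightarrow> nat \<Rightarrow> nat \<Rightarrow> real ^ 'n \<Rightarrow> real" where
  "P_poly Y \<mu> n j l x = (let d = real CARD('n) in
      pochhammer (real n - real j + d / 2) j
      * gen_jacobi \<mu> (real n - 2 * real j + d / 2 - 1) j (2 * (norm x)\<^sup>2 - 1)
      * Y (n - 2 * j) l x)"

definition c_coef :: "'n::finite itself \<Rightarrow> nat \<Rightarrow> nat \<Rightarrow> nat \<Rightarrow> real" where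
  "c_coef _ m j = (THE c. (\<forall>k\<le>j.
        4 ^ k * (\<Sum>i = k..j. pochhammer (- real i) k * pochhammer (- real k) (i - k)
            * pochhammer (real m + real CARD('n) / 2) k
            / pochhammer (real m + real CARD('n) / 2) (i - k) * c i)
        = (if k = j then 1 else 0)) \<and> (\<forall>i>j. c i = 0))"

definition Y_mj :: "(nat \<Rightarrow> nat \<Rightarrow> real ^ 'n::finite \<Rightarrow> real) \<Rightarrow> nat \<Rightarrow> nat \<Rightarrow> nat \<Rightarrow> real ^ 'n \<Rightarrow> real" where
  "Y_mj Y m j l x = (\<Sum>i\<le>j. c_coef TYPE('n) m j i * (1 - (norm x)\<^sup>2) ^ i * Y m l x)"

definition gamma_const :: "(real ^ 'n::finite \<Rightarrow> real) \<Rightarrow> (real ^ 'n \<Rightarrow> real) \<Rightarrow> nat \<Rightarrow> real" where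
  "gamma_const P Yml k = (THE \<gamma>. \<forall>\<xi>\<in>sphere 0 1. (laplacian ^^ k) P \<xi> = \<gamma> * Yml \<xi>)"

definition Q_poly :: "(nat \<Rightarrow> nat \<Rightarrow> real ^ 'n::finite \<Rightarrow> real) \<Rightarrow> nat \<Rightarrow> nat \<Rightarrow> nat \<Rightarrow> nat \<Rightarrow> real ^ 'n \<Rightarrow> real" where
  "Q_poly Y s n j l =
     (if s \<le> j then P_poly Y (- real s) n j l
      else if ceil_half s \<le> j then
        (\<lambda>x. P_poly Y (- real s) n j l x
             - (\<Sum>k<ceil_half s. gamma_const (P_poly Y (- real s) n j l) (Y (n - 2 * j) l) k
                                  * Y_mj Y (n - 2 * j) k l x))
      else Y_mj Y (n - 2 * j) j l)"

definition h_const :: "'n::finite itself \<Rightarrow> nat \<Rightarrow> (nat \<Rightarrow> real) \<Rightarrow> nat \<Rightarrow> nat \<Rightarrow> real" where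
  "h_const _ s lam j n = (let d = real CARD('n) in
     if ceil_half s \<le> j then
       2 ^ (2 * s - 1) * d * pochhammer (real n + d / 2 - real s) s
         * pochhammer (real n + d / 2 - real s + 1) (s - 1)
     else if 2 * real j = real s - 1 then d * (real n - 2 * real j) + lam j
     else lam j)"

(* {Y m l : 1 <= l <= a m} is an orthonormal basis of H^d_m (w.r.t. <.,.>_S) for every m;
   this forces a m = dim H^d_m = a^d_m *)
definition sph_harm_onb :: "(nat \<Rightarrow> nat) \<Rightarrow> (nat \<Rightarrow> nat \<Rightarrow> real ^ 'n::finite \<Rightarrow> real) \<Rightarrow> bool" where
  "sph_harm_onb a Y \<longleftrightarrow> (\<forall>m.
      (\<forall>l\<in>{1..a m}. Y m l \<in> harm_polys m) \<and>
      (\<forall>l\<in>{1..a m}. \<forall>l'\<in>{1..a m}. sph_ip (Y m l) (Y m l') = (if l = l' then 1 else 0)) \<and>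
      (\<forall>f\<in>harm_polys m. \<exists>c. f = (\<lambda>x. \<Sum>l=1..a m. c l * Y m l x)))"

end

theory Submission
  imports Defs "HOL-Computational_Algebra.Polynomial"
begin

text \<open>All functions in question are sums of terms $p(\|x\|^2)\,Y(x)$ with $Y$ harmonic and homogeneous of degree $m$.
  The Laplacian acts on the factor $p$ alone, and terms with orthogonal $Y$ are orthogonal, so for fixed $Y$
  everything is about polynomials on $[0,1]$ with the weight $u^{m+d/2-1}$. The polynomials $Q_j$ are made so that
  $(\Delta^k Q_j)|_{\mathbb S^{d-1}} = \delta_{jk} Y$ for $k < \lceil s/2 \rceil$. For small $j$ the volume term sees at
  most a constant, which leaves only boundary terms; for the other $j$ only the volume term survives, and
  $\Delta^{\lfloor s/2\rfloor}$ (followed by a derivative if $s$ is odd) turns the radial factor into a multiple of a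
  Jacobi polynomial of parameter $(0,\cdot)$, whose orthogonality and norm come from the Chu--Vandermonde identity.
  Each $Q_j$ has a radial factor of exact degree $j$, so the decomposition of a polynomial into
  $\|x\|^{2j}$ times harmonics shows that they span.\<close>

section \<open>Polynomials in several variables\<close>

text \<open>The form \<open>sph_ip\<close> is given as an integral over the ball, so there is no
  surface measure and no Green formula to start from. Integration by parts is done against the
  weight (1 - |x|^2)^2, which vanishes on the sphere together with its gradient; homogeneity of the
  integrands then turns identities of weighted ball integrals into identities of spherical averages.
  Radial factors are expanded in powers of |x|^2 - 1 and not of |x|^2, because the value on the
  sphere is then the constant coefficient and the generalized Jacobi polynomials are given in this
  variable. The price is that the Laplacian maps a power to two powers, whence the binomial
  coefficients in the system for the c_i. Powers of |x|^2 return where they are better suited: they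
  shift the weight parameter of the moments by one, and the Laplacian maps each to a single
  power.\<close>

lemma finite_mdeg_le: "finite {\<alpha>::'n::finite \<Rightarrow> nat. mdeg \<alpha> \<le> m}"
proof (rule finite_subset)
  show "{\<alpha>::'n \<Rightarrow> nat. mdeg \<alpha> \<le> m} \<subseteq> PiE UNIV (\<lambda>_. {..m})"
  proof
    fix \<alpha> :: "'n \<Rightarrow> nat" assume "\<alpha> \<in> {\<alpha>. mdeg \<alpha> \<le> m}"
    moreover have "\<alpha> i \<le> mdeg \<alpha>" for i
      unfolding mdeg_def by (rule member_le_sum) auto
    ultimately show "\<alpha> \<in> PiE UNIV (\<lambda>_. {..m})"
      by (auto intro: order_trans)
  qed
  show "finite (PiE (UNIV::'n set) (\<lambda>_. {..m}))"
    by (rule finite_PiE) auto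
qed

lemma finite_mdeg_eq: "finite {\<alpha>::'n::finite \<Rightarrow> nat. mdeg \<alpha> = m}"
  by (rule finite_subset[OF _ finite_mdeg_le[of m]]) auto

lemma mdeg_upd_Suc: "mdeg (\<alpha>(i := Suc (\<alpha> i))) = Suc (mdeg \<alpha>)"
  unfolding mdeg_def by (subst (1 2) sum.remove[of _ i]) auto

lemma monom_upd_Suc: "Defs.monom (\<alpha>(i := Suc (\<alpha> i))) x = x $ i * Defs.monom \<alpha> x"
  unfolding monom_def by (subst (1 2) prod.remove[of _ i]) (auto simp: mult.assoc)

text \<open>Building homogeneous polynomials by one coordinate factor at a time gives an induction
  in which the product rule, Euler's identity and degree counts need one short case each. Sums over
  multi-indices would have to be reindexed every time.\<close>

inductive homog_poly :: "nat \<Rightarrow> (real ^ 'n::finite \<Rightarrow> real) \<Rightarrow> bool" where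
  const: "homog_poly 0 (\<lambda>x. c)"
| zero: "homog_poly m (\<lambda>x. 0)"
| add: "homog_poly m f \<Longrightarrow> homog_poly m g \<Longrightarrow> homog_poly m (\<lambda>x. f x + g x)"
| coord: "homog_poly m f \<Longrightarrow> homog_poly (Suc m) (\<lambda>x. x $ i * f x)"

lemma homog_poly_scale: "homog_poly m f \<Longrightarrow> homog_poly m (\<lambda>x. c * f x)"
proof (induction rule: homog_poly.induct)
  case (const c')
  show ?case by (rule homog_poly.const)
next
  case (coord m f i)
  from homog_poly.coord[OF coord.IH, of i] show ?case by (simp add: mult.left_commute)
qed (auto simp: distrib_left intro: homog_poly.intros)

lemma homog_poly_sum: "(\<And>i. i \<in> A \<Longrightarrow> homog_poly m (f i)) \<Longrightarrow> homog_poly m (\<lambda>x. \<Sum>i\<in>A. f i x)"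
  by (induction A rule: infinite_finite_induct) (auto intro: homog_poly.intros)

lemma homog_poly_monom: "homog_poly (mdeg \<alpha>) (Defs.monom \<alpha>)"
proof (induction "mdeg \<alpha>" arbitrary: \<alpha>)
  case 0
  then have "\<alpha> i = 0" for i by (simp add: mdeg_def)
  then have "Defs.monom \<alpha> = (\<lambda>x. 1)" by (simp add: monom_def fun_eq_iff)
  then show ?case using homog_poly.const[of 1] 0 by simp
next
  case (Suc m)
  have "\<exists>i. \<alpha> i \<noteq> 0"
  proof (rule ccontr)
    assume "\<not> ?thesis" then show False using Suc by (simp add: mdeg_def)
  qed
  then obtain i where i: "\<alpha> i \<noteq> 0" by blast
  define \<beta> where "\<beta> = \<alpha>(i := \<alpha> i - 1)"
  have \<alpha>: "\<alpha> = \<beta>(i := Suc (\<beta> i))" using i by (auto simp: \<beta>_def)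
  have "mdeg \<alpha> = Suc (mdeg \<beta>)" by (subst \<alpha>, rule mdeg_upd_Suc)
  with Suc have "m = mdeg \<beta>" by simp
  have "Defs.monom \<alpha> = (\<lambda>x. x $ i * Defs.monom \<beta> x)"
    by (subst \<alpha>) (simp add: monom_upd_Suc fun_eq_iff del: fun_upd_apply)
  with homog_poly.coord[OF Suc(1)[OF \<open>m = mdeg \<beta>\<close>], of i] \<open>m = mdeg \<beta>\<close>
  show ?case by (simp flip: \<open>Suc m = mdeg \<alpha>\<close>)
qed

lemma homog_polys_add:
  assumes "f \<in> homog_polys m" "g \<in> homog_polys m"
  shows "(\<lambda>x. f x + g x) \<in> homog_polys m"
proof -
  from assms obtain c c' where
    "f = (\<lambda>x. \<Sum>\<alpha>\<in>{\<alpha>. mdeg \<alpha> = m}. c \<alpha> * Defs.monom \<alpha> x)"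
    "g = (\<lambda>x. \<Sum>\<alpha>\<in>{\<alpha>. mdeg \<alpha> = m}. c' \<alpha> * Defs.monom \<alpha> x)"
    by (auto simp: homog_polys_def)
  then have "(\<lambda>x. f x + g x) = (\<lambda>x. \<Sum>\<alpha>\<in>{\<alpha>. mdeg \<alpha> = m}. (c \<alpha> + c' \<alpha>) * Defs.monom \<alpha> x)"
    by (simp add: sum.distrib distrib_right)
  then show ?thesis unfolding homog_polys_def by (intro CollectI exI[of _ "\<lambda>\<alpha>. c \<alpha> + c' \<alpha>"])
qed

lemma homog_polys_zero: "(\<lambda>x. 0) \<in> homog_polys m"
  unfolding homog_polys_def by (intro CollectI exI[of _ "\<lambda>_. 0"]) simp

lemma homog_polys_sum:
  "(\<And>i. i \<in> A \<Longrightarrow> f i \<in> homog_polys m) \<Longrightarrow> (\<lambda>x. \<Sum>i\<in>A. f i x) \<in> homog_polys m"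
  by (induction A rule: infinite_finite_induct) (auto intro: homog_polys_add homog_polys_zero)

lemma homog_polys_monom: "mdeg \<alpha> = m \<Longrightarrow> (\<lambda>x. c * Defs.monom \<alpha> x) \<in> homog_polys m"
  unfolding homog_polys_def
  by (intro CollectI exI[of _ "\<lambda>\<beta>. if \<beta> = \<alpha> then c else 0"])
     (simp add: if_distrib[of "\<lambda>c. c * _"] finite_mdeg_eq cong: if_cong)

lemma homog_poly_iff_homog: "f \<in> homog_polys m \<longleftrightarrow> homog_poly m f"
proof
  assume "f \<in> homog_polys m"
  then obtain c where "f = (\<lambda>x. \<Sum>\<alpha>\<in>{\<alpha>. mdeg \<alpha> = m}. c \<alpha> * Defs.monom \<alpha> x)"
    by (auto simp: homog_polys_def)
  moreover have "homog_poly m (\<lambda>x. \<Sum>\<alpha>\<in>{\<alpha>. mdeg \<alpha> = m}. c \<alpha> * Defs.monom \<alpha> x)"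
    using homog_poly_monom by (intro homog_poly_sum homog_poly_scale) auto
  ultimately show "homog_poly m f" by simp
next
  assume "homog_poly m f"
  then show "f \<in> homog_polys m"
  proof (induction rule: homog_poly.induct)
    case (const c)
    have "(\<lambda>x. c * Defs.monom (\<lambda>_. 0) x) \<in> homog_polys 0"
      by (rule homog_polys_monom) (simp add: mdeg_def)
    then show ?case by (simp add: monom_def)
  next
    case (coord m f i)
    then obtain c where c: "f = (\<lambda>x. \<Sum>\<alpha>\<in>{\<alpha>. mdeg \<alpha> = m}. c \<alpha> * Defs.monom \<alpha> x)"
      by (auto simp: homog_polys_def)
    have "(\<lambda>x. \<Sum>\<alpha>\<in>{\<alpha>. mdeg \<alpha> = m}. c \<alpha> * Defs.monom (\<alpha>(i := Suc (\<alpha> i))) x) \<in> homog_polys (Suc m)"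
      by (intro homog_polys_sum homog_polys_monom) (simp add: mdeg_upd_Suc)
    then show ?case by (simp add: c monom_upd_Suc sum_distrib_left mult_ac)
  qed (auto intro: homog_polys_add homog_polys_zero)
qed

lemma polys_below_iff: "f \<in> polys_below n \<longleftrightarrow> (\<exists>h. (\<forall>k<n. homog_poly k (h k)) \<and> f = (\<lambda>x. \<Sum>k<n. h k x))"
proof
  assume "f \<in> polys_below n"
  then obtain c where c: "f = (\<lambda>x. \<Sum>\<alpha>\<in>{\<alpha>. mdeg \<alpha> < n}. c \<alpha> * Defs.monom \<alpha> x)"
    by (auto simp: polys_below_def)
  define h where "h k x = (\<Sum>\<alpha>\<in>{\<alpha>. mdeg \<alpha> = k}. c \<alpha> * Defs.monom \<alpha> x)" for k x
  have "homog_poly k (h k)" for k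
    unfolding homog_poly_iff_homog[symmetric] homog_polys_def h_def by blast
  moreover have "f x = (\<Sum>k<n. h k x)" for x
  proof -
    have "{\<alpha>::'a\<Rightarrow>nat. mdeg \<alpha> < n} = (\<Union>k<n. {\<alpha>. mdeg \<alpha> = k})" by auto
    then show ?thesis unfolding c h_def
      by (simp add: sum.UNION_disjoint finite_mdeg_eq disjoint_iff)
  qed
  ultimately show "\<exists>h. (\<forall>k<n. homog_poly k (h k)) \<and> f = (\<lambda>x. \<Sum>k<n. h k x)" by blast
next
  assume "\<exists>h. (\<forall>k<n. homog_poly k (h k)) \<and> f = (\<lambda>x. \<Sum>k<n. h k x)"
  then obtain h where h: "\<And>k. k < n \<Longrightarrow> h k \<in> homog_polys k" and f: "f = (\<lambda>x. \<Sum>k<n. h k x)"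
    by (auto simp: homog_poly_iff_homog)
  then have "\<forall>k. \<exists>c. k < n \<longrightarrow> h k = (\<lambda>x. \<Sum>\<alpha>\<in>{\<alpha>. mdeg \<alpha> = k}. c \<alpha> * Defs.monom \<alpha> x)"
    by (auto simp: homog_polys_def)
  then obtain c where c: "\<And>k. k < n \<Longrightarrow> h k = (\<lambda>x. \<Sum>\<alpha>\<in>{\<alpha>. mdeg \<alpha> = k}. c k \<alpha> * Defs.monom \<alpha> x)"
    by metis
  have "f x = (\<Sum>\<alpha>\<in>{\<alpha>. mdeg \<alpha> < n}. c (mdeg \<alpha>) \<alpha> * Defs.monom \<alpha> x)" for x
  proof -
    have eq: "{\<alpha>::'a\<Rightarrow>nat. mdeg \<alpha> < n} = (\<Union>k<n. {\<alpha>. mdeg \<alpha> = k})" by auto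
    have "f x = (\<Sum>k<n. \<Sum>\<alpha>\<in>{\<alpha>. mdeg \<alpha> = k}. c (mdeg \<alpha>) \<alpha> * Defs.monom \<alpha> x)"
      unfolding f by (intro sum.cong refl) (simp add: c)
    then show ?thesis unfolding eq
      by (subst sum.UNION_disjoint) (auto simp: finite_mdeg_eq)
  qed
  then show "f \<in> polys_below n" unfolding polys_below_def
    by (intro CollectI exI[of _ "\<lambda>\<alpha>. c (mdeg \<alpha>) \<alpha>"]) auto
qed

lemma homog_poly_mult: "homog_poly m f \<Longrightarrow> homog_poly k g \<Longrightarrow> homog_poly (m + k) (\<lambda>x. f x * g x)"
proof (induction rule: homog_poly.induct)
  case (coord m f i)
  from homog_poly.coord[OF coord.IH[OF coord.prems], of i] show ?case by (simp add: mult.assoc)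
qed (auto simp: distrib_right intro: homog_poly.intros homog_poly_scale)

lemma homog_poly_normsq: "homog_poly 2 (\<lambda>x::real^'n::finite. (norm x)\<^sup>2)"
proof -
  have "(\<lambda>x::real^'n. (norm x)\<^sup>2) = (\<lambda>x. \<Sum>i\<in>UNIV. x $ i * (x $ i * 1))"
    by (auto simp: fun_eq_iff power2_norm_eq_inner inner_vec_def)
  moreover have "homog_poly 2 (\<lambda>x::real^'n. \<Sum>i\<in>UNIV. x $ i * (x $ i * 1))"
    unfolding numeral_2_eq_2 by (intro homog_poly_sum homog_poly.coord homog_poly.const)
  ultimately show ?thesis by simp
qed

lemma homog_poly_normsq_power: "homog_poly (2 * j) (\<lambda>x. ((norm x)\<^sup>2) ^ j)"
proof (induction j)
  case 0 then show ?case by (simp add: homog_poly.const)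
next
  case (Suc j) from homog_poly_mult[OF homog_poly_normsq this] show ?case by simp
qed

lemma homog_poly_scaleR: "homog_poly m f \<Longrightarrow> f (c *\<^sub>R x) = c ^ m * f x"
  by (induction rule: homog_poly.induct) (auto simp: algebra_simps)

text \<open>Separates the radial from the spherical dependence. It holds at the origin too:
  \<open>sgn 0 = 0\<close>, and degree 0 is covered by \<open>0 ^ 0 = 1\<close>.\<close>

lemma homog_poly_sgn: "homog_poly m f \<Longrightarrow> f x = norm x ^ m * f (sgn x)"
  using homog_poly_scaleR[of m f "norm x" "sgn x"] by (simp add: sgn_div_norm)
    (metis (no_types, lifting) norm_eq_zero right_inverse scaleR_one scaleR_zero_right scaleR_scaleR)

lemma homog_poly_poly_fun: "homog_poly m f \<Longrightarrow> real_polynomial_function f"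
proof (induction rule: homog_poly.induct)
  case (coord m f i)
  have "real_polynomial_function (\<lambda>x::real^'a. x $ i)"
    by (rule real_polynomial_function.intros(1)) (rule bounded_linear_vec_nth)
  then show ?case using coord by (intro real_polynomial_function.intros(4))
qed (auto intro: real_polynomial_function.intros)

section \<open>Differentiation of polynomial functions\<close>

lemma poly_fun_coord: "real_polynomial_function (\<lambda>x::real^'n::finite. x $ i)"
  by (rule real_polynomial_function.intros(1)) (rule bounded_linear_vec_nth)

lemma poly_fun_continuous: "real_polynomial_function f \<Longrightarrow> continuous_on A f"
  by (simp add: continuous_at_imp_continuous_on continuous_real_polymonial_function)

text \<open>\<open>partial\<close> rests on \<open>frechet_derivative\<close>, a choice operator
  that carries no information where a function is not differentiable. The sum and product rules
  below therefore assume polynomial functions and obtain differentiability from here.\<close>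

lemma poly_fun_has_derivative:
  fixes f :: "real^'n::finite \<Rightarrow> real"
  assumes "real_polynomial_function f"
  shows "(f has_derivative frechet_derivative f (at x)) (at x)"
proof -
  have "f differentiable (at x)" using assms
    by (induction rule: real_polynomial_function.induct) (auto intro: bounded_linear_imp_differentiable)
  then show ?thesis by (simp add: frechet_derivative_works)
qed

lemma partial_eqI: "(f has_derivative f') (at x) \<Longrightarrow> partial i f x = f' (axis i 1)"
  unfolding partial_def using frechet_derivative_at by metis

lemma partial_const: "partial i (\<lambda>x. c) = (\<lambda>x. 0)"
  by (rule ext, subst partial_eqI[of _ "\<lambda>_. 0"]) auto

lemma partial_coord: "partial i (\<lambda>x. x $ k) = (\<lambda>x. if i = k then 1 else 0)"
  by (rule ext, subst partial_eqI[of _ "\<lambda>h. h $ k"])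
     (auto intro: bounded_linear_imp_has_derivative bounded_linear_vec_nth simp: axis_def)

lemma partial_add:
  assumes "real_polynomial_function f" "real_polynomial_function g"
  shows "partial i (\<lambda>x. f x + g x) = (\<lambda>x. partial i f x + partial i g x)"
  by (rule ext, subst partial_eqI[OF has_derivative_add[OF assms[THEN poly_fun_has_derivative]]])
     (simp add: partial_def)

lemma partial_mult:
  assumes "real_polynomial_function f" "real_polynomial_function g"
  shows "partial i (\<lambda>x. f x * g x) = (\<lambda>x. partial i f x * g x + f x * partial i g x)"
  by (rule ext, subst partial_eqI[OF has_derivative_mult[OF assms[THEN poly_fun_has_derivative]]])
     (simp add: partial_def)

lemma partial_cmult:
  assumes "real_polynomial_function f"
  shows "partial i (\<lambda>x. c * f x) = (\<lambda>x. c * partial i f x)"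
  using partial_mult[of "\<lambda>x. c" f i] assms by (auto simp: partial_const real_polynomial_function.intros)

lemma poly_fun_partial: "real_polynomial_function f \<Longrightarrow> real_polynomial_function (partial i f)"
proof (induction rule: real_polynomial_function.induct)
  case (linear f)
  have "partial i f = (\<lambda>x. f (axis i 1))"
    by (rule ext, rule partial_eqI, rule bounded_linear_imp_has_derivative[OF linear])
  then show ?case by (simp add: real_polynomial_function.intros(2))
next
  case (const c) then show ?case by (simp add: partial_const real_polynomial_function.intros(2))
qed (auto simp: partial_add partial_mult intro!: real_polynomial_function.intros(3,4))

lemma poly_fun_sum: "(\<And>i. i \<in> A \<Longrightarrow> real_polynomial_function (f i)) \<Longrightarrow>
    real_polynomial_function (\<lambda>x. \<Sum>i\<in>A. f i x)"
  by (induction A rule: infinite_finite_induct) (auto intro: real_polynomial_function.intros)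

lemma poly_fun_laplacian: "real_polynomial_function f \<Longrightarrow> real_polynomial_function (laplacian f)"
  unfolding laplacian_def[abs_def] by (intro poly_fun_sum poly_fun_partial)

lemma poly_fun_laplacian_pow: "real_polynomial_function f \<Longrightarrow> real_polynomial_function ((laplacian ^^ k) f)"
  by (induction k) (auto intro: poly_fun_laplacian)

lemma laplacian_add:
  assumes "real_polynomial_function f" "real_polynomial_function g"
  shows "laplacian (\<lambda>x. f x + g x) = (\<lambda>x. laplacian f x + laplacian g x)"
  unfolding laplacian_def[abs_def] by (simp add: partial_add assms poly_fun_partial sum.distrib)

lemma laplacian_cmult:
  assumes "real_polynomial_function f"
  shows "laplacian (\<lambda>x. c * f x) = (\<lambda>x. c * laplacian f x)"
  unfolding laplacian_def[abs_def] by (simp add: partial_cmult assms poly_fun_partial sum_distrib_left)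

lemma laplacian_zero: "laplacian (\<lambda>x. 0) = (\<lambda>x. 0)"
  unfolding laplacian_def[abs_def] by (simp add: partial_const)

lemma laplacian_sum:
  assumes "\<And>t. t \<in> A \<Longrightarrow> real_polynomial_function (f t)"
  shows "laplacian (\<lambda>x. \<Sum>t\<in>A. f t x) = (\<lambda>x. \<Sum>t\<in>A. laplacian (f t) x)"
  using assms
proof (induction A rule: infinite_finite_induct)
  case (insert t A)
  then show ?case using laplacian_add[of "f t" "\<lambda>x. \<Sum>t\<in>A. f t x"]
    by (simp add: poly_fun_sum)
qed (auto simp: laplacian_zero)

text \<open>With truncated subtraction the degree claim at \<open>m = 0\<close> is too weak for the
  induction: a coordinate times the derivative must again have degree 0, which is true only because
  the derivative vanishes. Hence the first conjunct.\<close>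

lemma homog_poly_partial_aux:
  "homog_poly m f \<Longrightarrow> (m = 0 \<longrightarrow> partial i f = (\<lambda>x. 0)) \<and> homog_poly (m - 1) (partial i f)"
proof (induction rule: homog_poly.induct)
  case (coord m f k)
  have "partial i (\<lambda>x. x $ k * f x) = (\<lambda>x. (if i = k then 1 else 0) * f x + x $ k * partial i f x)"
    using coord by (simp add: partial_mult poly_fun_coord homog_poly_poly_fun partial_coord)
  moreover have "homog_poly m (\<lambda>x. (if i = k then 1 else 0) * f x + x $ k * partial i f x)"
  proof (cases m)
    case 0 then show ?thesis using coord by (auto intro: homog_poly_scale)
  next
    case (Suc m')
    then show ?thesis using coord homog_poly.coord[of m' "partial i f" k] by (auto intro: homog_poly.add homog_poly_scale homog_poly.zero)
  qed
  ultimately show ?case by simp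
qed (auto simp: partial_const partial_add homog_poly_poly_fun intro: homog_poly.intros)

lemma homog_poly_partial: "homog_poly m f \<Longrightarrow> homog_poly (m - 1) (partial i f)"
  using homog_poly_partial_aux by blast

lemma partial_homog_poly_0: "homog_poly 0 f \<Longrightarrow> partial i f = (\<lambda>x. 0)"
  using homog_poly_partial_aux by blast

lemma homog_poly_laplacian: "homog_poly m f \<Longrightarrow> homog_poly (m - 2) (laplacian f)"
  unfolding laplacian_def[abs_def]
  by (intro homog_poly_sum) (metis diff_diff_left homog_poly_partial one_add_one)

lemma homog_poly_laplacian_less_2:
  assumes "homog_poly m f" "m < 2"
  shows "laplacian f = (\<lambda>x. 0)"
proof -
  have "homog_poly 0 (partial i f)" for i using homog_poly_partial[OF assms(1), of i] assms(2) by simp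
  from partial_homog_poly_0[OF this] show ?thesis unfolding laplacian_def[abs_def] by simp
qed

lemma euler_homog_poly: "homog_poly m f \<Longrightarrow> (\<Sum>i\<in>UNIV. x $ i * partial i f x) = real m * f x"
proof (induction rule: homog_poly.induct)
  case (coord m f k)
  have eq: "partial i (\<lambda>x. x $ k * f x) x = (if i = k then f x else 0) + x $ k * partial i f x" for i
    using coord by (simp add: partial_mult poly_fun_coord homog_poly_poly_fun partial_coord)
  have "(\<Sum>i\<in>UNIV. x $ i * partial i (\<lambda>x. x $ k * f x) x) =
     (\<Sum>i\<in>UNIV. (if i = k then x $ i * f x else 0)) + x $ k * (\<Sum>i\<in>UNIV. x $ i * partial i f x)"
    unfolding eq sum_distrib_left sum.distrib[symmetric] by (intro sum.cong) (auto simp: algebra_simps)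
  also have "\<dots> = x $ k * f x + x $ k * (real m * f x)" by (simp add: coord)
  finally show ?case by (simp add: algebra_simps)
next
  case (add m f g)
  then show ?case by (simp add: partial_add homog_poly_poly_fun distrib_left sum.distrib)
qed (auto simp: partial_const)

section \<open>Integration over the ball\<close>

text \<open>Without the normalization, so that no integral identity carries the volume of the ball.
  The volume returns in \<open>ball_ip\<close> and \<open>sph_ip\<close> as the same
  divisor.\<close>

definition ball_int :: "(real ^ 'n::finite \<Rightarrow> real) \<Rightarrow> real" where
  "ball_int f = (LINT x:ball 0 1|lborel. f x)"

lemma set_integrable_ball_bounded:
  fixes f :: "real^'n::finite \<Rightarrow> real"
  assumes [measurable]: "f \<in> borel_measurable borel" and C: "\<And>x. norm x < 1 \<Longrightarrow> \<bar>f x\<bar> \<le> C"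
  shows "set_integrable lborel (ball 0 1) f"
  unfolding set_integrable_def
proof (rule Bochner_Integration.integrable_bound)
  show "integrable lborel (\<lambda>x::real^'n. indicator (ball 0 1) x * C)"
    using emeasure_bounded_finite[of "ball 0 1 :: (real^'n) set"]
    by (intro integrable_mult_left integrable_real_indicator) auto
  show "(\<lambda>x. indicator (ball 0 1) x *\<^sub>R f x) \<in> borel_measurable lborel"
    by (intro borel_measurable_scaleR borel_measurable_indicator) auto
  show "AE x in lborel. norm (indicator (ball 0 1) x *\<^sub>R f x) \<le> norm (indicator (ball 0 1) x * C :: real)"
    using C by (intro always_eventually allI) (force simp: indicator_def)
qed

lemma poly_fun_measurable:
  fixes f :: "real^'n::finite \<Rightarrow> real"
  shows "real_polynomial_function f \<Longrightarrow> f \<in> borel_measurable borel"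
  by (intro borel_measurable_continuous_onI poly_fun_continuous)

lemma set_integrable_poly_fun:
  fixes f :: "real^'n::finite \<Rightarrow> real"
  assumes "real_polynomial_function f"
  shows "set_integrable lborel (ball 0 1) f"
proof -
  have "bounded (f ` cball 0 1)"
    by (intro compact_imp_bounded compact_continuous_image poly_fun_continuous assms compact_cball)
  then obtain C where "\<forall>x\<in>cball 0 1. \<bar>f x\<bar> \<le> C"
    by (auto simp: bounded_iff)
  with assms show ?thesis by (intro set_integrable_ball_bounded[where C = C] poly_fun_measurable) auto
qed

lemma ball_int_add: "real_polynomial_function f \<Longrightarrow> real_polynomial_function g \<Longrightarrow>
    ball_int (\<lambda>x. f x + g x) = ball_int f + ball_int g"
  unfolding ball_int_def by (intro set_integral_add set_integrable_poly_fun)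

lemma ball_int_cmult: "ball_int (\<lambda>x. c * f x) = c * ball_int f"
  unfolding ball_int_def by simp

lemma ball_int_zero: "ball_int (\<lambda>x. 0) = 0"
  unfolding ball_int_def by (simp add: set_lebesgue_integral_def)

lemma ball_int_sum: "(\<And>t. t \<in> A \<Longrightarrow> real_polynomial_function (f t)) \<Longrightarrow>
    ball_int (\<lambda>x. \<Sum>t\<in>A. f t x) = (\<Sum>t\<in>A. ball_int (f t))"
  by (induction A rule: infinite_finite_induct) (auto simp: ball_int_zero ball_int_add poly_fun_sum)

text \<open>The substitution x = \<rho> y has Jacobian \<rho>^d, and \<open>g\<close> is constant
  along rays.\<close>

lemma ball_int_scaled_ball:
  fixes g :: "real^'n::finite \<Rightarrow> real"
  assumes [measurable]: "g \<in> borel_measurable borel" and g: "\<And>x c. c > 0 \<Longrightarrow> g (c *\<^sub>R x) = g x"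
    and \<rho>: "0 \<le> \<rho>"
  shows "(LINT x|lborel. indicator (ball 0 \<rho>) x * g x) = \<rho> ^ CARD('n) * ball_int g"
proof (cases "\<rho> = 0")
  case True then show ?thesis by simp
next
  case False
  with \<rho> have \<rho>: "\<rho> > 0" by simp
  have [measurable]: "(\<lambda>x::real^'n. indicator (ball 0 \<rho>) x * g x) \<in> borel_measurable borel"
    by (intro borel_measurable_times borel_measurable_indicator) auto
  have ind: "indicator (ball 0 \<rho>) (\<rho> *\<^sub>R x) = (indicator (ball 0 1) x :: real)" for x :: "real^'n"
    using \<rho> by (auto simp: indicator_def)
  have "(LINT x|lborel. indicator (ball 0 \<rho>) x * g x)
      = (LINT x|density (distr lborel borel (\<lambda>x. 0 + \<rho> *\<^sub>R x)) (\<lambda>_. \<bar>\<rho>\<bar>^DIM(real^'n)). indicator (ball 0 \<rho>) x * g x)"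
    using lborel_affine[of \<rho> "0::real^'n"] \<rho> by simp
  also have "\<dots> = (LINT x|distr lborel borel (\<lambda>x. \<rho> *\<^sub>R x). \<rho> ^ CARD('n) * (indicator (ball 0 \<rho>) x * g x))"
    using \<rho> by (subst integral_density) auto
  also have "\<dots> = (LINT x|lborel. \<rho> ^ CARD('n) * (indicator (ball 0 \<rho>) (\<rho> *\<^sub>R x) * g (\<rho> *\<^sub>R x)))"
    by (subst integral_distr) auto
  also have "\<dots> = \<rho> ^ CARD('n) * ball_int g"
    using \<rho> by (simp add: ind g ball_int_def set_lebesgue_integral_def)
  finally show ?thesis .
qed

text \<open>Integration in polar coordinates: Fubini for
  $1 - |x|^k = \int_{|x|}^1 k \rho^{k-1}\,d\rho$ reduces it to the scaling of balls.\<close>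

lemma ball_int_radial_power:
  fixes g :: "real^'n::finite \<Rightarrow> real"
  assumes [measurable]: "g \<in> borel_measurable borel" and g: "\<And>x c. c > 0 \<Longrightarrow> g (c *\<^sub>R x) = g x"
    and C: "\<And>x. \<bar>g x\<bar> \<le> C"
  shows "(CARD('n) + k) * ball_int (\<lambda>x. norm x ^ k * g x) = CARD('n) * ball_int g"
proof (cases k)
  case (Suc k')
  \<comment> \<open>The kernel for Fubini without the factor k, which reappears as a division by
    \<open>k\<close> in \<open>inner2\<close>. Integrating in x first leaves scaled balls,
    integrating in \<rho> first leaves 1 - |x|^k.\<close>
  define h where "h x \<rho> = indicator {0..1} \<rho> * (if norm x < \<rho> then 1 else 0) * \<rho> ^ k' * g x"
    for x :: "real^'n" and \<rho> :: real
  have int_h: "integrable (lborel \<Otimes>\<^sub>M lborel) (case_prod h)"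
  proof (rule Bochner_Integration.integrable_bound)
    let ?A = "ball 0 1 \<times> {0..1} :: ((real^'n) \<times> real) set"
    have "emeasure lborel ?A < \<infinity>" by (intro emeasure_bounded_finite bounded_Times) auto
    moreover have "?A \<in> sets (borel \<Otimes>\<^sub>M borel)" by (intro pair_measureI) auto
    moreover from this have "?A \<in> sets borel" by (simp only: borel_prod)
    ultimately show "integrable (lborel \<Otimes>\<^sub>M lborel) (\<lambda>z::(real^'n) \<times> real. indicator ?A z * C)"
      unfolding lborel_prod by (intro integrable_mult_left integrable_real_indicator) auto
    show "case_prod h \<in> borel_measurable (lborel \<Otimes>\<^sub>M lborel)"
      unfolding h_def[abs_def] by measurable
    show "AE z in lborel \<Otimes>\<^sub>M lborel. norm (case_prod h z) \<le> norm (indicator ?A z * C)"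
    proof (intro always_eventually allI)
      fix z :: "(real^'n) \<times> real"
      obtain x \<rho> where z: "z = (x, \<rho>)" by fastforce
      have "\<bar>\<rho> ^ k' * g x\<bar> \<le> \<bar>C\<bar>" if "0 \<le> \<rho>" "\<rho> \<le> 1"
        using mult_mono[of "\<bar>\<rho> ^ k'\<bar>" 1 "\<bar>g x\<bar>" "\<bar>C\<bar>"] C[of x] that power_le_one[of \<rho> k']
        by (auto simp: abs_mult)
      then show "norm (case_prod h z) \<le> norm (indicator ?A z * C)"
        by (auto simp: z h_def indicator_def)
    qed
  qed
  have inner1: "(LINT x|lborel. h x \<rho>) = ball_int g * (\<rho> ^ (CARD('n) + k') * indicator {0..1} \<rho>)" for \<rho>
  proof (cases "\<rho> \<in> {0..1}")
    case True
    have "h x \<rho> = \<rho> ^ k' * (indicator (ball 0 \<rho>) x * g x)" for x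
      using True by (simp add: h_def indicator_def)
    then have "(LINT x|lborel. h x \<rho>) = \<rho> ^ k' * (\<rho> ^ CARD('n) * ball_int g)"
      using ball_int_scaled_ball[of g \<rho>] g True by simp
    with True show ?thesis by (simp add: power_add)
  qed (simp add: h_def)
  have inner2: "(LINT \<rho>|lborel. h x \<rho>) = indicator (ball 0 1) x * ((1 - norm x ^ k) * g x) / k" for x
  proof (cases "norm x < 1")
    case True
    have "(LINT \<rho>|lborel. h x \<rho>) = (LINT \<rho>|lborel. \<rho> ^ k' * indicator {norm x..1} \<rho> * g x)"
    proof (rule integral_cong_AE)
      \<comment> \<open>The strict inequality in \<open>h\<close> and the closed interval disagree
        only at \<rho> = |x|.\<close>
      have "AE \<rho> in lborel. \<rho> \<noteq> norm x" by (rule AE_lborel_singleton)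
      then show "AE \<rho> in lborel. h x \<rho> = \<rho> ^ k' * indicator {norm x..1} \<rho> * g x"
      proof eventually_elim
        case (elim \<rho>)
        have "0 \<le> \<rho>" if "norm x < \<rho>" using norm_ge_zero[of x] that by linarith
        with elim show ?case by (auto simp: h_def indicator_def)
      qed
    qed (auto simp: h_def[abs_def])
    also have "\<dots> = (1 - norm x ^ k) * g x / k"
      using integral_power[of "norm x" 1 k'] True by (simp add: Suc)
    finally show ?thesis using True by simp
  next
    case False
    then have "h x \<rho> = 0" for \<rho> by (auto simp: h_def indicator_def)
    then show ?thesis using False by simp
  qed
  have m: "set_integrable lborel (ball 0 1) (\<lambda>x. norm x ^ k * g x)" "set_integrable lborel (ball 0 1) g"
  proof (rule set_integrable_ball_bounded)
    show "\<bar>norm x ^ k * g x\<bar> \<le> C" if "norm x < 1" for x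
      using mult_mono[of "norm x ^ k" 1 "\<bar>g x\<bar>" C] C[of x] that power_le_one[of "norm x" k]
      by (auto simp: abs_mult)
  qed (use C in \<open>auto intro!: set_integrable_ball_bounded[where C = C]\<close>)
  have "(LINT x|lborel. LINT \<rho>|lborel. h x \<rho>) = (ball_int g - ball_int (\<lambda>x. norm x ^ k * g x)) / k"
  proof -
    have "(LINT x|lborel. LINT \<rho>|lborel. h x \<rho>) = (LINT x:ball 0 1|lborel. g x - norm x ^ k * g x) / k"
      unfolding inner2 by (simp add: set_lebesgue_integral_def algebra_simps)
    also have "\<dots> = (ball_int g - ball_int (\<lambda>x. norm x ^ k * g x)) / k"
      unfolding ball_int_def using m by (subst set_integral_diff) auto
    finally show ?thesis .
  qed
  moreover have "(LINT \<rho>|lborel. LINT x|lborel. h x \<rho>) = ball_int g / (CARD('n) + k)"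
    unfolding inner1 using integral_power[of 0 1 "CARD('n) + k'"] by (simp add: Suc)
  ultimately have "(ball_int g - ball_int (\<lambda>x. norm x ^ k * g x)) / k = ball_int g / (CARD('n) + k)"
    using lborel_pair.Fubini_integral[OF int_h] by simp
  then show ?thesis by (simp add: field_simps Suc)
qed simp

text \<open>Squaring removes the kink: at 0 the difference quotient is \<open>max 0 h\<close>
  itself, which tends to 0.\<close>

lemma has_real_derivative_max_square:
  "((\<lambda>u. (max 0 u)\<^sup>2) has_real_derivative 2 * max 0 u) (at (u::real))"
proof -
  consider "u > 0" | "u < 0" | "u = 0" by linarith
  then show ?thesis
  proof cases
    case 1
    have "((\<lambda>u. u\<^sup>2) has_real_derivative 2 * max 0 u) (at u)"
      using 1 by (auto intro!: derivative_eq_intros)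
    then show ?thesis
      by (rule has_field_derivative_transform_within_open[of _ _ _ "{0<..}"]) (use 1 in auto)
  next
    case 2
    have "((\<lambda>u. 0) has_real_derivative 2 * max 0 u) (at u)"
      using 2 by (auto intro!: derivative_eq_intros)
    then show ?thesis
      by (rule has_field_derivative_transform_within_open[of _ _ _ "{..<0}"]) (use 2 in auto)
  next
    case 3
    have "((\<lambda>h. max 0 h) \<longlongrightarrow> max 0 0) (at (0::real))"
      by (intro tendsto_intros)
    moreover have "(max 0 h)\<^sup>2 / h = max 0 h" for h :: real by (auto simp: max_def power2_eq_square)
    ultimately show ?thesis using 3 by (simp add: DERIV_def)
  qed
qed

(* The square of the cut-off 1 - |x|^2 is continuously differentiable across the sphere, so integrating a
   derivative over the ball needs only translation invariance and no boundary term. *)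
lemma ball_int_partial_by_parts:
  fixes f :: "real^'n::finite \<Rightarrow> real"
  assumes f: "real_polynomial_function f"
  shows "ball_int (\<lambda>x. (1 - (norm x)\<^sup>2)\<^sup>2 * partial i f x) = ball_int (\<lambda>x. 4 * (1 - (norm x)\<^sup>2) * x $ i * f x)"
proof -
  define w where "w x = max 0 (1 - (norm x)\<^sup>2)" for x :: "real^'n"
  define \<phi> where "\<phi> x = (w x)\<^sup>2 * f x" for x
  \<comment> \<open>The i-th partial derivative of \<phi>; the second term comes from
    differentiating the squared cut-off.\<close>
  define \<psi> where "\<psi> x = (w x)\<^sup>2 * partial i f x - 4 * w x * x $ i * f x" for x
  define e :: "real^'n" where "e = axis i 1"
  have ne: "norm e = 1" by (simp add: e_def)
  have pf: "real_polynomial_function (partial i f)" by (rule poly_fun_partial[OF f])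
  have out: "w x = 0" if "norm x \<ge> 1" for x using that by (simp add: w_def)
  have in': "w x = 1 - (norm x)\<^sup>2" if "norm x < 1" for x
    using that power_le_one[of "norm x" 2] by (simp add: w_def)
  have cont_w: "continuous_on A w" for A unfolding w_def by (intro continuous_intros)
  have cont_\<phi>: "continuous_on A \<phi>" for A
    unfolding \<phi>_def[abs_def] by (intro continuous_intros cont_w poly_fun_continuous f)
  have cont_\<psi>: "continuous_on A \<psi>" for A
    unfolding \<psi>_def[abs_def] by (intro continuous_intros cont_w poly_fun_continuous f pf)
  have D: "((\<lambda>t. \<phi> (x + t *\<^sub>R e)) has_real_derivative \<psi> (x + t *\<^sub>R e)) (at t)" for x t
  proof -
    have "((\<lambda>t. f (x + t *\<^sub>R e)) has_derivative (\<lambda>h. frechet_derivative f (at (x + t *\<^sub>R e)) (h *\<^sub>R e))) (at t)"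
      by (rule has_derivative_compose[OF _ poly_fun_has_derivative[OF f]]) (auto intro!: derivative_eq_intros)
    moreover have "frechet_derivative f (at (x + t *\<^sub>R e)) (h *\<^sub>R e) = h * partial i f (x + t *\<^sub>R e)" for h
      using has_derivative_bounded_linear[OF poly_fun_has_derivative[OF f, of "x + t *\<^sub>R e"]]
      by (simp add: partial_def e_def linear_simps)
    ultimately have Df: "((\<lambda>t. f (x + t *\<^sub>R e)) has_real_derivative partial i f (x + t *\<^sub>R e)) (at t)"
      by (simp add: has_field_derivative_def mult_commute_abs)
    have "((\<lambda>t. 1 - (norm (x + t *\<^sub>R e))\<^sup>2) has_derivative (\<lambda>h. h * (- 2 * (x + t *\<^sub>R e) $ i))) (at t)"
      unfolding power2_norm_eq_inner
      by (auto intro!: derivative_eq_intros simp: e_def inner_axis inner_axis' algebra_simps)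
    then have "((\<lambda>t. 1 - (norm (x + t *\<^sub>R e))\<^sup>2) has_real_derivative - 2 * (x + t *\<^sub>R e) $ i) (at t)"
      unfolding has_field_derivative_def by (rule has_derivative_eq_rhs) (simp add: fun_eq_iff)
    from DERIV_chain2[OF has_real_derivative_max_square this]
    have "((\<lambda>t. (w (x + t *\<^sub>R e))\<^sup>2) has_real_derivative 2 * w (x + t *\<^sub>R e) * (- 2 * (x + t *\<^sub>R e) $ i)) (at t)"
      by (simp add: w_def)
    from DERIV_mult[OF this Df] show ?thesis
      by (simp add: \<phi>_def \<psi>_def algebra_simps)
  qed
  have "bounded (\<psi> ` cball 0 1)"
    by (intro compact_imp_bounded compact_continuous_image cont_\<psi> compact_cball)
  then obtain K where "\<forall>x\<in>cball 0 1. \<bar>\<psi> x\<bar> \<le> K"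
    by (auto simp: bounded_iff)
  then have K: "\<bar>\<psi> x\<bar> \<le> K" if "norm x \<le> 1" for x using that by simp
  have "K \<ge> 0" using K[of 0] by simp
  have K': "\<bar>\<psi> x\<bar> \<le> K" for x
    using K[of x] \<open>K \<ge> 0\<close> by (cases "norm x \<le> 1") (auto simp: \<psi>_def out)
  \<comment> \<open>Difference quotients of \<phi> in direction \<open>e\<close>. Each has integral
    0 by translation invariance, and they converge to \<psi>, so dominated convergence gives that
    \<psi> has integral 0.\<close>
  define s where "s n x = real (Suc n) * (\<phi> (x + (1 / real (Suc n)) *\<^sub>R e) - \<phi> x)" for n x
  have int_\<phi>: "integrable lborel \<phi>"
  proof -
    have "(\<lambda>x. indicator (cball 0 1) x *\<^sub>R \<phi> x) = \<phi>"
      by (auto simp: fun_eq_iff indicator_def \<phi>_def out)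
    with borel_integrable_compact[OF compact_cball cont_\<phi>, of 0 1] show ?thesis by simp
  qed
  have int_shift: "integrable lborel (\<lambda>x. \<phi> (x + c))" "(LINT x|lborel. \<phi> (x + c)) = (LINT x|lborel. \<phi> x)" for c
  proof -
    have m: "\<phi> \<in> borel_measurable borel" by (intro borel_measurable_continuous_onI cont_\<phi>)
    have "integrable (distr lborel borel ((+) c)) \<phi>" using int_\<phi> by (simp add: lborel_distr_plus)
    then show "integrable lborel (\<lambda>x. \<phi> (x + c))"
      by (subst (asm) integrable_distr_eq) (auto simp: add.commute m)
    have "(LINT x|distr lborel borel ((+) c). \<phi> x) = (LINT x|lborel. \<phi> (c + x))"
      by (rule integral_distr) (auto simp: m)
    then show "(LINT x|lborel. \<phi> (x + c)) = (LINT x|lborel. \<phi> x)"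
      by (simp add: lborel_distr_plus add.commute)
  qed
  have s0: "(LINT x|lborel. s n x) = 0" for n
    unfolding s_def using int_shift int_\<phi> by simp
  have "(\<lambda>n. LINT x|lborel. s n x) \<longlonglongrightarrow> (LINT x|lborel. \<psi> x)"
  proof (rule integral_dominated_convergence)
    show "\<psi> \<in> borel_measurable lborel" by (simp add: borel_measurable_continuous_onI cont_\<psi>)
    show "s n \<in> borel_measurable lborel" for n
      unfolding s_def[abs_def] using int_shift int_\<phi> by (auto intro!: borel_measurable_integrable)
    show "integrable lborel (\<lambda>x::real^'n. indicator (cball 0 2) x * K)"
      by (intro integrable_mult_left integrable_real_indicator emeasure_bounded_finite) auto
    show "AE x in lborel. (\<lambda>n. s n x) \<longlonglongrightarrow> \<psi> x"
    proof (intro always_eventually allI)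
      fix x
      have "((\<lambda>t. (\<phi> (x + t *\<^sub>R e) - \<phi> x) / t) \<longlongrightarrow> \<psi> x) (at 0)"
        using D[of x 0] by (simp add: DERIV_def)
      moreover have "filterlim (\<lambda>n. 1 / real (Suc n)) (at 0) sequentially"
        unfolding filterlim_at using LIMSEQ_inverse_real_of_nat by (auto simp: inverse_eq_divide)
      ultimately have "((\<lambda>n. (\<phi> (x + (1 / real (Suc n)) *\<^sub>R e) - \<phi> x) / (1 / real (Suc n))) \<longlonglongrightarrow> \<psi> x)"
        by (rule filterlim_compose)
      then show "(\<lambda>n. s n x) \<longlonglongrightarrow> \<psi> x"
        by (simp add: s_def mult.commute del: of_nat_Suc)
    qed
    \<comment> \<open>By the mean value theorem a quotient is a value of \<psi>, hence at most
      \<open>K\<close>. It vanishes outside the ball of radius 2, since \<phi> lives on the unit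
      ball and the shift has length at most 1.\<close>
    show "AE x in lborel. norm (s n x) \<le> indicator (cball 0 2) x * K" for n
    proof (intro always_eventually allI)
      fix x :: "real^'n"
      let ?t = "1 / real (Suc n)"
      have t: "0 < ?t" "?t \<le> 1" by simp_all
      show "norm (s n x) \<le> indicator (cball 0 2) x * K"
      proof (cases "norm x \<le> 2")
        case True
        obtain z where "0 < z" "z < ?t" "\<phi> (x + ?t *\<^sub>R e) - \<phi> (x + 0 *\<^sub>R e) = (?t - 0) * \<psi> (x + z *\<^sub>R e)"
          using MVT2[OF t(1), of "\<lambda>t. \<phi> (x + t *\<^sub>R e)" "\<lambda>t. \<psi> (x + t *\<^sub>R e)"] D by blast
        then have "s n x = \<psi> (x + z *\<^sub>R e)" by (simp add: s_def del: of_nat_Suc)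
        then show ?thesis using K' True by simp
      next
        case False
        have "norm x \<le> norm (x + ?t *\<^sub>R e) + norm (?t *\<^sub>R e)"
          using norm_triangle_ineq4[of "x + ?t *\<^sub>R e" "?t *\<^sub>R e"] by simp
        moreover have "norm (?t *\<^sub>R e) = ?t" using t ne by simp
        ultimately have "norm (x + ?t *\<^sub>R e) \<ge> 1" using False t by linarith
        then show ?thesis using False out by (simp add: s_def \<phi>_def)
      qed
    qed
  qed
  then have "(LINT x|lborel. \<psi> x) = 0" unfolding s0 by (simp add: LIMSEQ_const_iff)
  moreover have "(LINT x|lborel. \<psi> x) = (LINT x:ball 0 1|lborel. (1 - (norm x)\<^sup>2)\<^sup>2 * partial i f x - 4 * (1 - (norm x)\<^sup>2) * x $ i * f x)"
    unfolding set_lebesgue_integral_def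
    by (intro Bochner_Integration.integral_cong refl) (auto simp: indicator_def \<psi>_def out in')
  moreover have "\<dots> = ball_int (\<lambda>x. (1 - (norm x)\<^sup>2)\<^sup>2 * partial i f x) - ball_int (\<lambda>x. 4 * (1 - (norm x)\<^sup>2) * x $ i * f x)"
    unfolding ball_int_def
    by (intro set_integral_diff set_integrable_poly_fun real_polynomial_function.intros(2,4) real_polynomial_function_diff
        real_polynomial_function_power homog_poly_poly_fun[OF homog_poly_normsq] poly_fun_coord f pf)
  ultimately show ?thesis by simp
qed

section \<open>Spherical averages of harmonic polynomials\<close>

text \<open>Up to the factor $1/d$, this is the surface integral over the unit sphere.\<close>

definition sphere_int :: "(real ^ 'n::finite \<Rightarrow> real) \<Rightarrow> real" where
  "sphere_int f = ball_int (\<lambda>x. f (sgn x))"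

text \<open>The origin is set aside because \<open>sgn 0 = 0\<close> is not on the sphere, so
  agreement on the sphere says nothing there.\<close>

lemma ball_int_cong_AE:
  assumes "f \<in> borel_measurable borel" "g \<in> borel_measurable borel" "\<And>x. x \<noteq> 0 \<Longrightarrow> f x = g x"
  shows "ball_int f = ball_int g"
  unfolding ball_int_def set_lebesgue_integral_def
proof (rule integral_cong_AE)
  have "AE x in lborel. x \<noteq> 0" by (rule AE_lborel_singleton)
  then show "AE x in lborel. indicator (ball 0 1) x *\<^sub>R f x = indicator (ball 0 1) x *\<^sub>R g x"
    by eventually_elim (simp add: assms)
qed (use assms in \<open>auto intro!: borel_measurable_times borel_measurable_indicator\<close>)

lemma poly_fun_sgn_measurable:
  fixes f :: "real^'n::finite \<Rightarrow> real"
  assumes "real_polynomial_function f"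
  shows "(\<lambda>x. f (sgn x)) \<in> borel_measurable borel"
  by (rule measurable_compose[OF _ poly_fun_measurable[OF assms]]) (simp add: sgn_div_norm)

lemma sphere_int_cong:
  assumes "real_polynomial_function f" "real_polynomial_function g" "\<And>x. norm x = 1 \<Longrightarrow> f x = g x"
  shows "sphere_int f = sphere_int g"
  unfolding sphere_int_def
  by (rule ball_int_cong_AE) (use assms in \<open>auto intro: poly_fun_sgn_measurable simp: norm_sgn\<close>)

lemma poly_fun_sgn_bounded:
  fixes f :: "real^'n::finite \<Rightarrow> real"
  assumes "real_polynomial_function f"
  obtains C where "\<And>x. \<bar>f (sgn x)\<bar> \<le> C"
proof -
  have "bounded (f ` cball 0 1)"
    by (intro compact_imp_bounded compact_continuous_image poly_fun_continuous assms compact_cball)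
  then obtain C where "\<forall>x\<in>cball 0 1. \<bar>f x\<bar> \<le> C"
    by (auto simp: bounded_iff)
  then have "\<bar>f (sgn x)\<bar> \<le> C" for x by (auto simp: norm_sgn)
  with that show thesis by blast
qed

lemma set_integrable_sgn_poly_fun:
  fixes f :: "real^'n::finite \<Rightarrow> real"
  assumes "real_polynomial_function f"
  shows "set_integrable lborel (ball 0 1) (\<lambda>x. f (sgn x))"
proof -
  obtain C where "\<And>x. \<bar>f (sgn x)\<bar> \<le> C" using poly_fun_sgn_bounded[OF assms] by blast
  then show ?thesis by (intro set_integrable_ball_bounded[where C = C] poly_fun_sgn_measurable assms)
qed

lemma sphere_int_add: "real_polynomial_function f \<Longrightarrow> real_polynomial_function g \<Longrightarrow>
    sphere_int (\<lambda>x. f x + g x) = sphere_int f + sphere_int g"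
  unfolding sphere_int_def ball_int_def by (intro set_integral_add set_integrable_sgn_poly_fun)

lemma sphere_int_cmult: "sphere_int (\<lambda>x. c * f x) = c * sphere_int f"
  unfolding sphere_int_def by (rule ball_int_cmult)

text \<open>Homogeneity gives f(x) = |x|^k f(sgn x), so \<open>ball_int_radial_power\<close>
  applies; the ratio d/(d + k) compares the integrals of r^(d+k-1) and r^(d-1) over [0,1].\<close>

lemma ball_int_homog_poly:
  fixes f :: "real^'n::finite \<Rightarrow> real"
  assumes "homog_poly k f"
  shows "ball_int f = CARD('n) / (CARD('n) + k) * sphere_int f"
proof -
  have poly_fun: "real_polynomial_function f" by (rule homog_poly_poly_fun[OF assms])
  obtain C where C: "\<And>x. \<bar>f (sgn x)\<bar> \<le> C" using poly_fun_sgn_bounded[OF poly_fun] by blast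
  have "(CARD('n) + k) * ball_int (\<lambda>x. norm x ^ k * f (sgn x)) = CARD('n) * ball_int (\<lambda>x. f (sgn x))"
  proof (rule ball_int_radial_power[where C = C])
    show "f (sgn (c *\<^sub>R x)) = f (sgn x)" if "c > 0" for x c
      using that by (simp add: sgn_scaleR)
  qed (auto simp: poly_fun_sgn_measurable poly_fun C)
  then have "(CARD('n) + k) * ball_int f = CARD('n) * sphere_int f"
    by (simp add: sphere_int_def flip: homog_poly_sgn[OF assms])
  moreover have "real (CARD('n) + k) \<noteq> 0" by (subst of_nat_eq_0_iff) simp
  ultimately show ?thesis by (simp add: field_simps)
qed

text \<open>The value of $\int_0^1 (u-1)^k u^{b-1}\,du$, where $u = \|x\|^2$.\<close>

definition moment :: "real \<Rightarrow> nat \<Rightarrow> real" where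
  "moment b k = (- 1) ^ k * fact k / pochhammer b (Suc k)"

text \<open>The integral of p(u - 1) u^(b-1) over [0,1] for b > 0, encoded as a linear functional
  through its values on powers. All later work on [0,1] is thus algebra of coefficients.\<close>

definition poly_moment :: "real \<Rightarrow> real poly \<Rightarrow> real" where
  "poly_moment b p = (\<Sum>k\<le>degree p. coeff p k * moment b k)"

text \<open>Radial factors are polynomials in $\|x\|^2 - 1$, so their value on the sphere is the constant
  coefficient.\<close>

definition radial :: "real poly \<Rightarrow> (real ^ 'n::finite \<Rightarrow> real) \<Rightarrow> real ^ 'n \<Rightarrow> real" where
  "radial p f x = poly p ((norm x)\<^sup>2 - 1) * f x"

text \<open>One factor u - 1 is split into u and -1, and the factor u raises the exponent of the
  weight.\<close>

lemma moment_Suc: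
  assumes "b > 0"
  shows "moment b (Suc k) = moment (b + 1) k - moment b k"
proof -
  have p: "pochhammer (b + 1) k > 0" using assms by (intro pochhammer_pos) auto
  have "pochhammer b (Suc k) = b * pochhammer (b + 1) k"
    "pochhammer (b + 1) (Suc k) = (b + 1 + k) * pochhammer (b + 1) k"
    "pochhammer b (Suc (Suc k)) = b * ((b + 1 + k) * pochhammer (b + 1) k)"
    by (simp_all only: pochhammer_rec[of b] pochhammer_rec'[of "b + 1"])
  with p assms show ?thesis unfolding moment_def
    by (simp add: divide_simps) (simp add: algebra_simps)
qed

text \<open>Splitting one factor |x|^2 - 1 yields |x|^2 f and -f. The former has degree m + 2 and
  the same values on the sphere, so only the moment parameter changes, and \<open>moment_Suc\<close>
  recombines the two terms. The factor d/2 is that of the substitution u = r^2.\<close>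

lemma ball_int_normsq_power_homog_poly:
  fixes f :: "real^'n::finite \<Rightarrow> real"
  assumes "homog_poly m f"
  shows "ball_int (\<lambda>x. ((norm x)\<^sup>2 - 1) ^ k * f x) = CARD('n) / 2 * moment ((CARD('n) + m) / 2) k * sphere_int f"
  using assms
proof (induction k arbitrary: m f)
  case 0
  then show ?case by (simp add: ball_int_homog_poly moment_def field_simps)
next
  case (Suc k)
  have h2: "homog_poly (2 + m) (\<lambda>x. (norm x)\<^sup>2 * f x)" by (rule homog_poly_mult[OF homog_poly_normsq Suc.prems])
  have rp: "real_polynomial_function (\<lambda>x. ((norm x)\<^sup>2 - 1) ^ k * g x)" if "real_polynomial_function g" for g :: "real^'n \<Rightarrow> real"
    by (intro real_polynomial_function.intros(2,4) real_polynomial_function_diff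
        real_polynomial_function_power homog_poly_poly_fun[OF homog_poly_normsq] that)
  have "ball_int (\<lambda>x. ((norm x)\<^sup>2 - 1) ^ Suc k * f x)
     = ball_int (\<lambda>x. ((norm x)\<^sup>2 - 1) ^ k * ((norm x)\<^sup>2 * f x) + ((norm x)\<^sup>2 - 1) ^ k * (- 1 * f x))"
    by (simp add: algebra_simps)
  also have "\<dots> = ball_int (\<lambda>x. ((norm x)\<^sup>2 - 1) ^ k * ((norm x)\<^sup>2 * f x)) + ball_int (\<lambda>x. ((norm x)\<^sup>2 - 1) ^ k * (- 1 * f x))"
    by (intro ball_int_add rp homog_poly_poly_fun[OF h2] homog_poly_poly_fun[OF homog_poly_scale[OF Suc.prems]])
  also have "\<dots> = CARD('n) / 2 * moment ((CARD('n) + m) / 2 + 1) k * sphere_int f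
                - CARD('n) / 2 * moment ((CARD('n) + m) / 2) k * sphere_int f"
  proof -
    have "sphere_int (\<lambda>x. (norm x)\<^sup>2 * f x) = sphere_int f"
      by (intro sphere_int_cong homog_poly_poly_fun[OF h2] homog_poly_poly_fun[OF Suc.prems]) auto
    moreover have "real (CARD('n) + (2 + m)) / 2 = real (CARD('n) + m) / 2 + 1" by (simp add: field_simps)
    ultimately show ?thesis
      unfolding Suc.IH[OF h2] Suc.IH[OF homog_poly_scale[OF Suc.prems]] sphere_int_cmult by (simp add: add_divide_distrib add_ac)
  qed
  also have "\<dots> = CARD('n) / 2 * moment ((CARD('n) + m) / 2) (Suc k) * sphere_int f"
    by (subst moment_Suc) (auto simp: algebra_simps add_nonneg_pos)
  finally show ?case .
qed

lemma radial_as_sum: "radial p f = (\<lambda>x. \<Sum>k\<le>degree p. coeff p k * (((norm x)\<^sup>2 - 1) ^ k * f x))"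
  by (simp add: radial_def fun_eq_iff poly_altdef sum_distrib_right mult.assoc)

lemma poly_fun_radial: "real_polynomial_function f \<Longrightarrow> real_polynomial_function (radial p f)"
  unfolding radial_as_sum
  by (intro poly_fun_sum real_polynomial_function.intros(2,4) real_polynomial_function_diff
        real_polynomial_function_power homog_poly_poly_fun[OF homog_poly_normsq])

lemma ball_int_radial:
  fixes f :: "real^'n::finite \<Rightarrow> real"
  assumes "homog_poly m f"
  shows "ball_int (radial p f) = CARD('n) / 2 * poly_moment ((CARD('n) + m) / 2) p * sphere_int f"
proof -
  have rp: "real_polynomial_function (\<lambda>x. c * (((norm x)\<^sup>2 - 1) ^ k * f x))" for k c
    by (intro real_polynomial_function.intros(2,4) real_polynomial_function_diff
        real_polynomial_function_power homog_poly_poly_fun[OF homog_poly_normsq] homog_poly_poly_fun[OF assms])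
  show ?thesis unfolding radial_as_sum poly_moment_def
    by (subst ball_int_sum[OF rp], subst ball_int_cmult, subst ball_int_normsq_power_homog_poly[OF assms])
       (simp add: sum_distrib_left sum_distrib_right mult_ac)
qed

section \<open>Orthogonality of harmonic polynomials and of their gradients\<close>

definition grad_dot :: "(real ^ 'n::finite \<Rightarrow> real) \<Rightarrow> (real ^ 'n \<Rightarrow> real) \<Rightarrow> real ^ 'n \<Rightarrow> real" where
  "grad_dot f g x = (\<Sum>i\<in>UNIV. partial i f x * partial i g x)"

lemma homog_poly_grad_dot: "homog_poly m f \<Longrightarrow> homog_poly k g \<Longrightarrow> homog_poly (m - 1 + (k - 1)) (grad_dot f g)"
  unfolding grad_dot_def[abs_def] by (intro homog_poly_sum homog_poly_mult homog_poly_partial)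

lemma grad_dot_commute: "grad_dot f g = grad_dot g f"
  by (simp add: grad_dot_def fun_eq_iff mult.commute)

lemma grad_dot_homog_poly_0: "homog_poly 0 f \<Longrightarrow> grad_dot f g = (\<lambda>x. 0)"
  by (simp add: grad_dot_def fun_eq_iff partial_homog_poly_0)

text \<open>The field (1 - |x|^2)^2 f grad g vanishes on the sphere, so its divergence integrates to
  0. Harmonicity removes the Laplacian of g, and the derivative of the weight produces x . grad g,
  which is k g by Euler's identity. The polynomials \<open>[:0, 0, 1:]\<close> and
  \<open>[:0, 1:]\<close> are (|x|^2 - 1)^2 and |x|^2 - 1.\<close>

lemma ball_int_grad_dot:
  fixes f g :: "real^'n::finite \<Rightarrow> real"
  assumes f: "homog_poly m f" and g: "homog_poly k g" and harm: "laplacian g = (\<lambda>x. 0)"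
  shows "ball_int (radial [:0, 0, 1:] (grad_dot f g)) = - 4 * real k * ball_int (radial [:0, 1:] (\<lambda>x. f x * g x))"
proof -
  note rp = homog_poly_poly_fun[OF f] homog_poly_poly_fun[OF g] poly_fun_partial[OF homog_poly_poly_fun[OF f]] poly_fun_partial[OF homog_poly_poly_fun[OF g]]
    poly_fun_partial[OF poly_fun_partial[OF homog_poly_poly_fun[OF g]]] homog_poly_poly_fun[OF homog_poly_normsq] poly_fun_coord
  note ri = real_polynomial_function.intros(2,3,4) real_polynomial_function_diff real_polynomial_function_power
  have "ball_int (radial [:0, 0, 1:] (grad_dot f g))
      = ball_int (\<lambda>x. \<Sum>i\<in>UNIV. (1 - (norm x)\<^sup>2)\<^sup>2 * partial i (\<lambda>x. f x * partial i g x) x)"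
  proof (rule arg_cong[where f = ball_int], rule ext)
    fix x
    have "(\<Sum>i\<in>UNIV. (1 - (norm x)\<^sup>2)\<^sup>2 * partial i (\<lambda>x. f x * partial i g x) x)
       = (1 - (norm x)\<^sup>2)\<^sup>2 * (grad_dot f g x + f x * laplacian g x)"
      by (simp add: partial_mult rp grad_dot_def laplacian_def sum.distrib sum_distrib_left distrib_left)
    then show "radial [:0, 0, 1:] (grad_dot f g) x = (\<Sum>i\<in>UNIV. (1 - (norm x)\<^sup>2)\<^sup>2 * partial i (\<lambda>x. f x * partial i g x) x)"
      by (simp add: harm radial_def power2_eq_square algebra_simps)
  qed
  also have "\<dots> = (\<Sum>i\<in>UNIV. ball_int (\<lambda>x. 4 * (1 - (norm x)\<^sup>2) * x $ i * (f x * partial i g x)))"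
    by (subst ball_int_sum, intro ri rp poly_fun_partial) (intro sum.cong refl ball_int_partial_by_parts ri rp)
  also have "\<dots> = ball_int (\<lambda>x. \<Sum>i\<in>UNIV. 4 * (1 - (norm x)\<^sup>2) * x $ i * (f x * partial i g x))"
    by (subst ball_int_sum) (auto intro!: ri rp)
  also have "\<dots> = ball_int (\<lambda>x. - 4 * real k * radial [:0, 1:] (\<lambda>x. f x * g x) x)"
  proof (rule arg_cong[where f = ball_int], rule ext)
    fix x
    have "(\<Sum>i\<in>UNIV. 4 * (1 - (norm x)\<^sup>2) * x $ i * (f x * partial i g x))
      = 4 * (1 - (norm x)\<^sup>2) * f x * (\<Sum>i\<in>UNIV. x $ i * partial i g x)"
      by (subst sum_distrib_left) (simp only: mult_ac)
    then show "(\<Sum>i\<in>UNIV. 4 * (1 - (norm x)\<^sup>2) * x $ i * (f x * partial i g x)) = - 4 * real k * radial [:0, 1:] (\<lambda>x. f x * g x) x"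
      by (simp add: euler_homog_poly[OF g] radial_def algebra_simps)
  qed
  also have "\<dots> = - 4 * real k * ball_int (radial [:0, 1:] (\<lambda>x. f x * g x))"
    by (rule ball_int_cmult)
  finally show ?thesis .
qed

text \<open>Takes the place of Green's identity on the sphere. Apart from the weights, both
  integrands in \<open>ball_int_grad_dot\<close> are homogeneous, of degrees m + k - 2 and m + k, so
  explicit moments convert it into spherical averages; the two moments differ by a factor -2/b with
  2b = d + m + k - 2. Positive degrees keep the subtraction from truncating.\<close>

lemma sphere_int_grad_dot:
  fixes f g :: "real^'n::finite \<Rightarrow> real"
  assumes f: "homog_poly m f" and g: "homog_poly k g" and harm: "laplacian g = (\<lambda>x. 0)" and "m > 0" "k > 0"
  shows "sphere_int (grad_dot f g) = (CARD('n) + m + k - 2) * k * sphere_int (\<lambda>x. f x * g x)"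
proof -
  define b where "b = (real CARD('n) + real m + real k - 2) / 2"
  have "c > 0 \<Longrightarrow> c + real m + real k - 2 > 0" for c
    using assms(4,5) by linarith
  then have b: "b > 0" by (simp add: b_def)
  have e1: "(CARD('n) + (m - 1 + (k - 1))) / 2 = b" "(CARD('n) + (m + k)) / 2 = b + 1"
    using assms(4,5) by (simp_all add: b_def of_nat_diff field_simps)
  have m2: "poly_moment b [:0, 0, 1:] = 2 / (b * (b + 1) * (b + 2))" "poly_moment (b + 1) [:0, 1:] = - 1 / ((b + 1) * (b + 2))"
    by (simp_all add: poly_moment_def moment_def numeral_2_eq_2 pochhammer_rec' algebra_simps)
  have "CARD('n) / 2 * (2 / (b * (b + 1) * (b + 2))) * sphere_int (grad_dot f g)
      = CARD('n) / 2 * (4 * k / ((b + 1) * (b + 2))) * sphere_int (\<lambda>x. f x * g x)"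
  proof -
    have D: "X * (4 * k / D) * S = - 4 * real k * (X * (- 1 / D) * S)" for X D S by simp
    show ?thesis
      by (subst D) (rule ball_int_grad_dot[OF f g harm,
        unfolded ball_int_radial[OF homog_poly_grad_dot[OF f g]] ball_int_radial[OF homog_poly_mult[OF f g]] e1 m2])
  qed
  then have "sphere_int (grad_dot f g) = 2 * b * k * sphere_int (\<lambda>x. f x * g x)"
    using b by (simp add: divide_simps)
  moreover have "real (CARD('n) + m + k - 2) = 2 * b" using assms(4,5) by (simp add: b_def of_nat_diff)
  ultimately show ?thesis by simp
qed

text \<open>The average of grad f . grad g is symmetric, but \<open>sphere_int_grad_dot\<close>
  evaluates it with the factor k or, after exchanging f and g, with the factor m. Since d + m + k -
  2 is positive, m \<noteq> k leaves only 0.\<close>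

lemma sphere_int_harm_orthogonal:
  fixes f g :: "real^'n::finite \<Rightarrow> real"
  assumes f: "homog_poly m f" "laplacian f = (\<lambda>x. 0)" and g: "homog_poly k g" "laplacian g = (\<lambda>x. 0)" and "m \<noteq> k"
  shows "sphere_int (\<lambda>x. f x * g x) = 0"
proof -
  \<comment> \<open>In degree 0 the gradient vanishes, so the weighted identity on the ball already
    makes the average of the product zero.\<close>
  have aux: "sphere_int (\<lambda>x. f x * g x) = 0" if f: "homog_poly 0 f" and g: "homog_poly k g" "laplacian g = (\<lambda>x. 0)" and "k > 0"
    for k and f g :: "real^'n \<Rightarrow> real"
  proof -
    have "ball_int (radial [:0, 1:] (\<lambda>x. f x * g x)) = 0"
      using ball_int_grad_dot[OF f g] grad_dot_homog_poly_0[OF f, of g] \<open>k > 0\<close> by (simp add: radial_def[abs_def] ball_int_zero)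
    moreover have "poly_moment b [:0, 1:] = - 1 / (b * (b + 1))" for b
      by (simp add: poly_moment_def moment_def numeral_2_eq_2 pochhammer_rec' algebra_simps)
    moreover have "(real CARD('n) + real k) / 2 > 0" by (simp add: add_pos_nonneg)
    ultimately show ?thesis
      unfolding ball_int_radial[OF homog_poly_mult[OF f g(1)]] by auto
  qed
  show ?thesis
  proof (cases "m = 0 \<or> k = 0")
    case True
    then show ?thesis
      using aux[of f k g] aux[of g m f] f g \<open>m \<noteq> k\<close> by (auto simp: mult.commute)
  next
    case False
    then have "m > 0" "k > 0" by auto
    have 1: "sphere_int (grad_dot f g) = (CARD('n) + m + k - 2) * k * sphere_int (\<lambda>x. f x * g x)"
      by (rule sphere_int_grad_dot) fact+
    have 2: "sphere_int (grad_dot f g) = (CARD('n) + m + k - 2) * m * sphere_int (\<lambda>x. f x * g x)"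
      using sphere_int_grad_dot[OF g(1) f \<open>k > 0\<close> \<open>m > 0\<close>] by (simp add: grad_dot_commute mult.commute add_ac)
    have "real (CARD('n) + m + k - 2) \<noteq> 0" using \<open>m > 0\<close> \<open>k > 0\<close> zero_less_card_finite[where 'a='n] by linarith
    with 1 2 \<open>m \<noteq> k\<close> show ?thesis by auto
  qed
qed

lemma sphere_int_grad_dot_harm_orthogonal:
  fixes f g :: "real^'n::finite \<Rightarrow> real"
  assumes f: "homog_poly m f" "laplacian f = (\<lambda>x. 0)" and g: "homog_poly k g" "laplacian g = (\<lambda>x. 0)" and "m \<noteq> k"
  shows "sphere_int (grad_dot f g) = 0"
proof (cases "m = 0 \<or> k = 0")
  case True
  then have "grad_dot f g = (\<lambda>x. 0)"
    using grad_dot_homog_poly_0[of f g] grad_dot_homog_poly_0[of g f] f(1) g(1) grad_dot_commute[of f g] by metis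
  then show ?thesis by (simp add: sphere_int_def ball_int_zero)
next
  case False
  then show ?thesis using sphere_int_grad_dot[OF f(1) g] sphere_int_harm_orthogonal[OF assms] by simp
qed

lemma sphere_int_grad_dot_same:
  fixes f g :: "real^'n::finite \<Rightarrow> real"
  assumes f: "homog_poly m f" and g: "homog_poly m g" "laplacian g = (\<lambda>x. 0)"
  shows "sphere_int (grad_dot f g) = (2 * real m + real CARD('n) - 2) * m * sphere_int (\<lambda>x. f x * g x)"
proof (cases "m = 0")
  case True
  then show ?thesis using grad_dot_homog_poly_0[of f g] f by (simp add: sphere_int_def ball_int_zero)
next
  case False
  then show ?thesis using sphere_int_grad_dot[OF f g] by (simp add: of_nat_diff)
qed

section \<open>The Laplacian on radial factors\<close>

text \<open>This is the action of the Laplacian on the radial factor of a harmonic polynomial of degree $m$, with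
  $b = m + d/2$.\<close>

definition radial_laplacian :: "real \<Rightarrow> real poly \<Rightarrow> real poly" where
  "radial_laplacian b p = smult 4 ([:1, 1:] * pderiv (pderiv p) + smult b (pderiv p))"

lemma coeff_radial_laplacian:
  "coeff (radial_laplacian b p) k = 4 * (real k + 1) * ((real k + b) * coeff p (k + 1) + (real k + 2) * coeff p (k + 2))"
  by (cases k) (simp_all add: radial_laplacian_def coeff_pderiv coeff_pCons algebra_simps)

lemma radial_laplacian_add: "radial_laplacian b (p + q) = radial_laplacian b p + radial_laplacian b q"
  by (rule poly_eqI) (simp add: coeff_radial_laplacian algebra_simps)

lemma radial_laplacian_smult: "radial_laplacian b (smult c p) = smult c (radial_laplacian b p)"
  by (rule poly_eqI) (simp add: coeff_radial_laplacian algebra_simps)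

lemma radial_laplacian_0: "radial_laplacian b 0 = 0"
  by (simp add: radial_laplacian_def)

lemma radial_laplacian_pow_add: "(radial_laplacian b ^^ k) (p + q) = (radial_laplacian b ^^ k) p + (radial_laplacian b ^^ k) q"
  by (induction k) (auto simp: radial_laplacian_add)

lemma radial_laplacian_pow_smult: "(radial_laplacian b ^^ k) (smult c p) = smult c ((radial_laplacian b ^^ k) p)"
  by (induction k) (auto simp: radial_laplacian_smult)

lemma radial_laplacian_pow_0: "(radial_laplacian b ^^ k) 0 = 0"
  by (induction k) (auto simp: radial_laplacian_0)

lemma radial_laplacian_pow_diff: "(radial_laplacian b ^^ k) (p - q) = (radial_laplacian b ^^ k) p - (radial_laplacian b ^^ k) q"
  using radial_laplacian_pow_add[where p = p and q = "smult (- 1) q" and b = b and k = k]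
  by (simp only: radial_laplacian_pow_smult) simp

lemma radial_laplacian_pow_sum: "(radial_laplacian b ^^ k) (\<Sum>i\<in>A. f i) = (\<Sum>i\<in>A. (radial_laplacian b ^^ k) (f i))"
  by (induction A rule: infinite_finite_induct) (auto simp: radial_laplacian_pow_0 radial_laplacian_pow_add)

text \<open>Each Laplacian lowers the degree by one. The bound is put as vanishing coefficients and
  not through \<open>degree\<close>, so that the zero polynomial is no special case.\<close>

lemma coeff_radial_laplacian_pow_eq_0: "(\<And>i. i \<ge> N \<Longrightarrow> coeff p i = 0) \<Longrightarrow> i + k \<ge> N \<Longrightarrow> coeff ((radial_laplacian b ^^ k) p) i = 0"
  by (induction k arbitrary: i) (auto simp: coeff_radial_laplacian)

lemma radial_laplacian_pow_eq_0: "(\<And>i. i \<ge> k \<Longrightarrow> coeff p i = 0) \<Longrightarrow> (radial_laplacian b ^^ k) p = 0"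
  by (rule poly_eqI) (auto intro: coeff_radial_laplacian_pow_eq_0[where N = k])

section \<open>Boundary values of iterated Laplacians\<close>

lemma radial_laplacian_monom:
  "radial_laplacian b (Polynomial.monom 1 i) = smult (4 * real i * (real i - 1)) (Polynomial.monom 1 (i - 2))
     + smult (4 * real i * (real i - 1 + b)) (Polynomial.monom 1 (i - 1))"
\<comment> \<open>The truncated exponents are harmless: the first coefficient vanishes for i < 2 and
  the second for i = 0.\<close>
proof -
  consider "i = 0" | "i = 1" | i' where "i = Suc (Suc i')"
    by (metis One_nat_def not0_implies_Suc)
  then show ?thesis
    by cases (auto intro!: poly_eqI simp: coeff_radial_laplacian coeff_pCons algebra_simps split: nat.split)
qed

text \<open>The value at t = 0, that is on the sphere, of k Laplacians of t^i. For b > 0 it is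
  nonzero exactly when k \<le> i \<le> 2k, because each Laplacian removes one or two factors
  t.\<close>

definition boundary_coeff :: "real \<Rightarrow> nat \<Rightarrow> nat \<Rightarrow> real" where
  "boundary_coeff b k i = (if k \<le> i then 4 ^ k * fact i * real (k choose (i - k)) * pochhammer b k / pochhammer b (i - k) else 0)"

text \<open>The innermost Laplacian is peeled off: it meets the power itself and leaves the
  exponents i - 1 and i - 2, for which the induction hypothesis is available. What remains is
  Pascal's rule together with absorption for binomial coefficients.\<close>

lemma coeff_0_radial_laplacian_pow_monom:
  assumes "b > 0"
  shows "coeff ((radial_laplacian b ^^ k) (Polynomial.monom 1 i)) 0 = boundary_coeff b k i"
proof (induction k arbitrary: i)
  case 0
  show ?case by (cases i) (auto simp: boundary_coeff_def)
next
  case (Suc k)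
  have "coeff ((radial_laplacian b ^^ Suc k) (Polynomial.monom 1 i)) 0
     = 4 * real i * (real i - 1) * boundary_coeff b k (i - 2) + 4 * real i * (real i - 1 + b) * boundary_coeff b k (i - 1)"
    by (simp only: funpow_Suc_right o_apply radial_laplacian_monom radial_laplacian_pow_add radial_laplacian_pow_smult coeff_add coeff_smult Suc.IH)
  also have "\<dots> = boundary_coeff b (Suc k) i"
  proof (cases "i \<le> k")
    case True
    then show ?thesis by (auto simp: boundary_coeff_def)
  next
    case False
    then obtain t where i: "i = Suc (k + t)" by (metis less_imp_Suc_add not_le)
    show ?thesis
    proof (cases t)
      case 0
      \<comment> \<open>On the diagonal i = k + 1 the term with \<open>i - 2\<close> drops out: for
        k > 0 the exponent k - 1 is too small, and for k = 0 the factor \<open>real i - 1\<close> is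
        0.\<close>
      then show ?thesis using i by (cases k) (auto simp: boundary_coeff_def pochhammer_rec' algebra_simps)
    next
      case (Suc u)
      have p: "pochhammer b u > 0" using assms by (rule pochhammer_pos)
      have ch: "real (Suc u) * real (k choose Suc u) = (real k - real u) * real (k choose u)"
      proof (cases "u \<le> k")
        case True
        have "Suc u * (k choose Suc u) = (k - u) * (k choose u)"
          by (simp only: binomial_absorption binomial_absorb_comp)
        from arg_cong[OF this, of real] True show ?thesis by (simp only: of_nat_mult of_nat_diff)
      qed (simp add: binomial_eq_0)
      have E1: "boundary_coeff b k (i - 2) = 4 ^ k * fact (k + u) * real (k choose u) * pochhammer b k / pochhammer b u"
        using i Suc by (simp add: boundary_coeff_def)
      have E2: "boundary_coeff b k (i - 1) = 4 ^ k * ((real k + real u + 1) * fact (k + u)) * real (k choose Suc u) * pochhammer b k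
          / ((b + real u) * pochhammer b u)"
        using i Suc by (simp add: boundary_coeff_def pochhammer_rec' algebra_simps)
      have E3: "boundary_coeff b (Suc k) i = 4 * 4 ^ k * ((real k + real u + 2) * ((real k + real u + 1) * fact (k + u)))
          * (real (k choose Suc u) + real (k choose u)) * ((b + real k) * pochhammer b k) / ((b + real u) * pochhammer b u)"
        using i Suc by (simp add: boundary_coeff_def pochhammer_rec' algebra_simps)
      have ri: "real i = real k + real u + 2" using i Suc by simp
      have key: "(b + real u) * real (k choose u) + (real k + real u + 1 + b) * real (k choose Suc u)
          = (real (k choose Suc u) + real (k choose u)) * (b + real k)"
        using ch by (simp add: algebra_simps)
      define F where "F = 4 ^ k * fact (k + u) * pochhammer b k / ((b + real u) * pochhammer b u)"
      have bu: "b + real u > 0" using assms by simp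
      have "boundary_coeff b k (i - 2) = F * (b + real u) * real (k choose u)"
        "boundary_coeff b k (i - 1) = F * (real k + real u + 1) * real (k choose Suc u)"
        "boundary_coeff b (Suc k) i = 4 * F * (real k + real u + 2) * (real k + real u + 1)
           * ((real (k choose Suc u) + real (k choose u)) * (b + real k))"
        unfolding E1 E2 E3 F_def using p bu by (simp_all add: divide_simps mult_ac)
      then show ?thesis unfolding ri by (simp add: key[symmetric]) (simp add: algebra_simps)
    qed
  qed
  finally show ?case .
qed

lemma poly_sum_monoms: "p = (\<Sum>i\<le>degree p. smult (coeff p i) (Polynomial.monom 1 i))" for p :: "real poly"
  using poly_as_sum_of_monoms[of p] by (simp add: smult_monom)

lemma coeff_0_radial_laplacian_pow:
  assumes "b > 0"
  shows "coeff ((radial_laplacian b ^^ k) p) 0 = (\<Sum>i\<le>degree p. coeff p i * boundary_coeff b k i)"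
  by (subst poly_sum_monoms) (simp only: radial_laplacian_pow_sum radial_laplacian_pow_smult coeff_sum coeff_smult coeff_0_radial_laplacian_pow_monom[OF assms])

lemma coeff_0_radial_laplacian_pow':
  assumes "b > 0" "\<And>i. i > N \<Longrightarrow> coeff p i = 0"
  shows "coeff ((radial_laplacian b ^^ k) p) 0 = (\<Sum>i\<le>N. coeff p i * boundary_coeff b k i)"
proof -
  have "degree p \<le> N" using assms(2) by (simp add: degree_le)
  then show ?thesis unfolding coeff_0_radial_laplacian_pow[OF assms(1)]
    by (intro sum.mono_neutral_left) (auto simp: coeff_eq_0)
qed

text \<open>Back substitution: the last equation fixes the last unknown, and its column moves to the
  right-hand side. Zero values beyond the system make the solution unique as a function, which is
  what a definite description requires.\<close>

lemma triangular_system: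
  fixes A :: "nat \<Rightarrow> nat \<Rightarrow> real"
  assumes "\<And>k. k < N \<Longrightarrow> A k k \<noteq> 0"
  shows "\<exists>!c. (\<forall>k<N. (\<Sum>i\<in>{k..<N}. A k i * c i) = r k) \<and> (\<forall>i\<ge>N. c i = 0)"
  using assms
proof (induction N arbitrary: r)
  case 0
  show ?case by (intro ex1I[of _ "\<lambda>_. 0"]) auto
next
  case (Suc N)
  let ?P = "\<lambda>N r c. (\<forall>k<N. (\<Sum>i\<in>{k..<N}. A k i * c i) = r k) \<and> (\<forall>i\<ge>N. c i = (0::real))"
  define r' where "r' k = r k - A k N * (r N / A N N)" for k
  have ANN: "A N N \<noteq> 0" using Suc.prems by simp
  have split: "?P (Suc N) r c \<longleftrightarrow> c N = r N / A N N \<and> ?P N r' (c(N := 0))" for c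
  proof -
    have 1: "(\<Sum>i\<in>{N..<Suc N}. A N i * c i) = r N \<longleftrightarrow> c N = r N / A N N"
      using ANN by (auto simp: field_simps)
    have 2: "(\<Sum>i\<in>{k..<Suc N}. A k i * c i) = (\<Sum>i\<in>{k..<N}. A k i * (c(N := 0)) i) + A k N * c N" if "k < N" for k
      using that by (simp add: sum.atLeastLessThan_Suc)
    have 3: "(\<forall>i\<ge>Suc N. c i = 0) \<longleftrightarrow> (\<forall>i\<ge>N. (c(N := 0)) i = 0)"
    proof -
      have "(Suc N \<le> i \<longrightarrow> c i = 0) \<longleftrightarrow> (N \<le> i \<longrightarrow> (c(N := 0)) i = 0)" for i
        by (cases "i = N") (auto simp: Suc_le_eq)
      then show ?thesis by blast
    qed
    have "(\<forall>k<Suc N. (\<Sum>i\<in>{k..<Suc N}. A k i * c i) = r k) \<longleftrightarrow>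
        c N = r N / A N N \<and> (\<forall>k<N. (\<Sum>i\<in>{k..<N}. A k i * (c(N := 0)) i) = r' k)"
    proof -
      have "(\<forall>k<Suc N. (\<Sum>i\<in>{k..<Suc N}. A k i * c i) = r k) \<longleftrightarrow>
          (\<Sum>i\<in>{N..<Suc N}. A N i * c i) = r N \<and> (\<forall>k<N. (\<Sum>i\<in>{k..<Suc N}. A k i * c i) = r k)"
        using less_Suc_eq by auto
      also have "\<dots> \<longleftrightarrow> c N = r N / A N N \<and> (\<forall>k<N. (\<Sum>i\<in>{k..<N}. A k i * (c(N := 0)) i) + A k N * c N = r k)"
        unfolding 1 using 2 by presburger
      also have "\<dots> \<longleftrightarrow> c N = r N / A N N \<and> (\<forall>k<N. (\<Sum>i\<in>{k..<N}. A k i * (c(N := 0)) i) = r' k)"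
        unfolding r'_def eq_diff_eq by (rule conj_cong[OF refl]) (simp only:)
      finally show ?thesis .
    qed
    then show ?thesis unfolding 3 by blast
  qed
  from Suc.IH[of r'] Suc.prems obtain c where c: "?P N r' c" and uniq: "\<And>c'. ?P N r' c' \<Longrightarrow> c' = c"
    by (auto elim!: ex1E)
  show ?case
  proof (rule ex1I)
    have "(c(N := r N / A N N))(N := 0) = c" using c by (auto simp: fun_eq_iff)
    then show "?P (Suc N) r (c(N := r N / A N N))" unfolding split using c by simp
    show "c' = c(N := r N / A N N)" if "?P (Suc N) r c'" for c'
    proof -
      from that have "c' N = r N / A N N" "?P N r' (c'(N := 0))" unfolding split by auto
      with uniq[of "c'(N := 0)"] show ?thesis by (auto simp: fun_eq_iff split: if_splits)
    qed
  qed
qed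

lemma pochhammer_uminus_nat: "pochhammer (- real i) k = (- 1) ^ k * fact k * real (i choose k)"
  by (simp add: binomial_gbinomial gbinomial_pochhammer)

text \<open>Up to sign, the linear system that defines the constants $c_i^{m,j}$ consists of the boundary values
  of iterated Laplacians of the powers of $1 - \|x\|^2$.\<close>

lemma system_entry:
  assumes "k \<le> i"
  shows "4 ^ k * (pochhammer (- real i) k * pochhammer (- real k) (i - k) * pochhammer b k / pochhammer b (i - k))
     = (- 1) ^ i * boundary_coeff b k i"
proof -
  have "fact k * fact (i - k) * real (i choose k) = fact i"
    using assms by (simp add: binomial_fact)
  moreover have "(- 1) ^ k * (- 1) ^ (i - k) = ((- 1) ^ i :: real)"
    using assms by (simp flip: power_add)
  ultimately show ?thesis
    using assms unfolding pochhammer_uminus_nat boundary_coeff_def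
    by (simp add: divide_simps) (simp add: mult_ac)
qed

text \<open>\<open>c_coef\<close> with m + d/2 replaced by a real parameter, which frees the radial
  calculus from the dimension type.\<close>

definition c_vec :: "real \<Rightarrow> nat \<Rightarrow> nat \<Rightarrow> real" where
  "c_vec b j = (THE c. (\<forall>k\<le>j.
        4 ^ k * (\<Sum>i = k..j. pochhammer (- real i) k * pochhammer (- real k) (i - k)
            * pochhammer b k / pochhammer b (i - k) * c i)
        = (if k = j then 1 else 0)) \<and> (\<forall>i>j. c i = 0))"

text \<open>\<open>[:0, - 1:]\<close> is 1 - |x|^2 in the variable |x|^2 - 1.\<close>

definition Y_radial :: "real \<Rightarrow> nat \<Rightarrow> real poly" where
  "Y_radial b j = (\<Sum>i\<le>j. smult (c_vec b j i) ([:0, - 1:] ^ i))"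

lemma coeff_Y_radial: "coeff (Y_radial b j) i = (if i \<le> j then (- 1) ^ i * c_vec b j i else 0)"
proof -
  have "[:0, - 1:] ^ i = smult ((- 1) ^ i) (Polynomial.monom (1::real) i)" for i
    by (simp add: monom_altdef flip: smult_power)
  then show ?thesis by (simp add: Y_radial_def coeff_sum if_distrib cong: if_cong)
qed

lemma c_vec_system:
  assumes "b > 0" "k \<le> j"
  shows "(\<Sum>i=k..j. (- 1) ^ i * boundary_coeff b k i * c_vec b j i) = (if k = j then 1 else 0)"
proof -
  have eq: "4 ^ k * (\<Sum>i = k..j. pochhammer (- real i) k * pochhammer (- real k) (i - k)
            * pochhammer b k / pochhammer b (i - k) * c i) = (\<Sum>i\<in>{k..<Suc j}. ((- 1) ^ i * boundary_coeff b k i) * c i)" for k and c :: "nat \<Rightarrow> real"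
    unfolding sum_distrib_left atLeastLessThanSuc_atLeastAtMost
    by (intro sum.cong refl, subst mult.assoc[symmetric], subst system_entry) auto
  have "\<exists>!c. (\<forall>k<Suc j. (\<Sum>i\<in>{k..<Suc j}. ((- 1) ^ i * boundary_coeff b k i) * c i) = (if k = j then 1 else 0)) \<and> (\<forall>i\<ge>Suc j. c i = 0)"
  proof (rule triangular_system)
    fix k
    show "(- 1) ^ k * boundary_coeff b k k \<noteq> 0"
      using pochhammer_pos[OF assms(1), of k] by (simp add: boundary_coeff_def)
  qed
  from theI'[OF this] assms(2) show ?thesis
    unfolding c_vec_def eq by (simp only: less_Suc_eq_le Suc_le_eq atLeastLessThanSuc_atLeastAtMost)
qed

text \<open>The property for which the constants c_i are designed: for k \<le> j it is the k-th
  equation of their system, and for k > j the Laplacians have exhausted the degree j.\<close>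

lemma coeff_0_radial_laplacian_pow_Y_radial:
  assumes "b > 0"
  shows "coeff ((radial_laplacian b ^^ k) (Y_radial b j)) 0 = (if k = j then 1 else 0)"
proof (cases "k \<le> j")
  case True
  have "coeff ((radial_laplacian b ^^ k) (Y_radial b j)) 0 = (\<Sum>i\<le>j. coeff (Y_radial b j) i * boundary_coeff b k i)"
    by (rule coeff_0_radial_laplacian_pow') (auto simp: assms coeff_Y_radial)
  also have "\<dots> = (\<Sum>i=k..j. (- 1) ^ i * boundary_coeff b k i * c_vec b j i)"
    by (rule sum.mono_neutral_cong_right) (auto simp: coeff_Y_radial boundary_coeff_def)
  finally show ?thesis using c_vec_system[OF assms True] by simp
next
  case False
  then show ?thesis by (subst radial_laplacian_pow_eq_0) (auto simp: coeff_Y_radial)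
qed

lemma coeff_Y_radial_top:
  assumes "b > 0"
  shows "coeff (Y_radial b j) j \<noteq> 0"
  using c_vec_system[OF assms order_refl, of j] by (auto simp: coeff_Y_radial)

section \<open>Moments and Jacobi polynomials\<close>

lemma poly_moment_bound: "degree p \<le> N \<Longrightarrow> poly_moment b p = (\<Sum>k\<le>N. coeff p k * moment b k)"
  unfolding poly_moment_def by (intro sum.mono_neutral_left) (auto simp: coeff_eq_0)

lemma poly_moment_add: "poly_moment b (p + q) = poly_moment b p + poly_moment b q"
proof -
  define N where "N = max (degree p) (degree q)"
  have "degree p \<le> N" "degree q \<le> N" "degree (p + q) \<le> N"
    using degree_add_le_max[of p q] by (auto simp: N_def)
  then show ?thesis by (simp only: poly_moment_bound coeff_add distrib_right sum.distrib)
qed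

lemma poly_moment_smult: "poly_moment b (smult c p) = c * poly_moment b p"
  using poly_moment_bound[OF degree_smult_le[of c p], of b] by (simp add: poly_moment_def sum_distrib_left mult.assoc)

lemma poly_moment_0: "poly_moment b 0 = 0"
  by (simp add: poly_moment_def)

lemma poly_moment_pCons_0: "poly_moment b (pCons 0 p) = (\<Sum>k\<le>degree p. coeff p k * moment b (Suc k))"
  unfolding poly_moment_bound[OF degree_pCons_le] sum.atMost_Suc_shift by simp

text \<open>\<open>[:1, 1:]\<close> is u = |x|^2, so the factor is absorbed by the weight
  u^(b-1).\<close>

lemma poly_moment_times_X1:
  assumes "b > 0"
  shows "poly_moment b ([:1, 1:] * p) = poly_moment (b + 1) p"
proof -
  have "[:1, 1:] * p = p + pCons 0 p" by simp
  then have "poly_moment b ([:1, 1:] * p) = (\<Sum>k\<le>degree p. coeff p k * (moment b k + moment b (Suc k)))"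
    by (simp only: poly_moment_add poly_moment_pCons_0 distrib_left sum.distrib) (simp add: poly_moment_def)
  then show ?thesis by (simp add: moment_Suc[OF assms] poly_moment_def)
qed

lemma poly_moment_times_X1_power: "b > 0 \<Longrightarrow> poly_moment b ([:1, 1:] ^ i * p) = poly_moment (b + real i) p"
proof (induction i arbitrary: b)
  case (Suc i)
  have "poly_moment b ([:1, 1:] ^ Suc i * p) = poly_moment b ([:1, 1:] * ([:1, 1:] ^ i * p))"
    by (simp only: power_Suc mult.assoc)
  also have "\<dots> = poly_moment (b + 1 + real i) p"
    using Suc by (simp only: poly_moment_times_X1 Suc.IH)
  finally show ?case by (simp add: add_ac)
qed simp

text \<open>Integration by parts on [0,1]: the boundary term at u = 1 is the constant coefficient,
  and b > 1 removes the one at u = 0.\<close>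

lemma poly_moment_pderiv:
  assumes "b > 1"
  shows "poly_moment b (pderiv p) + (b - 1) * poly_moment (b - 1) p = coeff p 0"
proof -
  have m: "(b - 1) * moment (b - 1) (Suc k) = - real (Suc k) * moment b k" for k
  proof -
    have "pochhammer (b - 1) (Suc (Suc k)) = (b - 1) * pochhammer b (Suc k)"
      using pochhammer_rec[of "b - 1" "Suc k"] by simp
    then show ?thesis using assms
      by (simp add: moment_def del: pochhammer_Suc) (simp add: algebra_simps add_divide_distrib diff_divide_distrib)
  qed
  have m0: "(b - 1) * moment (b - 1) 0 = 1" using assms by (simp add: moment_def)
  have "poly_moment b (pderiv p) = (\<Sum>k\<le>degree p. real (Suc k) * coeff p (Suc k) * moment b k)"
    by (subst poly_moment_bound[where N = "degree p"]) (simp_all add: degree_pderiv coeff_pderiv)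
  moreover have "(b - 1) * poly_moment (b - 1) p = (\<Sum>k\<le>Suc (degree p). coeff p k * ((b - 1) * moment (b - 1) k))"
    by (subst poly_moment_bound[where N = "Suc (degree p)"]) (simp_all only: sum_distrib_left mult.left_commute le_SucI order_refl)
  then have "(b - 1) * poly_moment (b - 1) p = coeff p 0 - (\<Sum>k\<le>degree p. real (Suc k) * coeff p (Suc k) * moment b k)"
  proof -
    assume *: "(b - 1) * poly_moment (b - 1) p = (\<Sum>k\<le>Suc (degree p). coeff p k * ((b - 1) * moment (b - 1) k))"
    have "(\<Sum>k\<le>degree p. coeff p (Suc k) * (- real (Suc k) * moment b k)) = - (\<Sum>k\<le>degree p. real (Suc k) * coeff p (Suc k) * moment b k)"
      unfolding sum_negf[symmetric] by (intro sum.cong refl) (simp add: algebra_simps)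
    then show ?thesis unfolding * sum.atMost_Suc_shift m m0 by simp
  qed
  ultimately show ?thesis by simp
qed

text \<open>Pascal's rule splits the sum for J + 1 into the sum for J and one with both a and c
  raised by one. The difference c - a does not change, so both parts have the same
  numerator.\<close>

lemma chu_vandermonde:
  assumes "c > 0"
  shows "(\<Sum>k\<le>J. (- 1) ^ k * real (J choose k) * pochhammer a k / pochhammer c k) = pochhammer (c - a) J / pochhammer c J"
  using assms
proof (induction J arbitrary: a c)
  case (Suc J)
  let ?t = "\<lambda>J a c k. (- 1) ^ k * real (J choose k) * pochhammer a k / pochhammer c k"
  have c: "pochhammer c n > 0" for n using Suc.prems by (rule pochhammer_pos)
  have c1: "pochhammer (c + 1) n > 0" for n using Suc.prems by (intro pochhammer_pos) simp
  have "(\<Sum>k\<le>Suc J. ?t (Suc J) a c k) = (\<Sum>k\<le>Suc J. ?t J a c k) - a / c * (\<Sum>k\<le>J. ?t J (a + 1) (c + 1) k)"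
  proof -
    have "?t (Suc J) a c (Suc k) = ?t J a c (Suc k) - a / c * ?t J (a + 1) (c + 1) k" for k
      using c1[of k] Suc.prems by (simp add: pochhammer_rec divide_simps) (simp add: algebra_simps)
    then show ?thesis
      by (subst (1 2) sum.atMost_Suc_shift) (simp add: sum_subtractf sum_distrib_left)
  qed
  also have "(\<Sum>k\<le>Suc J. ?t J a c k) = (\<Sum>k\<le>J. ?t J a c k)" by simp
  also have "(\<Sum>k\<le>J. ?t J a c k) - a / c * (\<Sum>k\<le>J. ?t J (a + 1) (c + 1) k)
      = pochhammer (c - a) J / pochhammer c J - a / c * (pochhammer (c - a) J / pochhammer (c + 1) J)"
    using Suc.IH[of c a] Suc.IH[of "c + 1" "a + 1"] Suc.prems by simp
  also have "\<dots> = pochhammer (c - a) (Suc J) / pochhammer c (Suc J)"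
  proof -
    have e: "c * pochhammer (c + 1) J = (c + real J) * pochhammer c J"
      by (simp only: pochhammer_rec[symmetric] pochhammer_rec'[symmetric])
    have "a / c * (pochhammer (c - a) J / pochhammer (c + 1) J) = a * pochhammer (c - a) J / (c * pochhammer (c + 1) J)"
      by simp
    also have "\<dots> = a * pochhammer (c - a) J / ((c + real J) * pochhammer c J)" by (simp only: e)
    finally have "a / c * (pochhammer (c - a) J / pochhammer (c + 1) J) = a * pochhammer (c - a) J / ((c + real J) * pochhammer c J)" .
    then show ?thesis
      by (rule ssubst) (use c[of J] Suc.prems in \<open>simp add: pochhammer_rec' divide_simps, simp add: algebra_simps\<close>)
  qed
  finally show ?case .
qed simp

text \<open>The closed formula inside \<open>gen_jacobi\<close>, at every index. Below a positive
  \<open>j0_gen\<close> its Pochhammer denominator contains the factor 0.\<close>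

definition jacobi_coeff :: "real \<Rightarrow> real \<Rightarrow> nat \<Rightarrow> nat \<Rightarrow> real" where
  "jacobi_coeff \<alpha> \<beta> j k = pochhammer (real k + \<alpha> + 1) (j - k)
      / (fact (j - k) * fact k * pochhammer (real j + \<alpha> + \<beta> + real k + 1) (j - k))"

text \<open>Up to the factor 4 this is the action of \<open>radial_laplacian\<close> with b =
  \<beta> + 1, read off coefficientwise: it takes parameters (\<alpha>, \<beta>) and degree j to
  (\<alpha> + 2, \<beta>) and degree j - 1. The assumption \<open>pos\<close> makes the first
  Pochhammer factor at index k + 1 positive, so that denominators can be cleared.\<close>

lemma jacobi_coeff_rec:
  assumes kj: "k < j" and pos: "real k + 2 + (real j + \<alpha> + \<beta>) > 0"
  shows "(real k + 1) * ((real k + \<beta> + 1) * jacobi_coeff \<alpha> \<beta> j (k + 1) + (real k + 2) * (if k + 2 \<le> j then jacobi_coeff \<alpha> \<beta> j (k + 2) else 0))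
    = (real j + \<beta>) * jacobi_coeff (\<alpha> + 2) \<beta> (j - 1) k"
proof -
  obtain J where j: "j = Suc (k + J)" using kj less_imp_Suc_add by blast
  show ?thesis
  proof (cases J)
    case 0
    then show ?thesis by (simp add: j jacobi_coeff_def divide_simps) (simp add: algebra_simps)
  next
    case (Suc I)
    define x where "x = real j + \<alpha> + \<beta> + real k + 2"
    define p q where "p = pochhammer (real k + \<alpha> + 3) I" and "q = pochhammer (x + 1) I"
    have rj: "real j = real k + real I + 2" by (simp add: j Suc)
    have x: "x > 0" using pos by (simp add: x_def)
    then have q: "q > 0" unfolding q_def by (intro pochhammer_pos) simp
    have A1: "jacobi_coeff \<alpha> \<beta> j (k + 1) = (real k + \<alpha> + 2) * p / ((real I + 1) * fact I * ((real k + 1) * fact k) * (x * q))"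
    proof -
      have "pochhammer (real (k + 1) + \<alpha> + 1) (j - (k + 1)) = (real k + \<alpha> + 2) * p"
        by (simp add: j Suc p_def pochhammer_rec add_ac)
      moreover have "pochhammer (real j + \<alpha> + \<beta> + real (k + 1) + 1) (j - (k + 1)) = x * q"
        unfolding q_def pochhammer_rec[symmetric] by (simp add: j Suc x_def add_ac)
      ultimately show ?thesis unfolding jacobi_coeff_def by (simp add: j Suc algebra_simps)
    qed
    have A2: "jacobi_coeff \<alpha> \<beta> j (k + 2) = p / (fact I * ((real k + 2) * ((real k + 1) * fact k)) * q)"
    proof -
      have "pochhammer (real (k + 2) + \<alpha> + 1) (j - (k + 2)) = p"
        by (simp add: j Suc p_def add_ac)
      moreover have "pochhammer (real j + \<alpha> + \<beta> + real (k + 2) + 1) (j - (k + 2)) = q"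
        unfolding q_def by (simp add: j Suc x_def add_ac)
      ultimately show ?thesis unfolding jacobi_coeff_def by (simp add: j Suc algebra_simps)
    qed
    have A3: "jacobi_coeff (\<alpha> + 2) \<beta> (j - 1) k = p * (real j + \<alpha> + 1) / ((real I + 1) * fact I * fact k * (x * q))"
    proof -
      have "pochhammer (real k + (\<alpha> + 2) + 1) (j - 1 - k) = p * (real j + \<alpha> + 1)"
        by (simp add: j Suc p_def pochhammer_rec' algebra_simps)
      moreover have "pochhammer (real (j - 1) + (\<alpha> + 2) + \<beta> + real k + 1) (j - 1 - k) = x * q"
        unfolding q_def pochhammer_rec[symmetric] by (simp add: j Suc x_def algebra_simps)
      ultimately show ?thesis unfolding jacobi_coeff_def by (simp add: j Suc algebra_simps)
    qed
    have key: "(real k + \<beta> + 1) * (real k + \<alpha> + 2) + (real I + 1) * x = (real j + \<beta>) * (real j + \<alpha> + 1)"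
      unfolding x_def rj by (simp add: algebra_simps)
    define F where "F = p / ((real I + 1) * fact I * fact k * (x * q))"
    have "(real k + 1) * jacobi_coeff \<alpha> \<beta> j (k + 1) = F * (real k + \<alpha> + 2)"
      "(real k + 1) * ((real k + 2) * jacobi_coeff \<alpha> \<beta> j (k + 2)) = F * ((real I + 1) * x)"
      "jacobi_coeff (\<alpha> + 2) \<beta> (j - 1) k = F * (real j + \<alpha> + 1)"
      unfolding A1 A2 A3 F_def using x q by (simp_all add: divide_simps)
    note F = this
    moreover have "k + 2 \<le> j" by (simp add: j Suc)
    ultimately have "(real k + 1) * ((real k + \<beta> + 1) * jacobi_coeff \<alpha> \<beta> j (k + 1) + (real k + 2) * (if k + 2 \<le> j then jacobi_coeff \<alpha> \<beta> j (k + 2) else 0))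
      = F * ((real k + \<beta> + 1) * (real k + \<alpha> + 2) + (real I + 1) * x)"
      by (simp add: distrib_left mult.left_commute[of "real k + 1"]) (simp add: algebra_simps)
    then show ?thesis unfolding key F(3) by simp
  qed
qed

text \<open>Differentiation raises both parameters by one and leaves the two Pochhammer symbols
  literally the same. For odd s this is the last half step after the Laplacians.\<close>

lemma jacobi_coeff_deriv:
  assumes "k < j"
  shows "(real k + 1) * jacobi_coeff \<alpha> \<beta> j (Suc k) = jacobi_coeff (\<alpha> + 1) (\<beta> + 1) (j - 1) k"
proof -
  obtain J where j: "j = Suc (k + J)" using assms less_imp_Suc_add by blast
  show ?thesis by (simp add: jacobi_coeff_def j add_ac divide_simps)
qed

text \<open>Written in the variable (t - 1)/2, which for t = 2|x|^2 - 1 is |x|^2 - 1, as in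
  \<open>radial\<close>.\<close>

definition jacobi_poly :: "real \<Rightarrow> real \<Rightarrow> nat \<Rightarrow> real poly" where
  "jacobi_poly \<alpha> \<beta> j = (\<Sum>k=j0_gen \<alpha> \<beta> j..j. Polynomial.monom (jacobi_coeff \<alpha> \<beta> j k) k)"

lemma coeff_jacobi_poly: "coeff (jacobi_poly \<alpha> \<beta> j) k = (if j0_gen \<alpha> \<beta> j \<le> k \<and> k \<le> j then jacobi_coeff \<alpha> \<beta> j k else 0)"
  by (simp add: jacobi_poly_def coeff_sum if_distrib cong: if_cong)

lemma gen_jacobi_eq_poly: "gen_jacobi \<alpha> \<beta> j t = poly (jacobi_poly \<alpha> \<beta> j) ((t - 1) / 2)"
  by (simp add: gen_jacobi_def jacobi_poly_def jacobi_coeff_def poly_sum poly_monom)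

lemma j0_gen_le: "j0_gen \<alpha> \<beta> j \<le> j"
  unfolding j0_gen_def Let_def by (auto simp: nat_le_iff floor_le_iff)

lemma j0_gen_le': "real k + 1 + (real j + \<alpha> + \<beta>) > 0 \<Longrightarrow> j0_gen \<alpha> \<beta> j \<le> k"
  unfolding j0_gen_def Let_def by (auto simp: nat_le_iff floor_le_iff)

text \<open>Below the truncation index $j_0$ the coefficients do not follow the closed formula. Each application of
  the Laplacian lowers the first index at which it holds by one, and for $j \ge \lceil s/2 \rceil$ no exceptional
  index is left after $\lfloor s/2 \rfloor$ steps.\<close>

lemma coeff_radial_laplacian_pow_jacobi_poly:
  assumes "\<sigma> \<le> j" "k + \<sigma> \<le> j" "real k + 1 + real \<sigma> + (real j + \<alpha> + b - 1) > 0"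
  shows "coeff ((radial_laplacian b ^^ \<sigma>) (jacobi_poly \<alpha> (b - 1) j)) k
    = 4 ^ \<sigma> * pochhammer (real j - real \<sigma> + b) \<sigma> * jacobi_coeff (\<alpha> + 2 * real \<sigma>) (b - 1) (j - \<sigma>) k"
  using assms
proof (induction \<sigma> arbitrary: k)
  case 0
  then show ?case using j0_gen_le'[of k j \<alpha> "b - 1"] by (simp add: coeff_jacobi_poly)
next
  case (Suc \<sigma>)
  let ?C = "4 ^ \<sigma> * pochhammer (real j - real \<sigma> + b) \<sigma>"
  let ?A = "jacobi_coeff (\<alpha> + 2 * real \<sigma>) (b - 1) (j - \<sigma>)"
  let ?p = "(radial_laplacian b ^^ \<sigma>) (jacobi_poly \<alpha> (b - 1) j)"
  \<comment> \<open>The positivity assumption involves only k + \<sigma>, so it passes unchanged to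
    index k + 1 with one Laplacian less.\<close>
  have c1: "coeff ?p (k + 1) = ?C * ?A (k + 1)"
    using Suc.prems by (intro Suc.IH) auto
  have c2: "coeff ?p (k + 2) = ?C * (if k + 2 \<le> j - \<sigma> then ?A (k + 2) else 0)"
  proof (cases "k + 2 \<le> j - \<sigma>")
    case True
    then show ?thesis using Suc.prems by (subst Suc.IH) auto
  next
    case False
    then show ?thesis by (subst coeff_radial_laplacian_pow_eq_0[where N = "Suc j"]) (auto simp: coeff_jacobi_poly)
  qed
  have "coeff ((radial_laplacian b ^^ Suc \<sigma>) (jacobi_poly \<alpha> (b - 1) j)) k
    = 4 * ?C * ((real k + 1) * ((real k + (b - 1) + 1) * ?A (k + 1) + (real k + 2) * (if k + 2 \<le> j - \<sigma> then ?A (k + 2) else 0)))"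
    by (simp only: funpow.simps o_apply coeff_radial_laplacian c1 c2) (simp add: algebra_simps)
  also have "\<dots> = 4 * ?C * ((real (j - \<sigma>) + (b - 1)) * jacobi_coeff (\<alpha> + 2 * real \<sigma> + 2) (b - 1) (j - \<sigma> - 1) k)"
    using Suc.prems by (subst jacobi_coeff_rec) (auto simp: of_nat_diff algebra_simps)
  also have "\<dots> = 4 ^ Suc \<sigma> * pochhammer (real j - real (Suc \<sigma>) + b) (Suc \<sigma>)
      * jacobi_coeff (\<alpha> + 2 * real (Suc \<sigma>)) (b - 1) (j - Suc \<sigma>) k"
    using Suc.prems by (simp add: pochhammer_rec of_nat_diff algebra_simps)
  finally show ?case .
qed

text \<open>The Jacobi polynomial with parameters (0, b - 1) in the variable u - 1, orthogonal on
  [0,1] for the weight u^(b-1) and with leading coefficient 1/J!.\<close>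

definition shifted_jacobi :: "real \<Rightarrow> nat \<Rightarrow> real poly" where
  "shifted_jacobi b J = (\<Sum>k\<le>J. Polynomial.monom (jacobi_coeff 0 (b - 1) J k) k)"

lemma coeff_shifted_jacobi: "coeff (shifted_jacobi b J) k = (if k \<le> J then jacobi_coeff 0 (b - 1) J k else 0)"
  by (simp add: shifted_jacobi_def coeff_sum if_distrib cong: if_cong)

lemma degree_shifted_jacobi: "degree (shifted_jacobi b J) \<le> J"
  by (rule degree_le) (simp add: coeff_shifted_jacobi)

text \<open>The shift of the weight by i stands for a factor u^i. Coefficient times moment is a
  Chu-Vandermonde summand with a = J + b and c = b + i + 1, so the numerator starts at i + 1 - J and
  contains a zero exactly when i < J.\<close>

lemma poly_moment_shifted_jacobi:
  assumes "b > 0"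
  shows "poly_moment (b + real i) (shifted_jacobi b J)
    = pochhammer (real i + 1 - real J) J / (pochhammer (real J + b) J * (b + real i) * pochhammer (b + real i + 1) J)"
proof -
  have P: "pochhammer (real J + b) n > 0" for n using assms by (intro pochhammer_pos) simp
  have Q: "pochhammer (b + real i + 1) n > 0" for n using assms by (intro pochhammer_pos) simp
  have trm: "coeff (shifted_jacobi b J) k * moment (b + real i) k = 1 / (pochhammer (real J + b) J * (b + real i))
     * ((- 1) ^ k * real (J choose k) * pochhammer (real J + b) k / pochhammer (b + real i + 1) k)" if "k \<le> J" for k
  proof -
    have 1: "pochhammer (real J + b) J = pochhammer (real J + b) k * pochhammer (real J + b + real k) (J - k)"
      using pochhammer_product[OF that, of "real J + b"] .
    have 2: "pochhammer (real k + 1) (J - k) * fact k = (fact J :: real)"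
      using pochhammer_product[OF that, of "1::real"] by (simp add: pochhammer_fact[symmetric] add_ac mult.commute)
    have 3: "fact k * fact (J - k) * real (J choose k) = fact J"
      using that by (simp add: binomial_fact)
    have R: "pochhammer (real J + b + real k) (J - k) > 0" using assms by (intro pochhammer_pos) simp
    have 4: "pochhammer (real k + 1) (J - k) = fact (J - k) * real (J choose k)"
      using 2 3 by (simp add: mult_ac) (metis fact_nonzero mult.left_commute mult_left_cancel)
    have "jacobi_coeff 0 (b - 1) J k = real (J choose k) / (fact k * pochhammer (real J + b + real k) (J - k))"
      using 4 by (simp add: jacobi_coeff_def add_ac)
    then show ?thesis using that P[of k] Q[of k] R assms
      by (simp add: coeff_shifted_jacobi moment_def 1 pochhammer_rec divide_simps mult_ac)
  qed
  have "poly_moment (b + real i) (shifted_jacobi b J) = (\<Sum>k\<le>J. 1 / (pochhammer (real J + b) J * (b + real i))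
     * ((- 1) ^ k * real (J choose k) * pochhammer (real J + b) k / pochhammer (b + real i + 1) k))"
    unfolding poly_moment_bound[OF degree_shifted_jacobi] using trm by (intro sum.cong) auto
  also have "\<dots> = 1 / (pochhammer (real J + b) J * (b + real i)) * (pochhammer (b + real i + 1 - (real J + b)) J / pochhammer (b + real i + 1) J)"
    unfolding sum_distrib_left[symmetric] using assms by (subst chu_vandermonde) auto
  finally show ?thesis by (simp add: algebra_simps)
qed

lemma poly_moment_shifted_jacobi_less:
  assumes "b > 0" "i < J"
  shows "poly_moment (b + real i) (shifted_jacobi b J) = 0"
proof -
  have "real i + 1 - real J = - real (J - Suc i)" using assms(2) by (simp add: of_nat_diff)
  moreover have "pochhammer (- real (J - Suc i)) J = 0"
    using assms(2) by (simp add: pochhammer_of_nat_eq_0_iff del: of_nat_diff)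
  ultimately show ?thesis by (simp add: poly_moment_shifted_jacobi[OF assms(1)] del: of_nat_diff)
qed

lemma coeff_X1_power: "coeff ([:1, 1:] ^ N :: real poly) N = 1" "i > N \<Longrightarrow> coeff ([:1, 1:] ^ N :: real poly) i = 0"
proof -
  have d: "degree ([:1, 1:] ^ N :: real poly) = N" by (simp add: degree_power_eq)
  show "coeff ([:1, 1:] ^ N :: real poly) N = 1" using lead_coeff_power[of "[:1, 1::real:]" N] d by simp
  show "i > N \<Longrightarrow> coeff ([:1, 1:] ^ N :: real poly) i = 0" using d by (simp add: coeff_eq_0)
qed

text \<open>Peels off leading powers of u = 1 + t instead of t, because powers of u only shift the
  weight.\<close>

lemma poly_moment_shifted_jacobi_orthogonal:
  assumes "b > 0"
  shows "(\<And>i. i \<ge> N \<Longrightarrow> coeff p i = 0) \<Longrightarrow> N \<le> J \<Longrightarrow> poly_moment b (p * shifted_jacobi b J) = 0"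
proof (induction N arbitrary: p)
  case 0
  then have "p = 0" by (intro poly_eqI) simp
  then show ?case by (simp add: poly_moment_0)
next
  case (Suc N)
  define q where "q = p - smult (coeff p N) ([:1, 1:] ^ N)"
  have "coeff q i = 0" if "i \<ge> N" for i
    using that Suc.prems(1)[of i] by (cases "i = N") (auto simp: q_def coeff_X1_power)
  then have q: "poly_moment b (q * shifted_jacobi b J) = 0" using Suc by simp
  have "p * shifted_jacobi b J = q * shifted_jacobi b J + smult (coeff p N) ([:1, 1:] ^ N * shifted_jacobi b J)"
    by (simp add: q_def algebra_simps)
  then show ?case using Suc.prems(2)
    by (simp only: poly_moment_add q poly_moment_smult poly_moment_times_X1_power[OF assms]) (simp add: poly_moment_shifted_jacobi_less assms)
qed

lemma poly_moment_shifted_jacobi_shifted_jacobi: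
  assumes "b > 0"
  shows "poly_moment b (shifted_jacobi b J * shifted_jacobi b J') =
    (if J = J' then 1 / ((2 * real J + b) * (pochhammer (real J + b) J)\<^sup>2) else 0)"
proof (cases "J = J'")
  case True
  have P: "pochhammer (real J + b) n > 0" for n using assms by (intro pochhammer_pos) simp
  \<comment> \<open>Only the leading term u^J / J! contributes to the norm; the rest has lower
    degree and is orthogonal.\<close>
  define q where "q = shifted_jacobi b J - smult (1 / fact J) ([:1, 1:] ^ J)"
  have "coeff q i = 0" if "i \<ge> J" for i
    using that by (cases "i = J") (auto simp: q_def coeff_X1_power coeff_shifted_jacobi jacobi_coeff_def)
  then have q: "poly_moment b (q * shifted_jacobi b J) = 0"
    by (intro poly_moment_shifted_jacobi_orthogonal[OF assms, where N = J]) auto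
  have "shifted_jacobi b J * shifted_jacobi b J = q * shifted_jacobi b J + smult (1 / fact J) ([:1, 1:] ^ J * shifted_jacobi b J)"
    by (simp add: q_def algebra_simps)
  then have "poly_moment b (shifted_jacobi b J * shifted_jacobi b J) = 1 / fact J * poly_moment (b + real J) (shifted_jacobi b J)"
    by (simp only: poly_moment_add q poly_moment_smult poly_moment_times_X1_power[OF assms] add_0)
  also have "\<dots> = 1 / (pochhammer (real J + b) J * ((b + real J) * pochhammer (b + real J + 1) J))"
    by (simp add: poly_moment_shifted_jacobi[OF assms] pochhammer_fact[symmetric] add_ac)
  also have "(b + real J) * pochhammer (b + real J + 1) J = (2 * real J + b) * pochhammer (real J + b) J"
    unfolding pochhammer_rec[symmetric] pochhammer_rec' by (simp add: add_ac)
  finally show ?thesis using True by (simp add: power2_eq_square mult_ac)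
next
  case False
  have less: "poly_moment b (shifted_jacobi b J * shifted_jacobi b J') = 0" if "J < J'" for J J'
    using that by (intro poly_moment_shifted_jacobi_orthogonal[OF assms, where N = J']) (auto simp: coeff_shifted_jacobi)
  show ?thesis using False less[of J J'] less[of J' J] by (auto simp: mult.commute neq_iff)
qed

section \<open>The radial factors of the basis\<close>

text \<open>With b = n - 2j + d/2 the prefactor of \<open>P_poly\<close> becomes (j + b)_j, so the
  radial factor depends on n only through b.\<close>

definition P_radial :: "nat \<Rightarrow> real \<Rightarrow> nat \<Rightarrow> real poly" where
  "P_radial s b j = smult (pochhammer (real j + b) j) (jacobi_poly (- real s) (b - 1) j)"

definition Q_radial :: "nat \<Rightarrow> real \<Rightarrow> nat \<Rightarrow> real poly" where
  "Q_radial s b j = (if s \<le> j then P_radial s b j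
     else if ceil_half s \<le> j then P_radial s b j
       - (\<Sum>k<ceil_half s. smult (coeff ((radial_laplacian b ^^ k) (P_radial s b j)) 0) (Y_radial b k))
     else Y_radial b j)"

text \<open>The volume term for a fixed normalized harmonic factor, divided by d. For odd s the part
  that is a boundary value is split off; the remaining derivatives contribute 4 |x|^2 p' q', whose
  factor |x|^2 is the shift to b + 1.\<close>

definition radial_form :: "nat \<Rightarrow> real \<Rightarrow> real poly \<Rightarrow> real poly \<Rightarrow> real" where
  "radial_form s b p q = (let \<sigma> = s div 2; p' = (radial_laplacian b ^^ \<sigma>) p; q' = (radial_laplacian b ^^ \<sigma>) q in
     if even s then poly_moment b (p' * q') / 2 else 2 * poly_moment (b + 1) (pderiv p' * pderiv q'))"

lemma radial_form_commute: "radial_form s b p q = radial_form s b q p"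
  by (simp add: radial_form_def Let_def mult.commute)

lemma coeff_P_radial_gt: "i > j \<Longrightarrow> coeff (P_radial s b j) i = 0"
  by (simp add: P_radial_def coeff_jacobi_poly)

text \<open>With \<alpha> = -s the symbol (i - s + 1)_(j - i) passes through 0 for i < s \<le> j.
  Hence the radial factor has a zero of order s on the sphere.\<close>

lemma coeff_P_radial_lt: "s \<le> j \<Longrightarrow> i < s \<Longrightarrow> coeff (P_radial s b j) i = 0"
proof -
  assume *: "s \<le> j" "i < s"
  then have "real i + - real s + 1 = - real (s - Suc i)" by (simp add: of_nat_diff)
  moreover have "pochhammer (- real (s - Suc i)) (j - i) = 0"
    using * by (simp add: pochhammer_of_nat_eq_0_iff del: of_nat_diff)
  ultimately show ?thesis by (simp add: P_radial_def coeff_jacobi_poly jacobi_coeff_def del: of_nat_diff)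
qed

lemma ceil_half_le: "k < ceil_half s \<Longrightarrow> 2 * k < s"
  by (auto simp: ceil_half_def)

text \<open>The reason depends on the range of j. For j \<ge> s the zero of order s wins, since the
  k-th boundary value sees only powers up to 2k < s. For smaller j above the threshold the
  subtracted terms cancel the boundary values one by one, by the duality of the
  \<open>Y_radial\<close>. Below the threshold it is that duality itself.\<close>

lemma coeff_0_radial_laplacian_pow_Q_radial:
  assumes b: "b > 0" and k: "k < ceil_half s"
  shows "coeff ((radial_laplacian b ^^ k) (Q_radial s b j)) 0 = (if j = k then 1 else 0)"
proof -
  consider "s \<le> j" | "\<not> s \<le> j" "ceil_half s \<le> j" | "j < ceil_half s" "\<not> s \<le> j"
    by linarith
  then show ?thesis
  proof cases
    case 1
    have "coeff ((radial_laplacian b ^^ k) (P_radial s b j)) 0 = (\<Sum>i\<le>j. coeff (P_radial s b j) i * boundary_coeff b k i)"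
      by (rule coeff_0_radial_laplacian_pow'[OF b]) (rule coeff_P_radial_gt)
    also have "\<dots> = 0"
    proof (intro sum.neutral ballI)
      fix i
      show "coeff (P_radial s b j) i * boundary_coeff b k i = 0"
      proof (cases "i < s")
        case False
        then have "k choose (i - k) = 0" using ceil_half_le[OF k] by (simp add: binomial_eq_0)
        then show ?thesis by (simp add: boundary_coeff_def)
      qed (simp add: coeff_P_radial_lt[OF 1])
    qed
    moreover have "j \<noteq> k" using 1 ceil_half_le[OF k] by auto
    ultimately show ?thesis using 1 by (simp add: Q_radial_def)
  next
    case 2
    have "j \<noteq> k" using 2 k by auto
    then show ?thesis using 2 k
      by (simp add: Q_radial_def radial_laplacian_pow_diff radial_laplacian_pow_sum radial_laplacian_pow_smult coeff_sum coeff_0_radial_laplacian_pow_Y_radial[OF b]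
          if_distrib cong: if_cong)
  next
    case 3
    then show ?thesis by (auto simp: Q_radial_def coeff_0_radial_laplacian_pow_Y_radial[OF b])
  qed
qed

lemma coeff_Q_radial_gt: "i > j \<Longrightarrow> coeff (Q_radial s b j) i = 0"
  by (auto simp: Q_radial_def coeff_P_radial_gt coeff_Y_radial coeff_sum intro!: sum.neutral)

text \<open>The correction terms have degree below \<open>ceil_half s\<close> and thus below j, so
  they do not reach the leading coefficient.\<close>

lemma coeff_Q_radial_top:
  assumes b: "b > 0"
  shows "coeff (Q_radial s b j) j \<noteq> 0"
proof -
  have "pochhammer (real j + b) j > 0" using b by (intro pochhammer_pos) simp
  then have "coeff (P_radial s b j) j \<noteq> 0"
    by (simp add: P_radial_def coeff_jacobi_poly j0_gen_le jacobi_coeff_def)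
  moreover have "(\<Sum>k<ceil_half s. coeff ((radial_laplacian b ^^ k) (P_radial s b j)) 0 * coeff (Y_radial b k) j) = 0" if "ceil_half s \<le> j"
    using that by (intro sum.neutral ballI) (simp add: coeff_Y_radial)
  ultimately show ?thesis by (auto simp: Q_radial_def coeff_sum coeff_Y_radial_top[OF b])
qed

text \<open>The prefactor of \<open>P_radial\<close> times the factor produced by \<sigma>
  Laplacians.\<close>

definition iterate_factor :: "nat \<Rightarrow> real \<Rightarrow> nat \<Rightarrow> real" where
  "iterate_factor \<sigma> b j = pochhammer (real j + b) j * (4 ^ \<sigma> * pochhammer (real j - real \<sigma> + b) \<sigma>)"

lemma ceil_half_even: "even s \<Longrightarrow> ceil_half s = s div 2"
  and ceil_half_odd: "odd s \<Longrightarrow> ceil_half s = Suc (s div 2)"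
  by (auto simp: ceil_half_def elim!: evenE oddE)

lemma radial_laplacian_pow_Y_radial_eq_0: "j < \<sigma> \<Longrightarrow> (radial_laplacian b ^^ \<sigma>) (Y_radial b j) = 0"
  by (rule radial_laplacian_pow_eq_0) (simp add: coeff_Y_radial)

lemma pderiv_radial_laplacian_pow_Y_radial_eq_0: "j < Suc \<sigma> \<Longrightarrow> pderiv ((radial_laplacian b ^^ \<sigma>) (Y_radial b j)) = 0"
  by (rule poly_eqI) (auto simp: coeff_pderiv coeff_Y_radial intro!: coeff_radial_laplacian_pow_eq_0[where N = "Suc j"])

text \<open>Each Laplacian raises the first Jacobi parameter by 2, so s/2 of them bring it from -s
  to 0. The correction terms have degree below s/2 and are annihilated.\<close>

lemma radial_laplacian_pow_Q_radial_even:
  assumes b: "b > 0" and "even s" and j: "ceil_half s \<le> j"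
  shows "(radial_laplacian b ^^ (s div 2)) (Q_radial s b j) = smult (iterate_factor (s div 2) b j) (shifted_jacobi b (j - s div 2))"
proof -
  define \<sigma> where "\<sigma> = s div 2"
  have s: "s = 2 * \<sigma>" using \<open>even s\<close> by (simp add: \<sigma>_def)
  have j: "\<sigma> \<le> j" using j ceil_half_even[OF \<open>even s\<close>] by (simp add: \<sigma>_def)
  have "(radial_laplacian b ^^ \<sigma>) (Q_radial s b j) = (radial_laplacian b ^^ \<sigma>) (P_radial s b j)"
    using j ceil_half_even[OF \<open>even s\<close>]
    by (simp add: Q_radial_def radial_laplacian_pow_diff radial_laplacian_pow_sum radial_laplacian_pow_smult radial_laplacian_pow_Y_radial_eq_0 \<sigma>_def)
  also have "\<dots> = smult (iterate_factor \<sigma> b j) (shifted_jacobi b (j - \<sigma>))"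
  proof (rule poly_eqI)
    fix k
    show "coeff ((radial_laplacian b ^^ \<sigma>) (P_radial s b j)) k = coeff (smult (iterate_factor \<sigma> b j) (shifted_jacobi b (j - \<sigma>))) k"
    proof (cases "k + \<sigma> \<le> j")
      case True
      then show ?thesis using b j
        by (simp add: P_radial_def radial_laplacian_pow_smult coeff_radial_laplacian_pow_jacobi_poly s coeff_shifted_jacobi iterate_factor_def)
    next
      case False
      then show ?thesis
        using j by (subst coeff_radial_laplacian_pow_eq_0[where N = "Suc j"]) (auto simp: coeff_P_radial_gt coeff_shifted_jacobi)
    qed
  qed
  finally show ?thesis unfolding \<sigma>_def .
qed

text \<open>The Laplacians bring the first parameter from -s to -1, and the derivative raises it to
  0 and the second one from b - 1 to b. The correction terms have become constants by then.\<close>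

lemma pderiv_radial_laplacian_pow_Q_radial_odd:
  assumes b: "b > 0" and "odd s" and j: "ceil_half s \<le> j"
  shows "pderiv ((radial_laplacian b ^^ (s div 2)) (Q_radial s b j)) = smult (iterate_factor (s div 2) b j) (shifted_jacobi (b + 1) (j - Suc (s div 2)))"
proof -
  define \<sigma> where "\<sigma> = s div 2"
  have s: "s = Suc (2 * \<sigma>)" using \<open>odd s\<close> by (simp add: \<sigma>_def)
  have z: "pderiv ((radial_laplacian b ^^ \<sigma>) (Y_radial b k)) = 0" if "k < ceil_half s" for k
    using that ceil_half_odd[OF \<open>odd s\<close>] by (simp add: pderiv_radial_laplacian_pow_Y_radial_eq_0 \<sigma>_def)
  have pd_sum: "pderiv (\<Sum>i\<in>A. f i) = (\<Sum>i\<in>A. pderiv (f i))" for A and f :: "nat \<Rightarrow> real poly"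
    by (induction A rule: infinite_finite_induct) (auto simp: pderiv_add)
  note j0 = j
  have j: "Suc \<sigma> \<le> j" using j0 ceil_half_odd[OF \<open>odd s\<close>] by (simp add: \<sigma>_def)
  have "pderiv ((radial_laplacian b ^^ \<sigma>) (Q_radial s b j)) = pderiv ((radial_laplacian b ^^ \<sigma>) (P_radial s b j))"
    using j0 by (simp add: Q_radial_def radial_laplacian_pow_diff radial_laplacian_pow_sum radial_laplacian_pow_smult pderiv_diff pd_sum pderiv_smult z)
  also have "\<dots> = smult (iterate_factor \<sigma> b j) (shifted_jacobi (b + 1) (j - Suc \<sigma>))"
  proof (rule poly_eqI)
    fix k
    show "coeff (pderiv ((radial_laplacian b ^^ \<sigma>) (P_radial s b j))) k = coeff (smult (iterate_factor \<sigma> b j) (shifted_jacobi (b + 1) (j - Suc \<sigma>))) k"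
    proof (cases "Suc k + \<sigma> \<le> j")
      case True
      have "coeff ((radial_laplacian b ^^ \<sigma>) (P_radial s b j)) (Suc k) = iterate_factor \<sigma> b j * jacobi_coeff (- 1) (b - 1) (j - \<sigma>) (Suc k)"
        using True b by (simp add: P_radial_def radial_laplacian_pow_smult coeff_radial_laplacian_pow_jacobi_poly s iterate_factor_def)
      moreover have "(real k + 1) * jacobi_coeff (- 1) (b - 1) (j - \<sigma>) (Suc k) = jacobi_coeff 0 b (j - Suc \<sigma>) k"
        using jacobi_coeff_deriv[of k "j - \<sigma>" "- 1" "b - 1"] True by simp
      ultimately show ?thesis using True j
        by (simp add: coeff_pderiv coeff_shifted_jacobi mult.left_commute add.commute)
    next
      case False
      then have "coeff ((radial_laplacian b ^^ \<sigma>) (P_radial s b j)) (Suc k) = 0"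
        by (intro coeff_radial_laplacian_pow_eq_0[where N = "Suc j"]) (auto simp: coeff_P_radial_gt)
      then show ?thesis using False j by (auto simp: coeff_pderiv coeff_shifted_jacobi)
    qed
  qed
  finally show ?thesis unfolding \<sigma>_def .
qed

text \<open>The blocks (X)_\<sigma> and (j + b)_j are adjacent, since X + \<sigma> = j + b, and join
  to a single Pochhammer symbol from which the first J factors are cancelled.\<close>

lemma iterate_factor_ratio:
  assumes "b > 0" "\<sigma> \<le> j" "J \<le> j" and X: "X = real j + b - real \<sigma>"
  shows "iterate_factor \<sigma> b j / pochhammer X J = 4 ^ \<sigma> * pochhammer (X + real J) (\<sigma> + j - J)"
proof -
  have P: "pochhammer X J > 0" using assms by (intro pochhammer_pos) simp
  have "pochhammer X \<sigma> * pochhammer (real j + b) j = pochhammer X (\<sigma> + j)"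
    using pochhammer_product'[of X \<sigma> j] X by simp
  also have "\<dots> = pochhammer X J * pochhammer (X + real J) (\<sigma> + j - J)"
    using assms by (intro pochhammer_product) simp
  finally have e: "pochhammer X \<sigma> * pochhammer (real j + b) j = pochhammer X J * pochhammer (X + real J) (\<sigma> + j - J)" .
  have "iterate_factor \<sigma> b j = 4 ^ \<sigma> * (pochhammer X \<sigma> * pochhammer (real j + b) j)"
    by (simp add: iterate_factor_def X algebra_simps)
  then show ?thesis unfolding e using P by simp
qed

lemma radial_form_Q_radial_low:
  assumes "j < ceil_half s"
  shows "radial_form s b (Q_radial s b j) q = 0"
proof -
  have q: "Q_radial s b j = Y_radial b j" using assms by (auto simp: Q_radial_def ceil_half_def)
  show ?thesis
  proof (cases "even s")
    case True
    then show ?thesis using assms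
      by (simp add: radial_form_def q radial_laplacian_pow_Y_radial_eq_0 ceil_half_even poly_moment_0)
  next
    case False
    then show ?thesis using assms
      by (simp add: radial_form_def Let_def q pderiv_radial_laplacian_pow_Y_radial_eq_0 ceil_half_odd poly_moment_0)
  qed
qed

text \<open>The number X = b + 2j - s is both the start of the joined Pochhammer symbol and the
  denominator in the norm of \<open>shifted_jacobi\<close>, so (X)_s^2 / X = (X)_s (X + 1)_(s-1).
  The powers 16^\<sigma> / 2 for even s and 2 16^\<sigma> for odd s both equal 2^(2s-1).\<close>

lemma radial_form_Q_radial_high:
  assumes b: "b > 0" and s: "s \<ge> 1" and j: "ceil_half s \<le> j" "ceil_half s \<le> j'"
  shows "radial_form s b (Q_radial s b j) (Q_radial s b j') = (if j = j' then
     2 ^ (2 * s - 1) * pochhammer (b + 2 * real j - real s) s * pochhammer (b + 2 * real j - real s + 1) (s - 1) else 0)"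
proof (cases "even s")
  case True
  define \<sigma> where "\<sigma> = s div 2"
  have s\<sigma>: "s = 2 * \<sigma>" using True by (simp add: \<sigma>_def)
  have j\<sigma>: "\<sigma> \<le> j" "\<sigma> \<le> j'" using j ceil_half_even[OF True] by (simp_all add: \<sigma>_def)
  have "radial_form s b (Q_radial s b j) (Q_radial s b j') = iterate_factor \<sigma> b j * iterate_factor \<sigma> b j' * poly_moment b (shifted_jacobi b (j - \<sigma>) * shifted_jacobi b (j' - \<sigma>)) / 2"
    using True radial_laplacian_pow_Q_radial_even[OF b True j(1), folded \<sigma>_def] radial_laplacian_pow_Q_radial_even[OF b True j(2), folded \<sigma>_def]
    by (simp add: radial_form_def Let_def poly_moment_smult flip: \<sigma>_def)
  also have "\<dots> = (if j = j' then (iterate_factor \<sigma> b j / pochhammer (real (j - \<sigma>) + b) (j - \<sigma>))\<^sup>2 / (2 * real (j - \<sigma>) + b) / 2 else 0)"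
  proof -
    have "j - \<sigma> = j' - \<sigma> \<longleftrightarrow> j = j'" using j\<sigma> by auto
    then show ?thesis by (simp add: poly_moment_shifted_jacobi_shifted_jacobi[OF b] power2_eq_square)
  qed
  also have "\<dots> = (if j = j' then
     2 ^ (2 * s - 1) * pochhammer (b + 2 * real j - real s) s * pochhammer (b + 2 * real j - real s + 1) (s - 1) else 0)"
  proof -
    define X where "X = b + 2 * real j - real s"
    have X: "X = 2 * real (j - \<sigma>) + b" using j\<sigma> by (simp add: X_def s\<sigma> of_nat_diff)
    have "X > 0" unfolding X using b by (intro add_nonneg_pos) auto
    have 1: "iterate_factor \<sigma> b j / pochhammer (real (j - \<sigma>) + b) (j - \<sigma>) = 4 ^ \<sigma> * pochhammer X s"
    proof -
      have "real (j - \<sigma>) + b + real (j - \<sigma>) = X" "\<sigma> + j - (j - \<sigma>) = s" using j\<sigma> by (simp_all add: X s\<sigma>)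
      with iterate_factor_ratio[OF b j\<sigma>(1), of "j - \<sigma>" "real (j - \<sigma>) + b"] j\<sigma> show ?thesis by (simp add: of_nat_diff)
    qed
    have 2: "pochhammer X s = X * pochhammer (X + 1) (s - 1)"
      using s pochhammer_rec[of X "s - 1"] by simp
    have 3: "(4 ^ \<sigma>)\<^sup>2 = (2 * 2 ^ (2 * s - 1) :: real)"
    proof -
      have "2 * 2 ^ (2 * s - 1) = (2 ^ (2 * s) :: real)" using s by (simp flip: power_Suc)
      also have "\<dots> = (4 ^ \<sigma>)\<^sup>2" by (simp add: s\<sigma> power_mult power2_eq_square flip: power_mult_distrib)
      finally show ?thesis by simp
    qed
    have "(4 ^ \<sigma> * pochhammer X s)\<^sup>2 / X / 2 = 2 ^ (2 * s - 1) * pochhammer X s * pochhammer (X + 1) (s - 1)"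
      unfolding power_mult_distrib 3 using \<open>X > 0\<close> by (simp add: 2 power2_eq_square)
    then show ?thesis unfolding 1 X_def[symmetric] X[symmetric] by simp
  qed
  finally show ?thesis .
next
  case False
  define \<sigma> where "\<sigma> = s div 2"
  have s\<sigma>: "s = Suc (2 * \<sigma>)" using False by (simp add: \<sigma>_def)
  have j\<sigma>: "Suc \<sigma> \<le> j" "Suc \<sigma> \<le> j'" using j ceil_half_odd[OF False] by (simp_all add: \<sigma>_def)
  have b1: "b + 1 > 0" using b by simp
  have "radial_form s b (Q_radial s b j) (Q_radial s b j') = 2 * (iterate_factor \<sigma> b j * iterate_factor \<sigma> b j' * poly_moment (b + 1) (shifted_jacobi (b + 1) (j - Suc \<sigma>) * shifted_jacobi (b + 1) (j' - Suc \<sigma>)))"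
    using False pderiv_radial_laplacian_pow_Q_radial_odd[OF b False j(1), folded \<sigma>_def]
      pderiv_radial_laplacian_pow_Q_radial_odd[OF b False j(2), folded \<sigma>_def]
    by (simp add: radial_form_def Let_def poly_moment_smult flip: \<sigma>_def)
  also have "\<dots> = (if j = j' then 2 * ((iterate_factor \<sigma> b j / pochhammer (real (j - Suc \<sigma>) + (b + 1)) (j - Suc \<sigma>))\<^sup>2 / (2 * real (j - Suc \<sigma>) + (b + 1))) else 0)"
  proof -
    have "j - Suc \<sigma> = j' - Suc \<sigma> \<longleftrightarrow> j = j'" using j\<sigma> by auto
    then show ?thesis by (simp add: poly_moment_shifted_jacobi_shifted_jacobi[OF b1] power2_eq_square)
  qed
  also have "\<dots> = (if j = j' then
     2 ^ (2 * s - 1) * pochhammer (b + 2 * real j - real s) s * pochhammer (b + 2 * real j - real s + 1) (s - 1) else 0)"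
  proof -
    define X where "X = b + 2 * real j - real s"
    have X: "X = 2 * real (j - Suc \<sigma>) + (b + 1)" using j\<sigma> by (simp add: X_def s\<sigma> of_nat_diff)
    have "X > 0" unfolding X using b by (intro add_nonneg_pos) auto
    have 1: "iterate_factor \<sigma> b j / pochhammer (real (j - Suc \<sigma>) + (b + 1)) (j - Suc \<sigma>) = 4 ^ \<sigma> * pochhammer X s"
    proof -
      have "real (j - Suc \<sigma>) + (b + 1) + real (j - Suc \<sigma>) = X" "\<sigma> + j - (j - Suc \<sigma>) = s" using j\<sigma> by (simp_all add: X s\<sigma>)
      with iterate_factor_ratio[OF b, of \<sigma> j "j - Suc \<sigma>" "real (j - Suc \<sigma>) + (b + 1)"] j\<sigma> show ?thesis by (simp add: of_nat_diff)
    qed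
    have 2: "pochhammer X s = X * pochhammer (X + 1) (s - 1)"
      using s pochhammer_rec[of X "s - 1"] by simp
    have 3: "2 * (4 ^ \<sigma>)\<^sup>2 = (2 ^ (2 * s - 1) :: real)"
      by (simp add: s\<sigma> power_mult power2_eq_square flip: power_mult_distrib)
    have "2 * ((4 ^ \<sigma> * pochhammer X s)\<^sup>2 / X) = 2 ^ (2 * s - 1) * pochhammer X s * pochhammer (X + 1) (s - 1)"
      unfolding power_mult_distrib 3[symmetric] using \<open>X > 0\<close> by (simp add: 2 power2_eq_square)
    then show ?thesis unfolding 1 X_def[symmetric] X[symmetric] by simp
  qed
  finally show ?thesis .
qed

section \<open>Sobolev inner products of harmonic polynomials with radial factors\<close>

lemma radial_mult: "radial p f x * radial q g x = radial (p * q) (\<lambda>x. f x * g x) x"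
  by (simp add: radial_def)

lemma poly_fun_poly_normsq: "real_polynomial_function (\<lambda>x::real^'n::finite. poly p ((norm x)\<^sup>2 - 1))"
  using poly_fun_radial[of "\<lambda>x. 1" p] by (simp add: radial_def[abs_def] real_polynomial_function.intros(2))

lemma partial_radial:
  fixes f :: "real^'n::finite \<Rightarrow> real"
  assumes "real_polynomial_function f"
  shows "partial i (radial p f) = (\<lambda>x. 2 * (x $ i * radial (pderiv p) f x) + radial p (partial i f) x)"
proof -
  have p: "partial i (\<lambda>x::real^'n. poly p ((norm x)\<^sup>2 - 1)) x = 2 * (x $ i) * poly (pderiv p) ((norm x)\<^sup>2 - 1)" for x
  proof -
    have "((\<lambda>x::real^'n. (norm x)\<^sup>2 - 1) has_derivative (\<lambda>h. 2 * (x \<bullet> h))) (at x)"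
      unfolding power2_norm_eq_inner by (auto intro!: derivative_eq_intros simp: inner_commute)
    then have "((\<lambda>x::real^'n. poly p ((norm x)\<^sup>2 - 1)) has_derivative
        (\<lambda>h. poly (pderiv p) ((norm x)\<^sup>2 - 1) * (2 * (x \<bullet> h)))) (at x)"
      by (rule has_derivative_compose) (use poly_DERIV[of p] in \<open>simp add: has_field_derivative_def\<close>)
    from partial_eqI[OF this, of i] show ?thesis by (simp add: inner_axis)
  qed
  show ?thesis
    unfolding radial_def[abs_def] by (subst partial_mult[OF poly_fun_poly_normsq assms]) (simp add: p algebra_simps)
qed

text \<open>The squares of the coordinates add up to |x|^2, the mixed terms give m by Euler's
  identity, and harmonicity removes the rest. The first-order terms have total factor 2d + 4m =
  4b.\<close>

lemma laplacian_radial: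
  fixes f :: "real^'n::finite \<Rightarrow> real"
  assumes f: "homog_poly m f" and harm: "laplacian f = (\<lambda>x. 0)"
  shows "laplacian (radial p f) = radial (radial_laplacian (real m + real CARD('n) / 2) p) f"
proof
  fix x :: "real^'n"
  note rf = homog_poly_poly_fun[OF f]
  let ?R = "\<lambda>p f. radial p f x"
  have 2: "partial i (partial i (radial p f)) x = 2 * ?R (pderiv p) f + 4 * (x $ i * x $ i) * ?R (pderiv (pderiv p)) f
     + 4 * (x $ i * ?R (pderiv p) (partial i f)) + ?R p (partial i (partial i f))" for i
    using rf by (simp add: partial_radial partial_add partial_cmult partial_mult partial_coord poly_fun_radial poly_fun_partial
        poly_fun_coord real_polynomial_function.intros(2,4) algebra_simps)
  have n2: "(\<Sum>i\<in>UNIV. x $ i * x $ i) = (norm x)\<^sup>2"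
    by (simp add: power2_norm_eq_inner inner_vec_def)
  have e: "(\<Sum>i\<in>UNIV. x $ i * ?R (pderiv p) (partial i f)) = real m * ?R (pderiv p) f"
  proof -
    have "(\<Sum>i\<in>UNIV. x $ i * ?R (pderiv p) (partial i f)) = poly (pderiv p) ((norm x)\<^sup>2 - 1) * (\<Sum>i\<in>UNIV. x $ i * partial i f x)"
      by (simp add: radial_def sum_distrib_left mult.left_commute)
    then show ?thesis by (simp add: euler_homog_poly[OF f] radial_def)
  qed
  have l: "(\<Sum>i\<in>UNIV. ?R p (partial i (partial i f))) = 0"
  proof -
    have "(\<Sum>i\<in>UNIV. ?R p (partial i (partial i f))) = poly p ((norm x)\<^sup>2 - 1) * laplacian f x"
      by (simp add: radial_def laplacian_def sum_distrib_left)
    then show ?thesis by (simp add: harm)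
  qed
  have "laplacian (radial p f) x = real CARD('n) * (2 * ?R (pderiv p) f)
     + 4 * (\<Sum>i\<in>UNIV. x $ i * x $ i) * ?R (pderiv (pderiv p)) f
     + 4 * (\<Sum>i\<in>UNIV. x $ i * ?R (pderiv p) (partial i f)) + (\<Sum>i\<in>UNIV. ?R p (partial i (partial i f)))"
    unfolding laplacian_def 2 by (simp add: sum.distrib sum_distrib_left sum_distrib_right)
  then show "laplacian (radial p f) x = radial (radial_laplacian (real m + real CARD('n) / 2) p) f x"
    unfolding n2 e l by (simp add: radial_laplacian_def radial_def algebra_simps)
qed

lemma laplacian_pow_radial:
  fixes f :: "real^'n::finite \<Rightarrow> real"
  assumes "homog_poly m f" "laplacian f = (\<lambda>x. 0)"
  shows "(laplacian ^^ k) (radial p f) = radial ((radial_laplacian (real m + real CARD('n) / 2) ^^ k) p) f"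
  by (induction k) (simp_all add: laplacian_radial[OF assms])

lemma ball_ip_ball_int: "ball_ip f g = ball_int (\<lambda>x. f x * g x) / measure lborel (ball (0::real^'n::finite) 1)"
  for f g :: "real^'n \<Rightarrow> real"
  by (simp add: ball_ip_def ball_int_def)

lemma sph_ip_sphere_int: "sph_ip f g = sphere_int (\<lambda>x. f x * g x) / measure lborel (ball (0::real^'n::finite) 1)"
  for f g :: "real^'n \<Rightarrow> real"
  by (simp add: sph_ip_def sphere_int_def ball_int_def)

lemma ball_ip_radial:
  fixes f g :: "real^'n::finite \<Rightarrow> real"
  assumes "homog_poly m f" "homog_poly k g"
  shows "ball_ip (radial p f) (radial q g) = real CARD('n) / 2 * poly_moment (real (CARD('n) + (m + k)) / 2) (p * q) * sph_ip f g"
  unfolding ball_ip_ball_int sph_ip_sphere_int radial_mult ball_int_radial[OF homog_poly_mult[OF assms]] by simp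

lemma sph_ip_radial:
  fixes f g :: "real^'n::finite \<Rightarrow> real"
  assumes "homog_poly m f" "homog_poly k g"
  shows "sph_ip (radial p f) (radial q g) = coeff p 0 * coeff q 0 * sph_ip f g"
proof -
  note rp = homog_poly_poly_fun[OF assms(1)] homog_poly_poly_fun[OF assms(2)]
  have "sphere_int (\<lambda>x. radial p f x * radial q g x) = sphere_int (\<lambda>x. (coeff p 0 * coeff q 0) * (f x * g x))"
    by (rule sphere_int_cong)
       (auto intro!: real_polynomial_function.intros(2,4) poly_fun_poly_normsq rp simp: radial_def poly_0_coeff_0)
  then show ?thesis by (simp add: sph_ip_sphere_int sphere_int_cmult)
qed

text \<open>Euler's identity reduces the mixed terms to multiples of f g. The product of the
  gradients of f and g is not such a multiple pointwise, only on spherical average, and is kept as a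
  separate integral.\<close>

lemma sum_ball_ip_partial_radial:
  fixes f g :: "real^'n::finite \<Rightarrow> real"
  assumes f: "homog_poly m f" and g: "homog_poly k g"
  shows "(\<Sum>i\<in>UNIV. ball_ip (partial i (radial p f)) (partial i (radial q g)))
    = (ball_int (radial (smult 4 ([:1, 1:] * (pderiv p * pderiv q)) + smult (2 * real k) (pderiv p * q)
          + smult (2 * real m) (p * pderiv q)) (\<lambda>x. f x * g x))
       + ball_int (radial (p * q) (grad_dot f g))) / measure lborel (ball (0::real^'n) 1)"
proof -
  note rp = homog_poly_poly_fun[OF f] homog_poly_poly_fun[OF g]
  have rgd: "real_polynomial_function (grad_dot f g)" using homog_poly_poly_fun[OF homog_poly_grad_dot[OF f g]] .
  have rpp: "real_polynomial_function (\<lambda>x. partial i (radial p f) x * partial i (radial q g) x)" for i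
    by (intro real_polynomial_function.intros(4) poly_fun_partial poly_fun_radial rp)
  have pt: "(\<Sum>i\<in>UNIV. partial i (radial p f) x * partial i (radial q g) x)
      = radial (smult 4 ([:1, 1:] * (pderiv p * pderiv q)) + smult (2 * real k) (pderiv p * q)
          + smult (2 * real m) (p * pderiv q)) (\<lambda>x. f x * g x) x + radial (p * q) (grad_dot f g) x" for x
  proof -
    define P P' Q Q' where "P = poly p ((norm x)\<^sup>2 - 1)" and "P' = poly (pderiv p) ((norm x)\<^sup>2 - 1)"
      and "Q = poly q ((norm x)\<^sup>2 - 1)" and "Q' = poly (pderiv q) ((norm x)\<^sup>2 - 1)"
    have n2: "(\<Sum>i\<in>UNIV. x $ i * x $ i) = (norm x)\<^sup>2"
      by (simp add: power2_norm_eq_inner inner_vec_def)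
    have "(\<Sum>i\<in>UNIV. partial i (radial p f) x * partial i (radial q g) x)
       = (\<Sum>i\<in>UNIV. 4 * P' * Q' * f x * g x * (x $ i * x $ i) + 2 * P' * Q * f x * (x $ i * partial i g x)
            + 2 * P * Q' * g x * (x $ i * partial i f x) + P * Q * (partial i f x * partial i g x))"
      by (simp add: partial_radial rp radial_def P_def P'_def Q_def Q'_def algebra_simps)
    also have "\<dots> = 4 * P' * Q' * f x * g x * (norm x)\<^sup>2 + 2 * P' * Q * f x * (real k * g x)
            + 2 * P * Q' * g x * (real m * f x) + P * Q * grad_dot f g x"
      unfolding sum.distrib sum_distrib_left[symmetric] n2 euler_homog_poly[OF f] euler_homog_poly[OF g] grad_dot_def ..
    finally show ?thesis by (simp add: radial_def P_def P'_def Q_def Q'_def algebra_simps)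
  qed
  have "(\<Sum>i\<in>UNIV. ball_int (\<lambda>x. partial i (radial p f) x * partial i (radial q g) x))
     = ball_int (\<lambda>x. \<Sum>i\<in>UNIV. partial i (radial p f) x * partial i (radial q g) x)"
    by (rule ball_int_sum[symmetric]) (rule rpp)
  also have "\<dots> = ball_int (radial (smult 4 ([:1, 1:] * (pderiv p * pderiv q)) + smult (2 * real k) (pderiv p * q)
          + smult (2 * real m) (p * pderiv q)) (\<lambda>x. f x * g x)) + ball_int (radial (p * q) (grad_dot f g))"
    unfolding pt by (intro ball_int_add poly_fun_radial rgd real_polynomial_function.intros(4) rp)
  finally show ?thesis unfolding ball_ip_ball_int by (simp flip: sum_divide_distrib)
qed

text \<open>The mixed terms combine to 2m (p q)', and the averaged product of gradients contributes
  2m (b - 1) p q with weight parameter b - 1. Integration by parts in u merges both into the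
  boundary value of p q, which is the origin of d (n - 2j) in \<open>h_const\<close>.\<close>

lemma nabla_odd_radial_same:
  fixes f g :: "real^'n::finite \<Rightarrow> real"
  assumes f: "homog_poly m f" and g: "homog_poly m g" "laplacian g = (\<lambda>x. 0)"
  defines "b \<equiv> real m + real CARD('n) / 2"
  shows "(\<Sum>i\<in>UNIV. ball_ip (partial i (radial p f)) (partial i (radial q g)))
    = real CARD('n) * (2 * poly_moment (b + 1) (pderiv p * pderiv q) + real m * (coeff p 0 * coeff q 0)) * sph_ip f g"
proof -
  have b: "b > 0" by (simp add: b_def add_nonneg_pos)
  have e1: "real (CARD('n) + (m + m)) / 2 = b" by (simp add: b_def)
  define S where "S = sphere_int (\<lambda>x. f x * g x)"
  define M where "M = measure lborel (ball (0::real^'n) 1)"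
  have pd: "pderiv p * q + p * pderiv q = pderiv (p * q)" by (simp add: pderiv_mult mult.commute)
  have "smult 4 ([:1, 1:] * (pderiv p * pderiv q)) + smult (2 * real m) (pderiv p * q)
          + smult (2 * real m) (p * pderiv q) = smult 4 ([:1, 1:] * (pderiv p * pderiv q)) + smult (2 * real m) (pderiv (p * q))"
    unfolding pd[symmetric] smult_add_right by (simp only: add.assoc)
  then have 1: "ball_int (radial (smult 4 ([:1, 1:] * (pderiv p * pderiv q)) + smult (2 * real m) (pderiv p * q)
          + smult (2 * real m) (p * pderiv q)) (\<lambda>x. f x * g x))
     = real CARD('n) / 2 * (4 * poly_moment (b + 1) (pderiv p * pderiv q) + 2 * real m * poly_moment b (pderiv (p * q))) * S"
    unfolding ball_int_radial[OF homog_poly_mult[OF f g(1)]] e1 S_def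
    by (simp only: poly_moment_add poly_moment_smult poly_moment_times_X1[OF b])
  have 2: "ball_int (radial (p * q) (grad_dot f g)) = real CARD('n) / 2 * (2 * real m * ((b - 1) * poly_moment (b - 1) (p * q))) * S"
  proof (cases "m = 0")
    case True
    then show ?thesis using grad_dot_homog_poly_0[of f g] f by (simp add: radial_def[abs_def] ball_int_zero)
  next
    case False
    have e2: "real (CARD('n) + (m - 1 + (m - 1))) / 2 = b - 1"
      using False by (simp add: b_def of_nat_diff field_simps)
    have e3: "2 * real m + real CARD('n) - 2 = 2 * (b - 1)" by (simp add: b_def)
    show ?thesis
      unfolding ball_int_radial[OF homog_poly_grad_dot[OF f g(1)]] e2 sphere_int_grad_dot_same[OF f g] e3 S_def by simp
  qed
  \<comment> \<open>For m = 0 both sides vanish; that case is separate because b = d/2 need not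
    exceed 1, as \<open>poly_moment_pderiv\<close> demands.\<close>
  have 3: "real m * (poly_moment b (pderiv (p * q)) + (b - 1) * poly_moment (b - 1) (p * q)) = real m * (coeff p 0 * coeff q 0)"
  proof (cases "m = 0")
    case False
    then have "real m \<ge> 1" by simp
    moreover have "real CARD('n) > 0" by simp
    ultimately have "b > 1" unfolding b_def by linarith
    then show ?thesis by (simp add: poly_moment_pderiv coeff_mult)
  qed simp
  have "(\<Sum>i\<in>UNIV. ball_ip (partial i (radial p f)) (partial i (radial q g)))
     = real CARD('n) * (2 * poly_moment (b + 1) (pderiv p * pderiv q)
        + real m * (poly_moment b (pderiv (p * q)) + (b - 1) * poly_moment (b - 1) (p * q))) * (S / M)"
    unfolding sum_ball_ip_partial_radial[OF f g(1)] 1 2 M_def[symmetric]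
    by (simp add: add_divide_distrib distrib_left distrib_right)
  then show ?thesis unfolding 3 S_def M_def sph_ip_sphere_int .
qed

lemma nabla_odd_radial_orthogonal:
  fixes f g :: "real^'n::finite \<Rightarrow> real"
  assumes f: "homog_poly m f" "laplacian f = (\<lambda>x. 0)" and g: "homog_poly k g" "laplacian g = (\<lambda>x. 0)" and "m \<noteq> k"
  shows "(\<Sum>i\<in>UNIV. ball_ip (partial i (radial p f)) (partial i (radial q g))) = 0"
  unfolding sum_ball_ip_partial_radial[OF f(1) g(1)] ball_int_radial[OF homog_poly_mult[OF f(1) g(1)]] ball_int_radial[OF homog_poly_grad_dot[OF f(1) g(1)]]
  by (simp add: sphere_int_harm_orthogonal[OF assms] sphere_int_grad_dot_harm_orthogonal[OF assms])

lemma sob_ip_radial_same: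
  fixes f g :: "real^'n::finite \<Rightarrow> real"
  assumes f: "homog_poly m f" "laplacian f = (\<lambda>x. 0)" and g: "homog_poly m g" "laplacian g = (\<lambda>x. 0)"
  defines "b \<equiv> real m + real CARD('n) / 2"
  shows "sob_ip s lam (radial p f) (radial q g) = (real CARD('n) * radial_form s b p q
     + (if odd s then real CARD('n) * real m * (coeff ((radial_laplacian b ^^ (s div 2)) p) 0 * coeff ((radial_laplacian b ^^ (s div 2)) q) 0) else 0)
     + (\<Sum>k<ceil_half s. lam k * (coeff ((radial_laplacian b ^^ k) p) 0 * coeff ((radial_laplacian b ^^ k) q) 0))) * sph_ip f g"
proof -
  note lap = laplacian_pow_radial[OF f, folded b_def] laplacian_pow_radial[OF g, folded b_def]
  have e1: "real (CARD('n) + (m + m)) / 2 = b" by (simp add: b_def)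
  have "nabla_ip s (radial p f) (radial q g) = (real CARD('n) * radial_form s b p q
     + (if odd s then real CARD('n) * real m * (coeff ((radial_laplacian b ^^ (s div 2)) p) 0 * coeff ((radial_laplacian b ^^ (s div 2)) q) 0) else 0)) * sph_ip f g"
  proof (cases "even s")
    case True
    then show ?thesis
      by (simp add: nabla_ip_def lap ball_ip_radial[OF f(1) g(1)] e1 radial_form_def Let_def del: of_nat_add)
  next
    case False
    then show ?thesis
      unfolding nabla_ip_def lap nabla_odd_radial_same[OF f(1) g] b_def[symmetric]
      by (simp add: radial_form_def Let_def distrib_left)
  qed
  then show ?thesis
    by (simp add: sob_ip_def lap sph_ip_radial[OF f(1) g(1)] distrib_right sum_distrib_right mult.assoc)
qed

lemma sob_ip_radial_orthogonal:
  fixes f g :: "real^'n::finite \<Rightarrow> real"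
  assumes f: "homog_poly m f" "laplacian f = (\<lambda>x. 0)" and g: "homog_poly k g" "laplacian g = (\<lambda>x. 0)" and "m \<noteq> k"
  shows "sob_ip s lam (radial p f) (radial q g) = 0"
proof -
  have "sph_ip f g = 0" by (simp add: sph_ip_sphere_int sphere_int_harm_orthogonal[OF assms])
  then show ?thesis
    by (simp add: sob_ip_def nabla_ip_def laplacian_pow_radial[OF f] laplacian_pow_radial[OF g]
       ball_ip_radial[OF f(1) g(1)] sph_ip_radial[OF f(1) g(1)] nabla_odd_radial_orthogonal[OF assms])
qed

section \<open>Bilinearity of the Sobolev form on polynomials\<close>

lemma laplacian_pow_add:
  assumes "real_polynomial_function f" "real_polynomial_function g"
  shows "(laplacian ^^ k) (\<lambda>x. f x + g x) = (\<lambda>x. (laplacian ^^ k) f x + (laplacian ^^ k) g x)"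
  by (induction k) (simp_all add: laplacian_add poly_fun_laplacian_pow assms)

lemma laplacian_pow_cmult:
  assumes "real_polynomial_function f"
  shows "(laplacian ^^ k) (\<lambda>x. c * f x) = (\<lambda>x. c * (laplacian ^^ k) f x)"
  by (induction k) (simp_all add: laplacian_cmult poly_fun_laplacian_pow assms)

lemma sob_ip_commute: "sob_ip s lam f g = sob_ip s lam g f"
  by (simp add: sob_ip_def nabla_ip_def ball_ip_def sph_ip_def mult.commute)

lemma ball_ip_add:
  assumes "real_polynomial_function f" "real_polynomial_function g" "real_polynomial_function h"
  shows "ball_ip (\<lambda>x. f x + g x) h = ball_ip f h + ball_ip g h"
  unfolding ball_ip_ball_int distrib_right
  by (subst ball_int_add) (auto intro!: real_polynomial_function.intros(4) assms simp: add_divide_distrib)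

lemma sph_ip_add:
  assumes "real_polynomial_function f" "real_polynomial_function g" "real_polynomial_function h"
  shows "sph_ip (\<lambda>x. f x + g x) h = sph_ip f h + sph_ip g h"
  unfolding sph_ip_sphere_int distrib_right
  by (subst sphere_int_add) (auto intro!: real_polynomial_function.intros(4) assms simp: add_divide_distrib)

lemma ball_ip_cmult: "ball_ip (\<lambda>x. c * f x) h = c * ball_ip f h"
  by (simp add: ball_ip_ball_int mult.assoc ball_int_cmult)

lemma sph_ip_cmult: "sph_ip (\<lambda>x. c * f x) h = c * sph_ip f h"
  by (simp add: sph_ip_sphere_int mult.assoc sphere_int_cmult)

lemma sob_ip_add:
  assumes "real_polynomial_function f" "real_polynomial_function g" "real_polynomial_function h"
  shows "sob_ip s lam (\<lambda>x. f x + g x) h = sob_ip s lam f h + sob_ip s lam g h"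
  unfolding sob_ip_def nabla_ip_def
  by (simp add: laplacian_pow_add partial_add ball_ip_add sph_ip_add poly_fun_laplacian_pow poly_fun_partial assms
      sum.distrib distrib_left)

lemma sob_ip_cmult:
  assumes "real_polynomial_function f"
  shows "sob_ip s lam (\<lambda>x. c * f x) h = c * sob_ip s lam f h"
  unfolding sob_ip_def nabla_ip_def
  by (simp add: laplacian_pow_cmult partial_cmult ball_ip_cmult sph_ip_cmult poly_fun_laplacian_pow assms
      sum_distrib_left distrib_left mult.left_commute)

lemma sob_ip_zero: "sob_ip s lam (\<lambda>x. 0) h = 0"
  using sob_ip_cmult[of "\<lambda>x. 0" s lam 0 h] by (simp add: real_polynomial_function.intros(2))

lemma sob_ip_sum:
  assumes "\<And>t. t \<in> A \<Longrightarrow> real_polynomial_function (F t)" "real_polynomial_function h"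
  shows "sob_ip s lam (\<lambda>x. \<Sum>t\<in>A. c t * F t x) h = (\<Sum>t\<in>A. c t * sob_ip s lam (F t) h)"
  using assms(1)
proof (induction A rule: infinite_finite_induct)
  case (insert t A)
  have "real_polynomial_function (\<lambda>x. \<Sum>t\<in>A. c t * F t x)"
    using insert by (intro poly_fun_sum real_polynomial_function.intros(2,4)) auto
  moreover have "real_polynomial_function (\<lambda>x. c t * F t x)"
    using insert by (intro real_polynomial_function.intros(2,4)) auto
  ultimately show ?case
    using insert by (simp add: sob_ip_add sob_ip_cmult assms(2))
qed (simp_all add: sob_ip_zero)

section \<open>The basis polynomials\<close>

lemma Y_mj_eq_radial:
  fixes Y :: "nat \<Rightarrow> nat \<Rightarrow> real^'n::finite \<Rightarrow> real"
  shows "Y_mj Y m j l = radial (Y_radial (real m + real CARD('n) / 2) j) (Y m l)"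
proof
  fix x :: "real^'n"
  have "c_coef TYPE('n) m j = c_vec (real m + real CARD('n) / 2) j"
    unfolding c_coef_def c_vec_def ..
  then show "Y_mj Y m j l x = radial (Y_radial (real m + real CARD('n) / 2) j) (Y m l) x"
    by (simp add: Y_mj_def radial_def Y_radial_def poly_sum sum_distrib_right)
qed

lemma P_poly_eq_radial:
  fixes Y :: "nat \<Rightarrow> nat \<Rightarrow> real^'n::finite \<Rightarrow> real"
  assumes "2 * j \<le> n"
  shows "P_poly Y (- real s) n j l = radial (P_radial s (real (n - 2 * j) + real CARD('n) / 2) j) (Y (n - 2 * j) l)"
proof
  fix x :: "real^'n"
  have e: "real (n - 2 * j) + real CARD('n) / 2 = real n - 2 * real j + real CARD('n) / 2"
    "real j + (real n - 2 * real j + real CARD('n) / 2) = real n - real j + real CARD('n) / 2"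
    "(2 * (norm x)\<^sup>2 - 1 - 1) / 2 = (norm x)\<^sup>2 - 1"
    using assms by (simp_all add: of_nat_diff field_simps)
  show "P_poly Y (- real s) n j l x = radial (P_radial s (real (n - 2 * j) + real CARD('n) / 2) j) (Y (n - 2 * j) l) x"
    unfolding P_poly_def Let_def radial_def P_radial_def gen_jacobi_eq_poly poly_smult e ..
qed

lemma harm_nonzero_on_sphere:
  fixes f :: "real^'n::finite \<Rightarrow> real"
  assumes "real_polynomial_function f" "sph_ip f f \<noteq> 0"
  obtains \<xi> where "norm \<xi> = 1" "f \<xi> \<noteq> 0"
proof -
  have "\<exists>\<xi>. norm \<xi> = 1 \<and> f \<xi> \<noteq> 0"
  proof (rule ccontr)
    assume "\<not> ?thesis"
    then have z: "f x = 0" if "norm x = 1" for x using that by blast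
    have "sphere_int (\<lambda>x. f x * f x) = sphere_int (\<lambda>x::real^'n. 0)"
      by (intro sphere_int_cong real_polynomial_function.intros(2,4) assms(1)) (simp add: z)
    also have "\<dots> = 0" by (simp add: sphere_int_def ball_int_zero)
    finally show False using assms(2) by (simp add: sph_ip_sphere_int)
  qed
  with that show thesis by blast
qed

text \<open>A point of the sphere where f does not vanish determines the constant, so the definite
  description can be evaluated.\<close>

lemma gamma_const_radial:
  fixes f :: "real^'n::finite \<Rightarrow> real"
  assumes f: "homog_poly m f" "laplacian f = (\<lambda>x. 0)" and nz: "sph_ip f f \<noteq> 0"
  shows "gamma_const (radial p f) f k = coeff ((radial_laplacian (real m + real CARD('n) / 2) ^^ k) p) 0"
proof -
  obtain \<xi> where \<xi>: "norm \<xi> = 1" "f \<xi> \<noteq> 0"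
    using harm_nonzero_on_sphere[OF homog_poly_poly_fun[OF f(1)] nz] .
  show ?thesis unfolding gamma_const_def laplacian_pow_radial[OF f]
  proof (rule the_equality)
    fix \<gamma>
    assume "\<forall>\<xi>\<in>sphere 0 1. radial ((radial_laplacian (real m + real CARD('n) / 2) ^^ k) p) f \<xi> = \<gamma> * f \<xi>"
    then have "radial ((radial_laplacian (real m + real CARD('n) / 2) ^^ k) p) f \<xi> = \<gamma> * f \<xi>" using \<xi> by simp
    with \<xi> show "\<gamma> = coeff ((radial_laplacian (real m + real CARD('n) / 2) ^^ k) p) 0"
      by (simp add: radial_def poly_0_coeff_0)
  qed (simp add: radial_def poly_0_coeff_0)
qed

lemma sph_harm_onbD:
  assumes "sph_harm_onb a Y" "l \<in> {1..a m}"
  shows "homog_poly m (Y m l)" "laplacian (Y m l) = (\<lambda>x. 0)"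
    and "l' \<in> {1..a m} \<Longrightarrow> sph_ip (Y m l) (Y m l') = (if l = l' then 1 else 0)"
  using assms by (auto simp: sph_harm_onb_def harm_polys_def homog_poly_iff_homog)

lemma Q_poly_eq_radial:
  fixes Y :: "nat \<Rightarrow> nat \<Rightarrow> real^'n::finite \<Rightarrow> real"
  assumes Y: "sph_harm_onb a Y" and l: "l \<in> {1..a (n - 2 * j)}" and j: "2 * j \<le> n"
  shows "Q_poly Y s n j l = radial (Q_radial s (real (n - 2 * j) + real CARD('n) / 2) j) (Y (n - 2 * j) l)"
proof -
  have nz: "sph_ip (Y (n - 2 * j) l) (Y (n - 2 * j) l) \<noteq> 0" using sph_harm_onbD(3)[OF Y l l] by simp
  have sum_radial: "radial (\<Sum>k\<in>A. F k) f x = (\<Sum>k\<in>A. radial (F k) f x)"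
    for F and A :: "nat set" and f and x :: "real^'n"
    by (simp add: radial_def poly_sum sum_distrib_right)
  show ?thesis
    unfolding Q_poly_def Q_radial_def P_poly_eq_radial[OF j] Y_mj_eq_radial
      gamma_const_radial[OF sph_harm_onbD(1,2)[OF Y l] nz]
    by (auto simp: fun_eq_iff radial_def poly_sum sum_distrib_right left_diff_distrib mult.assoc)
qed

lemma sob_ip_Q_poly:
  fixes Y :: "nat \<Rightarrow> nat \<Rightarrow> real^'n::finite \<Rightarrow> real"
  assumes Y: "sph_harm_onb a Y" and s: "1 \<le> s"
    and l: "l \<in> {1..a (n - 2 * j)}" and j: "2 * j \<le> n"
    and l': "l' \<in> {1..a (n' - 2 * j')}" and j': "2 * j' \<le> n'"
  shows "sob_ip s lam (Q_poly Y s n j l) (Q_poly Y s n' j' l')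
          = (if n = n' \<and> j = j' \<and> l = l' then h_const TYPE('n) s lam j n else 0)"
proof (cases "n - 2 * j = n' - 2 * j'")
  case False
  then have "\<not> (n = n' \<and> j = j')" by auto
  then show ?thesis
    unfolding Q_poly_eq_radial[OF Y l j] Q_poly_eq_radial[OF Y l' j']
    using sob_ip_radial_orthogonal[OF sph_harm_onbD(1,2)[OF Y l] sph_harm_onbD(1,2)[OF Y l'] False] by auto
next
  case True
  define m where "m = n - 2 * j"
  define b where "b = real m + real CARD('n) / 2"
  have b: "b > 0" by (simp add: b_def add_nonneg_pos)
  have m': "n' - 2 * j' = m" using True by (simp add: m_def)
  have lm: "l \<in> {1..a m}" "l' \<in> {1..a m}" using l l' m' by (simp_all add: m_def)
  have nj: "n = n' \<and> j = j' \<longleftrightarrow> j = j'" using True j j' by auto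
  define D where "D = real CARD('n) * radial_form s b (Q_radial s b j) (Q_radial s b j')
     + (if odd s then real CARD('n) * real m * (coeff ((radial_laplacian b ^^ (s div 2)) (Q_radial s b j)) 0 * coeff ((radial_laplacian b ^^ (s div 2)) (Q_radial s b j')) 0) else 0)
     + (\<Sum>k<ceil_half s. lam k * (coeff ((radial_laplacian b ^^ k) (Q_radial s b j)) 0 * coeff ((radial_laplacian b ^^ k) (Q_radial s b j')) 0))"
  have "sob_ip s lam (Q_poly Y s n j l) (Q_poly Y s n' j' l') = D * (if l = l' then 1 else 0)"
    unfolding Q_poly_eq_radial[OF Y l j] Q_poly_eq_radial[OF Y l' j'] m' m_def[symmetric] D_def b_def
    using sob_ip_radial_same[OF sph_harm_onbD(1,2)[OF Y lm(1)] sph_harm_onbD(1,2)[OF Y lm(2)], of s lam]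
      sph_harm_onbD(3)[OF Y lm] by simp
  moreover have "D = (if j = j' then h_const TYPE('n) s lam j n else 0)"
  proof -
    have sum: "(\<Sum>k<ceil_half s. lam k * (coeff ((radial_laplacian b ^^ k) (Q_radial s b j)) 0 * coeff ((radial_laplacian b ^^ k) (Q_radial s b j')) 0))
       = (if j = j' \<and> j < ceil_half s then lam j else 0)"
    proof -
      have "(\<Sum>k<ceil_half s. lam k * (coeff ((radial_laplacian b ^^ k) (Q_radial s b j)) 0 * coeff ((radial_laplacian b ^^ k) (Q_radial s b j')) 0))
         = (\<Sum>k<ceil_half s. if j = k then (if j = j' then lam j else 0) else 0)"
        by (intro sum.cong refl) (auto simp: coeff_0_radial_laplacian_pow_Q_radial[OF b])
      then show ?thesis by auto
    qed
    \<comment> \<open>For odd s the extra boundary term uses the iterate \<open>s div 2\<close>,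
      still below \<open>ceil_half s\<close>, so the same Kronecker deltas apply and only j = (s -
      1)/2 is left.\<close>
    have bd: "(if odd s then real CARD('n) * real m * (coeff ((radial_laplacian b ^^ (s div 2)) (Q_radial s b j)) 0 * coeff ((radial_laplacian b ^^ (s div 2)) (Q_radial s b j')) 0) else 0)
       = (if odd s \<and> j = s div 2 \<and> j' = j then real CARD('n) * real m else 0)"
      by (auto simp: coeff_0_radial_laplacian_pow_Q_radial[OF b] ceil_half_odd)
    have n: "real n + real CARD('n) / 2 = b + 2 * real j"
      using j by (simp add: b_def m_def of_nat_diff)
    have mr: "real m = real n - 2 * real j" using j by (simp add: m_def of_nat_diff)
    show ?thesis
    proof (cases "ceil_half s \<le> j")
      case high: True
      then have hd: "\<not> (odd s \<and> j = s div 2)" using ceil_half_odd[of s] by auto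
      show ?thesis
      proof (cases "j = j'")
        case True
        have "radial_form s b (Q_radial s b j) (Q_radial s b j') = 2 ^ (2 * s - 1) * pochhammer (b + 2 * real j - real s) s * pochhammer (b + 2 * real j - real s + 1) (s - 1)"
          using radial_form_Q_radial_high[OF b s high, of j'] high True by simp
        then show ?thesis unfolding D_def sum bd h_const_def Let_def n
          using True high hd by auto
      next
        case False
        have "radial_form s b (Q_radial s b j) (Q_radial s b j') = 0"
        proof (cases "ceil_half s \<le> j'")
          case True
          then show ?thesis using radial_form_Q_radial_high[OF b s high True] False by simp
        next
          case False
          then show ?thesis by (subst radial_form_commute, intro radial_form_Q_radial_low) simp
        qed
        then show ?thesis unfolding D_def sum bd using False by auto
      qed
    next
      case low: False
      have radial_form: "radial_form s b (Q_radial s b j) (Q_radial s b j') = 0" using low by (intro radial_form_Q_radial_low) simp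
      have eq: "odd s \<and> j = s div 2 \<longleftrightarrow> 2 * real j = real s - 1"
      proof -
        have "odd s \<and> j = s div 2 \<longleftrightarrow> 2 * j + 1 = s" by (auto elim!: oddE)
        also have "\<dots> \<longleftrightarrow> real (2 * j + 1) = real s" by (rule of_nat_eq_iff[symmetric])
        also have "\<dots> \<longleftrightarrow> 2 * real j = real s - 1" by auto
        finally show ?thesis .
      qed
      show ?thesis unfolding D_def sum bd radial_form h_const_def Let_def mr[symmetric]
        using low eq by auto
    qed
  qed
  ultimately show ?thesis using nj by auto
qed

text \<open>In the upper range n \<ge> 2j \<ge> s, so both Pochhammer symbols start at a positive
  number. Positive norms let coefficients be read off by pairing with basis elements.\<close>

lemma h_const_pos:
  fixes lam :: "nat \<Rightarrow> real"
  assumes "2 * j \<le> n" "\<And>k. k < ceil_half s \<Longrightarrow> lam k > 0"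
  shows "h_const TYPE('n::finite) s lam j n > 0"
proof (cases "ceil_half s \<le> j")
  case True
  then have "s \<le> n" using assms(1) by (auto simp: ceil_half_def)
  then have "real n - real s \<ge> 0" by simp
  moreover have "real CARD('n) > 0" by simp
  ultimately have X: "real n + real CARD('n) / 2 - real s > 0" by linarith
  have "pochhammer (real n + real CARD('n) / 2 - real s) s > 0" "pochhammer (real n + real CARD('n) / 2 - real s + 1) (s - 1) > 0"
    using X by (auto intro!: pochhammer_pos)
  then show ?thesis using True by (simp add: h_const_def Let_def)
next
  case False
  then have "lam j > 0" using assms(2) by simp
  moreover have "real CARD('n) * (real n - 2 * real j) \<ge> 0"
    using assms(1) by (intro mult_nonneg_nonneg) auto
  ultimately have "real CARD('n) * (real n - 2 * real j) + lam j > 0" by linarith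
  then show ?thesis using False \<open>lam j > 0\<close> 
    by (cases "2 * real j = real s - 1") (simp_all only: h_const_def Let_def if_False if_True simp_thms)
qed

text \<open>Powers of |x|^2 are mapped to single powers, so on them the Laplacian is inverted by a
  division.\<close>

lemma radial_laplacian_X1_power: "radial_laplacian b ([:1, 1:] ^ Suc j) = smult (4 * real (Suc j) * (real j + b)) ([:1, 1:] ^ j)"
proof -
  have d: "pderiv ([:1, 1:] ^ Suc i) = smult (real (Suc i)) ([:1, 1:] ^ i)" for i
    by (simp add: pderiv_power_Suc pderiv_pCons del: power_Suc)
  show ?thesis
  proof (cases j)
    case 0 then show ?thesis by (simp add: radial_laplacian_def d del: power_Suc) (simp add: pderiv_pCons)
  next
    case (Suc i)
    have "radial_laplacian b ([:1, 1:] ^ Suc j) = smult 4 ([:1, 1:] * smult (real (Suc j) * real (Suc i)) ([:1, 1:] ^ i) + smult b (smult (real (Suc j)) ([:1, 1:] ^ j)))"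
      unfolding radial_laplacian_def d unfolding Suc pderiv_smult d by simp
    also have "[:1, 1:] * smult (real (Suc j) * real (Suc i)) ([:1, 1:] ^ i) = smult (real (Suc j) * real j) ([:1, 1:] ^ j :: real poly)"
      unfolding Suc by (simp only: mult_smult_right power_Suc)
    also have "smult 4 (smult (real (Suc j) * real j) ([:1, 1:] ^ j) + smult b (smult (real (Suc j)) ([:1, 1:] ^ j)))
        = smult (4 * real (Suc j) * (real j + b)) ([:1, 1:] ^ j)"
      unfolding smult_smult smult_add_left[symmetric] by (rule arg_cong[where f = "\<lambda>c. smult c _"]) (simp add: algebra_simps)
    finally show ?thesis .
  qed
qed

lemma radial_X1_power: "radial ([:1, 1:] ^ j) f x = ((norm x)\<^sup>2) ^ j * f x"
  by (simp add: radial_def)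

(* Induction on the degree: the summands r^(2j) Z_j of the Laplacian of f are, up to nonzero constants,
   the Laplacians of r^(2j+2) Z_j, and subtracting these from f leaves a harmonic polynomial. *)
lemma harmonic_decomposition:
  fixes f :: "real^'n::finite \<Rightarrow> real"
  assumes "homog_poly n f"
  shows "\<exists>Z. (\<forall>j. 2 * j \<le> n \<longrightarrow> homog_poly (n - 2 * j) (Z j) \<and> laplacian (Z j) = (\<lambda>x. 0))
     \<and> f = (\<lambda>x. \<Sum>j\<in>{j. 2 * j \<le> n}. radial ([:1, 1:] ^ j) (Z j) x)"
  using assms
proof (induction n arbitrary: f rule: less_induct)
  case (less n)
  show ?case
  proof (cases "n < 2")
    case True
    then have "2 * j \<le> n \<longleftrightarrow> j = 0" for j by auto
    then show ?thesis using less.prems homog_poly_laplacian_less_2[OF less.prems True]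
      by (intro exI[of _ "\<lambda>_. f"]) (simp add: radial_def)
  next
    case False
    have "homog_poly (n - 2) (laplacian f)" by (rule homog_poly_laplacian[OF less.prems])
    moreover have "n - 2 < n" using False by simp
    ultimately obtain W where
      W0: "\<forall>j. 2 * j \<le> n - 2 \<longrightarrow> homog_poly (n - 2 - 2 * j) (W j) \<and> laplacian (W j) = (\<lambda>x. 0)"
      and lf: "laplacian f = (\<lambda>x. \<Sum>j\<in>{j. 2 * j \<le> n - 2}. radial ([:1, 1:] ^ j) (W j) x)"
      using less.IH[of "n - 2" "laplacian f"] by blast
    have W: "homog_poly (n - 2 - 2 * j) (W j)" "laplacian (W j) = (\<lambda>x. 0)" if "2 * j \<le> n - 2" for j
      using W0 that by blast+
    define c where "c j = 4 * real (Suc j) * (real j + (real (n - 2 - 2 * j) + real CARD('n) / 2))" for j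
    have c: "c j > 0" for j unfolding c_def by (intro mult_pos_pos add_nonneg_pos) auto
    define V where "V j = (\<lambda>x. (1 / c j) * W j x)" for j
    have V: "homog_poly (n - 2 - 2 * j) (V j)" "laplacian (V j) = (\<lambda>x. 0)" if "2 * j \<le> n - 2" for j
      using homog_poly_scale[OF W(1)[OF that], of "1 / c j"] laplacian_cmult[OF homog_poly_poly_fun[OF W(1)[OF that]], of "1 / c j"] W(2)[OF that]
      by (simp_all add: V_def)
    define g where "g x = (\<Sum>j\<in>{j. 2 * j \<le> n - 2}. radial ([:1, 1:] ^ Suc j) (V j) x)" for x
    have hg: "homog_poly n g"
      unfolding g_def[abs_def]
    proof (rule homog_poly_sum)
      fix j assume "j \<in> {j. 2 * j \<le> n - 2}"
      then have j: "2 * j \<le> n - 2" by simp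
      have "2 * Suc j + (n - 2 - 2 * j) = n" using j False by auto
      then show "homog_poly n (radial ([:1, 1:] ^ Suc j) (V j))"
        using homog_poly_mult[OF homog_poly_normsq_power[of "Suc j"] V(1)[OF j]] by (simp only: radial_X1_power[abs_def])
    qed
    have lg: "laplacian g = laplacian f"
    proof -
      have "laplacian g = (\<lambda>x. \<Sum>j\<in>{j. 2 * j \<le> n - 2}. laplacian (radial ([:1, 1:] ^ Suc j) (V j)) x)"
        unfolding g_def[abs_def] using V by (intro laplacian_sum poly_fun_radial) (auto intro: homog_poly_poly_fun)
      also have "\<dots> = laplacian f" unfolding lf
      proof (intro ext sum.cong refl)
        fix x j assume "j \<in> {j. 2 * j \<le> n - 2}"
        then have j: "2 * j \<le> n - 2" by simp
        have "laplacian (radial ([:1, 1:] ^ Suc j) (V j)) = radial (smult (c j) ([:1, 1:] ^ j)) (V j)"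
          unfolding laplacian_radial[OF V[OF j]] radial_laplacian_X1_power c_def ..
        then show "laplacian (radial ([:1, 1:] ^ Suc j) (V j)) x = radial ([:1, 1:] ^ j) (W j) x"
          using c[of j] by (simp add: radial_def V_def)
      qed
      finally show ?thesis .
    qed
    define h where "h x = f x + - 1 * g x" for x
    have hh: "homog_poly n h" unfolding h_def[abs_def] by (intro homog_poly.add homog_poly_scale less.prems hg)
    have lh: "laplacian h = (\<lambda>x. 0)"
    proof -
      have "laplacian h = (\<lambda>x. laplacian f x + - 1 * laplacian g x)"
        unfolding h_def[abs_def]
        by (simp only: laplacian_add[OF homog_poly_poly_fun[OF less.prems] homog_poly_poly_fun[OF homog_poly_scale[OF hg, of "- 1"]]]
            laplacian_cmult[OF homog_poly_poly_fun[OF hg]])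
      then show ?thesis by (simp add: lg)
    qed
    define Z where "Z j = (case j of 0 \<Rightarrow> h | Suc i \<Rightarrow> V i)" for j
    have "homog_poly (n - 2 * j) (Z j) \<and> laplacian (Z j) = (\<lambda>x. 0)" if "2 * j \<le> n" for j
    proof (cases j)
      case 0 then show ?thesis by (simp add: Z_def hh lh)
    next
      case (Suc i)
      then have "2 * i \<le> n - 2" "n - 2 * j = n - 2 - 2 * i" using that by auto
      then show ?thesis using V[of i] Suc by (simp add: Z_def)
    qed
    moreover have "f x = (\<Sum>j\<in>{j. 2 * j \<le> n}. radial ([:1, 1:] ^ j) (Z j) x)" for x
    proof -
      have eq: "{j. 2 * j \<le> n} = insert 0 (Suc ` {j. 2 * j \<le> n - 2})"
      proof (intro set_eqI iffI)
        fix j assume "j \<in> {j. 2 * j \<le> n}"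
        then show "j \<in> insert 0 (Suc ` {j. 2 * j \<le> n - 2})" by (cases j) auto
      qed (use False in auto)
      have fin: "finite {j. 2 * j \<le> n - 2}" by (rule finite_subset[of _ "{..n}"]) auto
      have "(\<Sum>j\<in>{j. 2 * j \<le> n}. radial ([:1, 1:] ^ j) (Z j) x) = h x + g x"
        unfolding eq g_def using fin
        by (subst sum.insert) (auto simp: sum.reindex Z_def radial_X1_power radial_def[of 1] simp del: power_Suc)
      then show ?thesis by (simp add: h_def)
    qed
    ultimately show ?thesis by blast
  qed
qed

section \<open>Spanning and orthogonality\<close>

lemma polys_belowI: "homog_poly k f \<Longrightarrow> k < n \<Longrightarrow> f \<in> polys_below n"
  unfolding polys_below_iff
  by (rule exI[of _ "\<lambda>i. if i = k then f else (\<lambda>x. 0)"])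
     (auto simp: fun_eq_iff if_distrib[of "\<lambda>g. g _"] intro: homog_poly.zero cong: if_cong)

lemma polys_below_add: "f \<in> polys_below n \<Longrightarrow> g \<in> polys_below n \<Longrightarrow> (\<lambda>x. f x + g x) \<in> polys_below n"
  unfolding polys_below_iff
proof (elim exE conjE)
  fix h h' assume "\<forall>k<n. homog_poly k (h k)" "\<forall>k<n. homog_poly k (h' k)" "f = (\<lambda>x. \<Sum>k<n. h k x)" "g = (\<lambda>x. \<Sum>k<n. h' k x)"
  then show "\<exists>h. (\<forall>k<n. homog_poly k (h k)) \<and> (\<lambda>x. f x + g x) = (\<lambda>x. \<Sum>k<n. h k x)"
    by (intro exI[of _ "\<lambda>k x. h k x + h' k x"]) (auto simp: sum.distrib intro: homog_poly.add)
qed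

lemma polys_below_zero: "(\<lambda>x. 0) \<in> polys_below n"
  unfolding polys_below_iff by (rule exI[of _ "\<lambda>k x. 0"]) (auto intro: homog_poly.zero)

lemma polys_below_sum: "(\<And>i. i \<in> A \<Longrightarrow> f i \<in> polys_below n) \<Longrightarrow> (\<lambda>x. \<Sum>i\<in>A. f i x) \<in> polys_below n"
  by (induction A rule: infinite_finite_induct) (auto intro: polys_below_add polys_below_zero)

lemma polys_below_poly_fun: "f \<in> polys_below n \<Longrightarrow> real_polynomial_function f"
  unfolding polys_below_iff by (auto intro!: poly_fun_sum intro: homog_poly_poly_fun)

text \<open>A factor |x|^2 moves into f and raises its degree by two, which leaves m + 2i
  unchanged.\<close>

lemma normsq_minus_1_power_mem_polys_below:
  fixes f :: "real^'n::finite \<Rightarrow> real"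
  assumes "homog_poly m f" "m + 2 * i < n"
  shows "(\<lambda>x. ((norm x)\<^sup>2 - 1) ^ i * f x) \<in> polys_below n"
  using assms
proof (induction i arbitrary: m f)
  case 0 then show ?case by (auto intro: polys_belowI)
next
  case (Suc i)
  have "(\<lambda>x. ((norm x)\<^sup>2 - 1) ^ Suc i * f x)
      = (\<lambda>x. ((norm x)\<^sup>2 - 1) ^ i * ((norm x)\<^sup>2 * f x) + ((norm x)\<^sup>2 - 1) ^ i * (- 1 * f x))"
    by (simp add: algebra_simps)
  moreover have "(\<lambda>x. ((norm x)\<^sup>2 - 1) ^ i * ((norm x)\<^sup>2 * f x)) \<in> polys_below n"
    by (rule Suc.IH[OF homog_poly_mult[OF homog_poly_normsq Suc.prems(1)]]) (use Suc.prems in simp)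
  moreover have "(\<lambda>x. ((norm x)\<^sup>2 - 1) ^ i * (- 1 * f x)) \<in> polys_below n"
    by (rule Suc.IH[OF homog_poly_scale[OF Suc.prems(1)]]) (use Suc.prems in simp)
  ultimately show ?case by (simp only: polys_below_add)
qed

lemma radial_mem_polys_below:
  fixes f :: "real^'n::finite \<Rightarrow> real"
  assumes f: "homog_poly m f" and n: "m + 2 * j < n" and p: "\<And>i. i > j \<Longrightarrow> coeff p i = 0"
  shows "radial p f \<in> polys_below n"
proof -
  have "degree p \<le> j" using p by (simp add: degree_le)
  have "(\<lambda>x. ((norm x)\<^sup>2 - 1) ^ i * (coeff p i * f x)) \<in> polys_below n" if "i \<le> degree p" for i
    using \<open>degree p \<le> j\<close> that n by (intro normsq_minus_1_power_mem_polys_below[OF homog_poly_scale[OF f]]) simp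
  then have "(\<lambda>x. \<Sum>i\<le>degree p. ((norm x)\<^sup>2 - 1) ^ i * (coeff p i * f x)) \<in> polys_below n"
    by (intro polys_below_sum) auto
  then show ?thesis by (simp add: radial_as_sum mult.left_commute)
qed

section \<open>The span of the basis polynomials below a given degree\<close>

definition Q_index :: "(nat \<Rightarrow> nat) \<Rightarrow> nat \<Rightarrow> (nat \<times> nat \<times> nat) set" where
  "Q_index a N = {(n, j, l). n < N \<and> 2 * j \<le> n \<and> l \<in> {1..a (n - 2 * j)}}"

definition Q_ix :: "(nat \<Rightarrow> nat \<Rightarrow> real ^ 'n::finite \<Rightarrow> real) \<Rightarrow> nat \<Rightarrow> nat \<times> nat \<times> nat \<Rightarrow> real ^ 'n \<Rightarrow> real" where
  "Q_ix Y s t = (case t of (n, j, l) \<Rightarrow> Q_poly Y s n j l)"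

definition Q_span :: "(nat \<Rightarrow> nat) \<Rightarrow> (nat \<Rightarrow> nat \<Rightarrow> real ^ 'n::finite \<Rightarrow> real) \<Rightarrow> nat \<Rightarrow> nat \<Rightarrow> (real ^ 'n \<Rightarrow> real) set" where
  "Q_span a Y s N = {f. \<exists>c. f = (\<lambda>x. \<Sum>t\<in>Q_index a N. c t * Q_ix Y s t x)}"

lemma finite_Q_index: "finite (Q_index a N)"
proof (rule finite_subset)
  show "Q_index a N \<subseteq> {..N} \<times> {..N} \<times> (\<Union>i\<in>{..N}. {..a i})"
  proof
    fix t assume "t \<in> Q_index a N"
    then obtain n j l where "t = (n, j, l)" "n < N" "2 * j \<le> n" "l \<le> a (n - 2 * j)" "n - 2 * j \<le> N"
      by (auto simp: Q_index_def)
    then show "t \<in> {..N} \<times> {..N} \<times> (\<Union>i\<in>{..N}. {..a i})" by auto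
  qed
qed auto

lemma Q_span_add:
  assumes "f \<in> Q_span a Y s N" "g \<in> Q_span a Y s N"
  shows "(\<lambda>x. f x + g x) \<in> Q_span a Y s N"
proof -
  from assms obtain c c' where "f = (\<lambda>x. \<Sum>t\<in>Q_index a N. c t * Q_ix Y s t x)"
    "g = (\<lambda>x. \<Sum>t\<in>Q_index a N. c' t * Q_ix Y s t x)" by (auto simp: Q_span_def)
  then show ?thesis unfolding Q_span_def
    by (intro CollectI exI[of _ "\<lambda>t. c t + c' t"]) (simp add: sum.distrib distrib_right)
qed

lemma Q_span_scale:
  assumes "f \<in> Q_span a Y s N"
  shows "(\<lambda>x. k * f x) \<in> Q_span a Y s N"
proof -
  from assms obtain c where "f = (\<lambda>x. \<Sum>t\<in>Q_index a N. c t * Q_ix Y s t x)"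
    by (auto simp: Q_span_def)
  then show ?thesis unfolding Q_span_def
    by (intro CollectI exI[of _ "\<lambda>t. k * c t"]) (simp add: sum_distrib_left mult.assoc)
qed

lemma Q_span_zero: "(\<lambda>x. 0) \<in> Q_span a Y s N"
  unfolding Q_span_def by (intro CollectI exI[of _ "\<lambda>t. 0"]) simp

lemma Q_span_sum: "(\<And>i. i \<in> A \<Longrightarrow> f i \<in> Q_span a Y s N) \<Longrightarrow> (\<lambda>x. \<Sum>i\<in>A. f i x) \<in> Q_span a Y s N"
  by (induction A rule: infinite_finite_induct) (auto intro: Q_span_add Q_span_zero)

lemma Q_span_base: "t \<in> Q_index a N \<Longrightarrow> Q_ix Y s t \<in> Q_span a Y s N"
  unfolding Q_span_def
  by (intro CollectI exI[of _ "\<lambda>t'. if t' = t then 1 else 0"])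
     (simp add: if_distrib[of "\<lambda>c. c * _"] finite_Q_index cong: if_cong)

text \<open>Elimination of leading coefficients against \<open>Q_radial\<close>, whose degree is
  exactly j. The bound \<open>J\<close> on the exponents is strict, so the largest polynomial used
  has degree m + 2(J - 1), whence the 2 added to \<open>N\<close>.\<close>

lemma radial_mem_Q_span:
  fixes Y :: "nat \<Rightarrow> nat \<Rightarrow> real^'n::finite \<Rightarrow> real"
  assumes Y: "sph_harm_onb a Y" and l: "l \<in> {1..a m}"
  shows "(\<And>i. i \<ge> J \<Longrightarrow> coeff p i = 0) \<Longrightarrow> m + 2 * J < N + 2 \<Longrightarrow> radial p (Y m l) \<in> Q_span a Y s N"
proof (induction J arbitrary: p)
  case 0
  then have "p = 0" by (intro poly_eqI) simp
  then show ?case by (simp add: radial_def[abs_def] Q_span_zero)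
next
  case (Suc j)
  define q where "q = Q_radial s (real m + real CARD('n) / 2) j"
  have top: "coeff q j \<noteq> 0" unfolding q_def by (rule coeff_Q_radial_top) (simp add: add_nonneg_pos)
  define r where "r = p - smult (coeff p j / coeff q j) q"
  have "coeff r i = 0" if "i \<ge> j" for i
  proof (cases "i = j")
    case True then show ?thesis using top by (simp add: r_def)
  next
    case False then show ?thesis using that Suc.prems(1)[of i] by (simp add: r_def q_def coeff_Q_radial_gt)
  qed
  then have r: "radial r (Y m l) \<in> Q_span a Y s N" using Suc by simp
  have "(m + 2 * j, j, l) \<in> Q_index a N" using l Suc.prems(2) by (simp add: Q_index_def)
  from Q_span_base[OF this, of Y s] have q: "radial q (Y m l) \<in> Q_span a Y s N"
    using Q_poly_eq_radial[OF Y, of l "m + 2 * j" j s] l by (simp add: Q_ix_def q_def)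
  have "radial p (Y m l) = (\<lambda>x. radial r (Y m l) x + coeff p j / coeff q j * radial q (Y m l) x)"
    by (simp add: r_def radial_def fun_eq_iff algebra_simps)
  then show ?case by (simp only: Q_span_add Q_span_scale r q)
qed

lemma homog_poly_mem_Q_span:
  fixes Y :: "nat \<Rightarrow> nat \<Rightarrow> real^'n::finite \<Rightarrow> real"
  assumes Y: "sph_harm_onb a Y" and f: "homog_poly n f" and n: "n < N"
  shows "f \<in> Q_span a Y s N"
proof -
  obtain Z where Z: "\<forall>j. 2 * j \<le> n \<longrightarrow> homog_poly (n - 2 * j) (Z j) \<and> laplacian (Z j) = (\<lambda>x. 0)"
    and feq: "f = (\<lambda>x. \<Sum>j\<in>{j. 2 * j \<le> n}. radial ([:1, 1:] ^ j) (Z j) x)"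
    using harmonic_decomposition[OF f] by blast
  show ?thesis unfolding feq
  proof (rule Q_span_sum)
    fix j assume "j \<in> {j. 2 * j \<le> n}"
    then have j: "2 * j \<le> n" by simp
    then have "Z j \<in> harm_polys (n - 2 * j)" using Z by (simp add: harm_polys_def homog_poly_iff_homog)
    then obtain c where c: "Z j = (\<lambda>x. \<Sum>l=1..a (n - 2 * j). c l * Y (n - 2 * j) l x)"
      using Y unfolding sph_harm_onb_def by blast
    have "radial ([:1, 1:] ^ j) (Z j) = (\<lambda>x. \<Sum>l=1..a (n - 2 * j). c l * radial ([:1, 1:] ^ j) (Y (n - 2 * j) l) x)"
      by (simp add: radial_def c fun_eq_iff sum_distrib_left mult.left_commute)
    moreover have "radial ([:1, 1:] ^ j) (Y (n - 2 * j) l) \<in> Q_span a Y s N" if "l \<in> {1..a (n - 2 * j)}" for l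
      using j n by (intro radial_mem_Q_span[OF Y that, where J = "Suc j"]) (auto simp: coeff_X1_power)
    ultimately show "radial ([:1, 1:] ^ j) (Z j) \<in> Q_span a Y s N"
      by (simp only: Q_span_sum Q_span_scale)
  qed
qed

lemma polys_below_subset_Q_span:
  assumes "sph_harm_onb a Y" "f \<in> polys_below N"
  shows "f \<in> Q_span a Y s N"
  using assms(2) unfolding polys_below_iff by (auto intro!: Q_span_sum homog_poly_mem_Q_span[OF assms(1)])

lemma Q_poly_mem_polys_below:
  assumes "sph_harm_onb a Y" "l \<in> {1..a (n - 2 * j)}" "2 * j \<le> n" "n < N"
  shows "Q_poly Y s n j l \<in> polys_below N"
  unfolding Q_poly_eq_radial[OF assms(1-3)]
  using assms(3,4) by (intro radial_mem_polys_below[OF sph_harm_onbD(1)[OF assms(1,2)], where j = j]) (auto simp: coeff_Q_radial_gt)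

theorem theorem3p8:
  fixes s :: nat and lam :: "nat \<Rightarrow> real" and n :: nat
    and a :: "nat \<Rightarrow> nat" and Y :: "nat \<Rightarrow> nat \<Rightarrow> real ^ 'n::finite \<Rightarrow> real"
  assumes s_pos: "1 \<le> s"
    and lam_pos: "\<And>k. k < ceil_half s \<Longrightarrow> lam k > 0"
    and Y_onb: "sph_harm_onb a Y"
  shows
    "(\<forall>j l. 2 * j \<le> n \<and> l \<in> {1..a (n - 2 * j)} \<longrightarrow> Q_poly Y s n j l \<in> V_space s lam n)
     \<and> (\<forall>P \<in> V_space s lam n. \<exists>c. P = (\<lambda>x. \<Sum>(j, l) \<in> {(j, l). 2 * j \<le> n \<and> l \<in> {1..a (n - 2 * j)}}.
                                                c j l * Q_poly Y s n j l x))
     \<and> (\<forall>c. (\<lambda>x. \<Sum>(j, l) \<in> {(j, l). 2 * j \<le> n \<and> l \<in> {1..a (n - 2 * j)}}. c j l * Q_poly Y s n j l x)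
              = (\<lambda>x. 0)
           \<longrightarrow> (\<forall>j l. 2 * j \<le> n \<and> l \<in> {1..a (n - 2 * j)} \<longrightarrow> c j l = 0))
     \<and> (\<forall>n' j l j' l'. 2 * j \<le> n \<and> l \<in> {1..a (n - 2 * j)} \<and> 2 * j' \<le> n' \<and> l' \<in> {1..a (n' - 2 * j')} \<longrightarrow>
          sob_ip s lam (Q_poly Y s n j l) (Q_poly Y s n' j' l')
          = (if n = n' \<and> j = j' \<and> l = l' then h_const TYPE('n) s lam j n else 0))"
proof -
  define I where "I = {(j, l). 2 * j \<le> n \<and> l \<in> {1..a (n - 2 * j)}}"
  note orth = sob_ip_Q_poly[OF Y_onb s_pos]
  have orth_ix: "sob_ip s lam (Q_ix Y s t) (Q_ix Y s t')
      = (if t = t' then h_const TYPE('n) s lam (fst (snd t)) (fst t) else 0)"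
    if "t \<in> Q_index a N" "t' \<in> Q_index a N'" for t t' N N'
    using that orth by (auto simp: Q_index_def Q_ix_def split: prod.splits)
  have h_ix: "h_const TYPE('n) s lam (fst (snd t)) (fst t) > 0" if "t \<in> Q_index a N" for t N
    using that h_const_pos[where lam = lam and s = s and 'n = 'n] lam_pos by (auto simp: Q_index_def)
  have poly_fun_ix: "real_polynomial_function (Q_ix Y s t)" if "t \<in> Q_index a N" for t N
    using that polys_below_poly_fun[OF Q_poly_mem_polys_below[OF Y_onb]] by (auto simp: Q_index_def Q_ix_def)
  \<comment> \<open>Pairing with a basis element isolates its coefficient; both uniqueness arguments
    below rest on this.\<close>
  have ip_sum: "sob_ip s lam (\<lambda>x. \<Sum>t\<in>Q_index a N. c t * Q_ix Y s t x) (Q_ix Y s t')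
      = c t' * h_const TYPE('n) s lam (fst (snd t')) (fst t')" if "t' \<in> Q_index a N" for c t' N
  proof -
    have "sob_ip s lam (\<lambda>x. \<Sum>t\<in>Q_index a N. c t * Q_ix Y s t x) (Q_ix Y s t')
       = (\<Sum>t\<in>Q_index a N. c t * sob_ip s lam (Q_ix Y s t) (Q_ix Y s t'))"
      by (rule sob_ip_sum) (use poly_fun_ix that in auto)
    also have "\<dots> = (\<Sum>t\<in>Q_index a N. if t = t' then c t' * h_const TYPE('n) s lam (fst (snd t')) (fst t') else 0)"
      by (intro sum.cong refl) (auto simp: orth_ix[OF _ that])
    finally show ?thesis using that by (simp add: finite_Q_index)
  qed
  have inj: "inj_on (\<lambda>(j, l). (n, j, l)) I" by (auto simp: inj_on_def)
  have sub: "(\<lambda>(j, l). (n, j, l)) ` I \<subseteq> Q_index a (Suc n)" by (auto simp: I_def Q_index_def)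
  \<comment> \<open>Once the coefficients of total degree below n vanish, only the index set of the
    theorem remains.\<close>
  have sum_I: "(\<Sum>t\<in>Q_index a (Suc n). c t * Q_ix Y s t x) = (\<Sum>(j, l)\<in>I. c (n, j, l) * Q_poly Y s n j l x)"
    if "\<And>t. t \<in> Q_index a n \<Longrightarrow> c t = 0" for c x
  proof -
    have "(\<Sum>t\<in>Q_index a (Suc n). c t * Q_ix Y s t x) = (\<Sum>t\<in>(\<lambda>(j, l). (n, j, l)) ` I. c t * Q_ix Y s t x)"
    proof (rule sum.mono_neutral_right[OF finite_Q_index sub], intro ballI)
      fix t assume "t \<in> Q_index a (Suc n) - (\<lambda>(j, l). (n, j, l)) ` I"
      then have "t \<in> Q_index a n" by (force simp: Q_index_def I_def image_iff less_Suc_eq)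
      then show "c t * Q_ix Y s t x = 0" using that by simp
    qed
    also have "\<dots> = (\<Sum>(j, l)\<in>I. c (n, j, l) * Q_poly Y s n j l x)"
      by (subst sum.reindex[OF inj]) (simp add: Q_ix_def case_prod_unfold)
    finally show ?thesis .
  qed
  have mem: "Q_poly Y s n j l \<in> V_space s lam n" if "2 * j \<le> n" "l \<in> {1..a (n - 2 * j)}" for j l
    unfolding V_space_def Pi_d_def
  proof (intro CollectI conjI ballI)
    show "Q_poly Y s n j l \<in> polys_below (Suc n)" by (rule Q_poly_mem_polys_below[OF Y_onb that(2,1)]) simp
    fix R :: "real^'n \<Rightarrow> real" assume "R \<in> polys_below n"
    then have "R \<in> Q_span a Y s n" by (rule polys_below_subset_Q_span[OF Y_onb])
    then obtain c where R: "R = (\<lambda>x. \<Sum>t\<in>Q_index a n. c t * Q_ix Y s t x)" by (auto simp: Q_span_def)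
    have t: "(n, j, l) \<in> Q_index a (Suc n)" using that by (simp add: Q_index_def)
    have "sob_ip s lam R (Q_ix Y s (n, j, l)) = (\<Sum>t\<in>Q_index a n. c t * sob_ip s lam (Q_ix Y s t) (Q_ix Y s (n, j, l)))"
      unfolding R by (rule sob_ip_sum) (use poly_fun_ix t in auto)
    also have "\<dots> = 0"
    proof (intro sum.neutral ballI)
      fix t' assume t': "t' \<in> Q_index a n"
      then have "t' \<noteq> (n, j, l)" by (auto simp: Q_index_def)
      then show "c t' * sob_ip s lam (Q_ix Y s t') (Q_ix Y s (n, j, l)) = 0" by (simp add: orth_ix[OF t' t])
    qed
    finally show "sob_ip s lam (Q_poly Y s n j l) R = 0" by (simp add: Q_ix_def sob_ip_commute)
  qed
  have span: "\<exists>c. P = (\<lambda>x. \<Sum>(j, l)\<in>I. c j l * Q_poly Y s n j l x)" if P: "P \<in> V_space s lam n" for P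
  proof -
    have "P \<in> Q_span a Y s (Suc n)"
      using P by (intro polys_below_subset_Q_span[OF Y_onb]) (simp add: V_space_def Pi_d_def)
    then obtain c where c: "P = (\<lambda>x. \<Sum>t\<in>Q_index a (Suc n). c t * Q_ix Y s t x)" by (auto simp: Q_span_def)
    \<comment> \<open>Basis elements of lower degree lie in \<open>polys_below n\<close>, so P is
      orthogonal to them, and their positive norm forces the coefficient to vanish.\<close>
    have "c t = 0" if t: "t \<in> Q_index a n" for t
    proof -
      have t': "t \<in> Q_index a (Suc n)" using t by (auto simp: Q_index_def)
      have "Q_ix Y s t \<in> polys_below n"
        using t Q_poly_mem_polys_below[OF Y_onb] by (auto simp: Q_index_def Q_ix_def)
      then have "sob_ip s lam P (Q_ix Y s t) = 0" using P by (simp add: V_space_def)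
      then show ?thesis using ip_sum[OF t', of c] h_ix[OF t'] by (simp add: c)
    qed
    from sum_I[OF this] have "P = (\<lambda>x. \<Sum>(j, l)\<in>I. c (n, j, l) * Q_poly Y s n j l x)" by (simp add: c)
    then show ?thesis by (intro exI[of _ "\<lambda>j l. c (n, j, l)"])
  qed
  have indep: "c j l = 0"
    if c: "(\<lambda>x. \<Sum>(j, l)\<in>I. c j l * Q_poly Y s n j l x) = (\<lambda>x. 0)" and jl: "2 * j \<le> n" "l \<in> {1..a (n - 2 * j)}" for c j l
  proof -
    \<comment> \<open>Padding by zero in lower degrees makes the coefficient formula
      \<open>ip_sum\<close> applicable.\<close>
    define c' where "c' t = (case t of (n', j, l) \<Rightarrow> if n' = n then c j l else 0)" for t
    have t: "(n, j, l) \<in> Q_index a (Suc n)" using jl by (simp add: Q_index_def)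
    have "(\<lambda>x. \<Sum>t\<in>Q_index a (Suc n). c' t * Q_ix Y s t x) = (\<lambda>x. 0)"
      using c by (subst sum_I) (auto simp: c'_def Q_index_def)
    with ip_sum[OF t, of c'] have "c j l * h_const TYPE('n) s lam j n = 0"
      by (simp add: sob_ip_zero c'_def)
    with h_ix[OF t] show ?thesis by simp
  qed
  show ?thesis unfolding I_def[symmetric]
    by (intro conjI allI ballI impI) (use mem span indep orth in \<open>blast+\<close>)
qed

end
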